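(* Let $X$ be a complex Banach space and $T\in\mathcal{B}(X)$. Then $$\sigma_{LBF^{-}}(T)=\bigcap_{F\in\mathcal{F}(X)}\sigma_{LD}(T+F),$$ $$\sigma_{RBF^{-}}(T)=\bigcap_{F\in\mathcal{F}(X)}\sigma_{RD}(T+F),$$ and $$\sigma_{BW}(T)=\bigcap_{F\in\mathcal{F}(X)}\sigma_{D}(T+F).$$
   Context: $\mathcal{B}(X)$ is the algebra of bounded linear operators on $X$, $\mathcal{F}(X)$ its ideal of finite rank operators, and $\mathcal{N}(T),\mathcal{R}(T)$ are the null space and range of $T$. A closed subspace is topologically complemented if it has a closed complement. Drazin notions. $T$ is left Drazin invertible if there are $S\in\mathcal{B}(X)$ and an integer $j\ge 0$ with $TST=ST^2$, $S^2T=S$, $ST^{j+1}=T^j$; right Drazin invertible if there are $S\in\mathcal{B}(X)$ and $j\ge 0$ with $TST=T^2S$, $TS^2=S$, $T^{j+1}S=T^j$; Drazin invertible if there are $S\in\mathcal{B}(X)$ and $j\ge 0$ with $TS=ST$, $S^2T=S$, $T^{j+1}S=T^j$. Then $\sigma_{LD}(T)$, $\sigma_{RD}(T)$, $\sigma_D(T)$ are the sets of $\lambda\in\mathbb{C}$ such that $\lambda I-T$ is not left Drazin invertible, not right Drazin invertible, not Drazin invertible, respectively. B-Fredholm notions. $T$ is upper semi Fredholm if $\mathcal{R}(T)$ is closed and $\dim\mathcal{N}(T)<\infty$; lower semi Fredholm if $\dim X/\mathcal{R}(T)<\infty$; Fredholm if both. For a semi Fredholm operator, the index is $\dim\mathcal{N}(T)-\dim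 X/\mathcal{R}(T)\in\mathbb{Z}\cup\{\pm\infty\}$. $T$ is B-Fredholm (resp. upper, lower semi B-Fredholm) if for some integer $n\ge 0$ the space $\mathcal{R}(T^n)$ is closed and the restriction $T|_{\mathcal{R}(T^n)}:\mathcal{R}(T^n)\to\mathcal{R}(T^n)$ is Fredholm (resp. upper, lower semi Fredholm); its index is $\mathrm{ind}(T):=\mathrm{ind}(T|_{\mathcal{R}(T^n)})$, which does not depend on the choice of such $n$. Let $\mathrm{dis}(T)$ be the infimum of all $n\in\mathbb{N}$ such that $\mathcal{N}(T)\cap\mathcal{R}(T^n)=\mathcal{N}(T)\cap\mathcal{R}(T^m)$ for all $m\ge n$ ($\infty$ if there is none). $T$ is left B-Fredholm if $d:=\mathrm{dis}(T)<\infty$, $\mathcal{N}(T)\cap\mathcal{R}(T^d)$ is finite dimensional and $\mathcal{R}(T)+\mathcal{N}(T^d)$ is topologically complemented in $X$ (such $T$ is upper semi B-Fredholm). $T$ is right B-Fredholm if $d:=\mathrm{dis}(T)<\infty$, $\mathcal{R}(T)+\mathcal{N}(T^d)$ is closed of finite codimension and $\mathcal{N}(T)\cap\mathcal{R}(T^d)$ is topologically complemented in $X$ (such $T$ is lower semi B-Fredholm). Spectra. $\sigma_{LBF^{-}}(T)$ is the set of $\lambda\in\mathbb{C}$ for which it fails that $\lambda I-T$ is left B-Fredholm with $\mathrm{ind}(\lambda I-T)\le 0$. $\sigma_{RBF^{-}}(T)$ is the set of $\lambda\in\mathbb{C}$ for which it fails that $\lambda I-T$ is right B-Fredholm with $\mathrm{ind}(\lambda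 I-T)\ge 0$. $\sigma_{BW}(T)$ (the B-Weyl spectrum) is the set of $\lambda\in\mathbb{C}$ for which it fails that $\lambda I-T$ is B-Fredholm with $\mathrm{ind}(\lambda I-T)=0$. *)

theory Defs
  imports "HOL-Analysis.Analysis"
begin

section \<open>Complex Banach spaces\<close>

text \<open>The library has real Banach spaces only. A complex one is a real one with a compatible
  complex scalar multiplication; the unit law follows from \<open>scaleR_scaleC\<close>.\<close>

class complex_vector = real_vector +
  fixes scaleC :: "complex \<Rightarrow> 'a \<Rightarrow> 'a"  (infixr \<open>*\<^sub>C\<close> 75)
  assumes scaleC_add_right: "a *\<^sub>C (x + y) = a *\<^sub>C x + a *\<^sub>C y"
    and scaleC_add_left: "(a + b) *\<^sub>C x = a *\<^sub>C x + b *\<^sub>C x"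
    and scaleC_scaleC: "a *\<^sub>C b *\<^sub>C x = (a * b) *\<^sub>C x"
    and scaleR_scaleC: "r *\<^sub>R x = complex_of_real r *\<^sub>C x"

class complex_normed_vector = complex_vector + real_normed_vector +
  assumes norm_scaleC: "norm (a *\<^sub>C x) = cmod a * norm x"

class complex_banach = complex_normed_vector + banach

instantiation complex :: complex_banach
begin

definition scaleC_complex :: "complex \<Rightarrow> complex \<Rightarrow> complex"
  where "scaleC_complex a x = a * x"

instance
  by standard (auto simp: scaleC_complex_def algebra_simps norm_mult scaleR_conv_of_real)

end

lemma scaleC_one: "1 *\<^sub>C x = (x :: 'a :: complex_vector)"
  using scaleR_scaleC[of 1 x] by simp

global_interpretation complex_vector: vector_space "scaleC :: complex \<Rightarrow> 'a \<Rightarrow> 'a :: complex_vector"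
  defines csubspace = complex_vector.subspace
    and cspan = complex_vector.span
  by standard (auto simp: scaleC_add_right scaleC_add_left scaleC_scaleC scaleC_one)


section \<open>Dimensions, complements and operators\<close>

text \<open>The library's \<open>dim\<close> is \<open>0\<close> on infinite-dimensional spaces, hence the case distinction.\<close>

definition cdimension :: "'a::complex_vector set \<Rightarrow> enat" where
  "cdimension V =
     (if \<exists>B. finite B \<and> cspan B = V then enat (complex_vector.dim V) else \<infinity>)"

text \<open>\<open>B\<close> is a set of representatives, one per basis vector, of a basis of \<open>M / N\<close>
  (for subspaces \<open>N \<subseteq> M\<close>): the cosets of \<open>B\<close> span \<open>M / N\<close>, and no \<open>b \<in> B\<close> lies, modulo \<open>N\<close>, in
  the span of the others.\<close>

definition quotient_basis :: "'a::complex_vector set \<Rightarrow> 'a set \<Rightarrow> 'a set \<Rightarrow> bool" where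
  "quotient_basis M N B \<longleftrightarrow>
     B \<subseteq> M \<and> M = cspan B + N \<and> (\<forall>b\<in>B. b \<notin> cspan (B - {b}) + N)"

text \<open>\<open>dim (M / N)\<close>. All bases have the same cardinality, and the infimum of the empty set
  is \<open>\<infinity>\<close>.\<close>

definition quotient_dimension :: "'a::complex_vector set \<Rightarrow> 'a set \<Rightarrow> enat" where
  "quotient_dimension M N = (INF B \<in> {B. finite B \<and> quotient_basis M N B}. enat (card B))"

definition topologically_complemented :: "'a::complex_normed_vector set \<Rightarrow> bool" where
  "topologically_complemented M \<longleftrightarrow> csubspace M \<and> closed M \<and>
     (\<exists>N. csubspace N \<and> closed N \<and> M \<inter> N = {0} \<and> M + N = UNIV)"

definition bounded_clinear ::
    "('a::complex_normed_vector \<Rightarrow> 'b::complex_normed_vector) \<Rightarrow> bool" where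
  "bounded_clinear T \<longleftrightarrow> bounded_linear T \<and> (\<forall>c x. T (c *\<^sub>C x) = c *\<^sub>C T x)"

definition finite_rank_operators :: "('a::complex_normed_vector \<Rightarrow> 'a) set" where
  "finite_rank_operators = {F. bounded_clinear F \<and> cdimension (range F) < \<infinity>}"

definition null_space :: "('a \<Rightarrow> 'b::zero) \<Rightarrow> 'a set" where
  "null_space T = {x. T x = 0}"


section \<open>Drazin invertibility\<close>

definition left_drazin_invertible :: "('a::complex_normed_vector \<Rightarrow> 'a) \<Rightarrow> bool" where
  "left_drazin_invertible T \<longleftrightarrow> (\<exists>S j. bounded_clinear S \<and>
     T \<circ> S \<circ> T = S \<circ> T ^^ 2 \<and> S ^^ 2 \<circ> T = S \<and> S \<circ> T ^^ (j + 1) = T ^^ j)"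

definition right_drazin_invertible :: "('a::complex_normed_vector \<Rightarrow> 'a) \<Rightarrow> bool" where
  "right_drazin_invertible T \<longleftrightarrow> (\<exists>S j. bounded_clinear S \<and>
     T \<circ> S \<circ> T = T ^^ 2 \<circ> S \<and> T \<circ> S ^^ 2 = S \<and> T ^^ (j + 1) \<circ> S = T ^^ j)"

definition drazin_invertible :: "('a::complex_normed_vector \<Rightarrow> 'a) \<Rightarrow> bool" where
  "drazin_invertible T \<longleftrightarrow> (\<exists>S j. bounded_clinear S \<and>
     T \<circ> S = S \<circ> T \<and> S ^^ 2 \<circ> T = S \<and> T ^^ (j + 1) \<circ> S = T ^^ j)"


section \<open>Fredholm and B-Fredholm operators\<close>

text \<open>The notions are stated for the restriction \<open>T : M \<rightarrow> M\<close> of \<open>T\<close> to a closed subspace \<open>M\<close> with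
  \<open>T ` M \<subseteq> M\<close>; this restriction has null space \<open>null_space T \<inter> M\<close> and range \<open>T ` M\<close>.\<close>

definition upper_semi_fredholm_on :: "'a::complex_normed_vector set \<Rightarrow> ('a \<Rightarrow> 'a) \<Rightarrow> bool" where
  "upper_semi_fredholm_on M T \<longleftrightarrow>
     closedin (top_of_set M) (T ` M) \<and> cdimension (null_space T \<inter> M) < \<infinity>"

definition lower_semi_fredholm_on :: "'a::complex_normed_vector set \<Rightarrow> ('a \<Rightarrow> 'a) \<Rightarrow> bool" where
  "lower_semi_fredholm_on M T \<longleftrightarrow> quotient_dimension M (T ` M) < \<infinity>"

definition fredholm_on :: "'a::complex_normed_vector set \<Rightarrow> ('a \<Rightarrow> 'a) \<Rightarrow> bool" where
  "fredholm_on M T \<longleftrightarrow> upper_semi_fredholm_on M T \<and> lower_semi_fredholm_on M T"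

text \<open>Meaningful for semi Fredholm restrictions only, where at most one term is infinite.\<close>

definition fredholm_index_on :: "'a::complex_normed_vector set \<Rightarrow> ('a \<Rightarrow> 'a) \<Rightarrow> ereal" where
  "fredholm_index_on M T =
     ereal_of_enat (cdimension (null_space T \<inter> M)) - ereal_of_enat (quotient_dimension M (T ` M))"

definition b_fredholm :: "('a::complex_normed_vector \<Rightarrow> 'a) \<Rightarrow> bool" where
  "b_fredholm T \<longleftrightarrow> (\<exists>n. closed (range (T ^^ n)) \<and> fredholm_on (range (T ^^ n)) T)"

text \<open>The index of an upper or lower semi B-Fredholm operator: the common value of the indices of
  all its semi Fredholm restrictions to closed ranges of powers.\<close>

definition b_fredholm_index :: "('a::complex_normed_vector \<Rightarrow> 'a) \<Rightarrow> ereal" where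
  "b_fredholm_index T = (THE i. \<exists>n. closed (range (T ^^ n)) \<and>
     (upper_semi_fredholm_on (range (T ^^ n)) T \<or> lower_semi_fredholm_on (range (T ^^ n)) T) \<and>
     i = fredholm_index_on (range (T ^^ n)) T)"

definition dis :: "('a::complex_normed_vector \<Rightarrow> 'a) \<Rightarrow> enat" where
  "dis T = (INF n \<in> {n. \<forall>m\<ge>n. null_space T \<inter> range (T ^^ n) = null_space T \<inter> range (T ^^ m)}.
     enat n)"

definition left_b_fredholm :: "('a::complex_normed_vector \<Rightarrow> 'a) \<Rightarrow> bool" where
  "left_b_fredholm T \<longleftrightarrow> (\<exists>d. dis T = enat d \<and>
     cdimension (null_space T \<inter> range (T ^^ d)) < \<infinity> \<and>
     topologically_complemented (range T + null_space (T ^^ d)))"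

definition right_b_fredholm :: "('a::complex_normed_vector \<Rightarrow> 'a) \<Rightarrow> bool" where
  "right_b_fredholm T \<longleftrightarrow> (\<exists>d. dis T = enat d \<and>
     closed (range T + null_space (T ^^ d)) \<and>
     quotient_dimension UNIV (range T + null_space (T ^^ d)) < \<infinity> \<and>
     topologically_complemented (null_space T \<inter> range (T ^^ d)))"


section \<open>Spectra\<close>

definition shifted_op :: "complex \<Rightarrow> ('a::complex_normed_vector \<Rightarrow> 'a) \<Rightarrow> 'a \<Rightarrow> 'a" where
  "shifted_op \<mu> T = (\<lambda>x. \<mu> *\<^sub>C x - T x)"

definition left_drazin_spectrum :: "('a::complex_normed_vector \<Rightarrow> 'a) \<Rightarrow> complex set" where
  "left_drazin_spectrum T = {\<mu>. \<not> left_drazin_invertible (shifted_op \<mu> T)}"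

definition right_drazin_spectrum :: "('a::complex_normed_vector \<Rightarrow> 'a) \<Rightarrow> complex set" where
  "right_drazin_spectrum T = {\<mu>. \<not> right_drazin_invertible (shifted_op \<mu> T)}"

definition drazin_spectrum :: "('a::complex_normed_vector \<Rightarrow> 'a) \<Rightarrow> complex set" where
  "drazin_spectrum T = {\<mu>. \<not> drazin_invertible (shifted_op \<mu> T)}"

definition left_b_fredholm_minus_spectrum :: "('a::complex_normed_vector \<Rightarrow> 'a) \<Rightarrow> complex set" where
  "left_b_fredholm_minus_spectrum T =
     {\<mu>. \<not> (left_b_fredholm (shifted_op \<mu> T) \<and> b_fredholm_index (shifted_op \<mu> T) \<le> 0)}"

definition right_b_fredholm_minus_spectrum :: "('a::complex_normed_vector \<Rightarrow> 'a) \<Rightarrow> complex set" where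
  "right_b_fredholm_minus_spectrum T =
     {\<mu>. \<not> (right_b_fredholm (shifted_op \<mu> T) \<and> b_fredholm_index (shifted_op \<mu> T) \<ge> 0)}"

definition b_weyl_spectrum :: "('a::complex_normed_vector \<Rightarrow> 'a) \<Rightarrow> complex set" where
  "b_weyl_spectrum T =
     {\<mu>. \<not> (b_fredholm (shifted_op \<mu> T) \<and> b_fredholm_index (shifted_op \<mu> T) = 0)}"

end

theory Submission
  imports Defs
begin

text \<open>Fix \<open>\<mu>\<close> and put \<open>A = \<mu> - T\<close>. If \<open>L = A + F\<close> is left Drazin invertible with
  \<open>F\<close> of finite rank, then \<open>A ^^ n\<close> and \<open>L ^^ n\<close> differ by a finite rank operator, so their ranges and
  null spaces agree up to finite dimensions. For large \<open>n\<close> the operator \<open>L\<close> is injective on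
  \<open>range (L ^^ n)\<close> and \<open>range L + null_space (L ^^ n)\<close> is complemented; comparing \<open>A\<close> and \<open>L\<close> on a common
  subspace of finite codimension of \<open>range (A ^^ n)\<close> and \<open>range (L ^^ n)\<close> on which they coincide gives the
  left B-Fredholm property of \<open>A\<close> and the sign of its index.

  Conversely let \<open>d = dis A\<close>. Neubauer's lemma shows that \<open>W = range (A ^^ d)\<close> is closed, and since the
  index is nonpositive there is a finite rank \<open>F\<close> with values in \<open>W\<close> that maps the kernel of \<open>A\<close> in \<open>W\<close>
  injectively into a complement of \<open>A ` W\<close>. Then \<open>B = A + F\<close> is injective on \<open>W\<close>, which contains
  \<open>range (B ^^ d)\<close>, so \<open>B\<close> has finite ascent, and a complement of \<open>range B + null_space (B ^^ d)\<close> generates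
  a \<open>B\<close>-invariant complement of \<open>null_space (B ^^ d)\<close> on which \<open>B\<close> is left invertible. The right-hand
  statement is dual, with \<open>F\<close> making \<open>B\<close> surjective on \<open>W\<close>, and an index equal to zero allows both
  at once.\<close>

section \<open>Hahn--Banach separation\<close>

text \<open>The one-sided notions control only \<open>range A + null_space (A ^^ d)\<close> and
  \<open>null_space A \<inter> range (A ^^ d)\<close>, while \<open>b_fredholm_index\<close> sees
  only exponents whose range is closed; Neubauer's lemma is what lets the sign of the index speak
  about \<open>W\<close>. In the B-Weyl case closedness comes with the definition, and any
  admissible exponent takes the place of \<open>dis A\<close>. Nullity or defect may be infinite in
  the one-sided cases, so dimension identities stay additive in \<open>enat\<close> and only finite
  terms are cancelled. Values of \<open>F\<close> in \<open>W\<close> make the powers of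
  \<open>B\<close> and \<open>A\<close> differ by maps into \<open>W\<close>; hence
  \<open>B ^^ d\<close> maps into \<open>W\<close>, and it suffices to know \<open>B\<close> on
  \<open>W\<close>. The coefficients of \<open>F\<close> are functionals on the whole space, so
  \<open>F\<close> is bounded there although \<open>W\<close> need not be complemented. In the other
  direction \<open>dis A\<close> may lie below the exponents at which \<open>L\<close> behaves well;
  both spaces above are constant from \<open>dis A\<close> on, which carries the conclusions down.
  Bounds for the one-sided inverses come from the open mapping theorem, applied to the sum map of a
  decomposition.\<close>

lemmas csubspace_0 = complex_vector.subspace_0
  and csubspace_UNIV = complex_vector.subspace_UNIV
  and csubspace_add = complex_vector.subspace_add
  and csubspace_diff = complex_vector.subspace_diff
  and csubspace_neg = complex_vector.subspace_neg
  and csubspace_scale = complex_vector.subspace_scale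

lemma scaleC_minus1: "(-1) *\<^sub>C x = - (x :: 'a :: complex_vector)"
  using scaleR_scaleC[of "-1" x] by simp

lemma csubspace_imp_subspace: "csubspace V \<Longrightarrow> subspace V"
  by (auto simp: subspace_def scaleR_scaleC csubspace_0
      csubspace_add csubspace_scale)

text \<open>With the next lemma, the distance to \<open>N\<close> becomes a sublinear gauge; a
  functional dominated by it must vanish on \<open>N\<close>.\<close>

lemma infdist_subspace_add:
  fixes N :: "'a::real_normed_vector set"
  assumes "subspace N"
  shows "infdist (x + y) N \<le> infdist x N + infdist y N"
proof (rule field_le_epsilon)
  fix e :: real assume "e > 0"
  have ne: "N \<noteq> {}" using subspace_0[OF assms] by auto
  have "\<exists>n\<in>N. dist z n < infdist z N + e/2" for z
    using infdist_attains_inf cInf_lessD[of "{dist z a |a. a \<in> N}" "infdist z N + e/2"] \<open>e>0\<close> ne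
    by (force simp: infdist_notempty[OF ne] setcompr_eq_image)
  then obtain a b where ab: "a \<in> N" "dist x a < infdist x N + e/2" "b \<in> N" "dist y b < infdist y N + e/2"
    by meson
  have "infdist (x+y) N \<le> dist (x+y) (a+b)"
    using ab assms by (intro infdist_le subspace_add) auto
  also have "\<dots> \<le> dist x a + dist y b" by (rule dist_triangle_add)
  finally show "infdist (x+y) N \<le> infdist x N + infdist y N + e" using ab by linarith
qed

lemma infdist_subspace_scaleR:
  fixes N :: "'a::real_normed_vector set"
  assumes "subspace N" "r > 0"
  shows "infdist (r *\<^sub>R x) N = r * infdist x N"
proof -
  have ne: "N \<noteq> {}" using subspace_0[OF assms(1)] by auto
  have le: "infdist (r *\<^sub>R x) N \<le> r * infdist x N" if "r > 0" for r and x :: 'a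
  proof -
    have "infdist (r *\<^sub>R x) N / r \<le> infdist x N"
      unfolding infdist_notempty[OF ne, of x]
    proof (rule cINF_greatest[OF ne])
      fix n assume n: "n \<in> N"
      have "infdist (r *\<^sub>R x) N \<le> dist (r *\<^sub>R x) (r *\<^sub>R n)"
        using n assms by (intro infdist_le subspace_scale)
      also have "\<dots> = r * dist x n" using that by (simp add: dist_norm flip: scaleR_diff_right)
      finally show "infdist (r *\<^sub>R x) N / r \<le> dist x n" using that by (simp add: divide_simps mult.commute)
    qed
    then show ?thesis using that by (simp add: divide_simps mult.commute)
  qed
  have "infdist x N \<le> (1/r) * infdist (r *\<^sub>R x) N"
    using le[of "1/r" "r *\<^sub>R x"] assms by simp
  with le[of r x] assms show ?thesis by (simp add: field_simps)
qed

text \<open>Zorn's lemma is applied to graphs of dominated functionals; domination by \<open>p\<close> alone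
  makes such a graph single-valued.\<close>

lemma hahn_banach_dominated:
  fixes p :: "'a::real_vector \<Rightarrow> real"
  assumes add: "\<And>x y. p (x + y) \<le> p x + p y"
    and scale: "\<And>r x. r > 0 \<Longrightarrow> p (r *\<^sub>R x) = r * p x"
  shows "\<exists>f. linear f \<and> (\<forall>x. f x \<le> p x) \<and> f v = p v"
proof -
  have p0: "p 0 = 0" using scale[of 2 0] by simp
  define G where "G = {g :: ('a \<times> real) set. subspace g \<and> (\<forall>(x,t)\<in>g. t \<le> p x) \<and> (v, p v) \<in> g}"
  \<comment> \<open>Zorn starts from the line through \<open>(v, p v)\<close>; for negative
    \<open>s\<close> domination follows from 0 = p 0 \<le> p (s v) + p (- s v).\<close>
  have init: "range (\<lambda>s. s *\<^sub>R (v, p v)) \<in> G"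
  proof -
    have "s * p v \<le> p (s *\<^sub>R v)" for s
    proof (cases "s < 0")
      case True
      then show ?thesis using add[of "s *\<^sub>R v" "(-s) *\<^sub>R v"] scale[of "-s" v] p0 by simp
    next
      case False
      then show ?thesis using scale[of s v] p0 by (cases "s = 0") auto
    qed
    moreover have "subspace (range (\<lambda>s. s *\<^sub>R (v, p v)))"
      using subspace_span[of "{(v, p v)}"] by (simp add: span_singleton)
    moreover have "(v, p v) \<in> range (\<lambda>s. s *\<^sub>R (v, p v))"
      by (rule image_eqI[of _ _ 1]) auto
    ultimately show ?thesis unfolding G_def by auto
  qed
  have chain: "\<Union>C \<in> G" if C: "C \<noteq> {}" "subset.chain G C" for C
  proof -
    have CG: "C \<subseteq> G" using C by (auto simp: subset.chain_def)
    have "subspace (\<Union>C)" unfolding subspace_def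
    proof (intro conjI ballI allI)
      show "0 \<in> \<Union>C" using C CG subspace_0 unfolding G_def by blast
      fix x y assume "x \<in> \<Union>C" "y \<in> \<Union>C"
      then obtain g h where "g \<in> C" "h \<in> C" "x \<in> g" "y \<in> h" by auto
      moreover have "g \<subseteq> h \<or> h \<subseteq> g" using C(2) \<open>g\<in>C\<close> \<open>h\<in>C\<close> by (auto simp: subset.chain_def)
      ultimately have "\<exists>k\<in>C. x \<in> k \<and> y \<in> k" by auto
      then show "x + y \<in> \<Union>C" using CG subspace_add unfolding G_def by blast
    next
      fix c x assume "x \<in> \<Union>C"
      then show "c *\<^sub>R x \<in> \<Union>C" using CG subspace_scale unfolding G_def by blast
    qed
    then show ?thesis using C CG unfolding G_def by blast
  qed
  obtain g where g: "g \<in> G" and max: "\<And>h. h \<in> G \<Longrightarrow> g \<subseteq> h \<Longrightarrow> h = g"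
    using subset_Zorn_nonempty[of G] init chain by blast
  have sg: "subspace g" and gp: "\<And>x t. (x,t) \<in> g \<Longrightarrow> t \<le> p x" and vg: "(v, p v) \<in> g"
    using g unfolding G_def by auto
  have total: "\<exists>t. (x0, t) \<in> g" for x0
  proof -
    \<comment> \<open>\<open>L\<close> collects the lower bounds that domination forces on the value
      at \<open>x0\<close>; the upper bounds are the numbers \<open>p (z + x0) - s\<close>. By
      \<open>key\<close> no lower bound exceeds an upper one, so the supremum of \<open>L\<close> is
      an admissible value, and homogeneity reduces all multiples of \<open>x0\<close> to these two
      cases.\<close>
    define L where "L = {t - p (y - x0) |y t. (y,t) \<in> g}"
    have key: "t - p (y - x0) \<le> p (z + x0) - s" if "(y,t) \<in> g" "(z,s) \<in> g" for y t z s
    proof -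
      have "t + s \<le> p (y + z)" using subspace_add[OF sg that] by (simp add: gp)
      also have "\<dots> \<le> p (y - x0) + p (z + x0)" using add[of "y - x0" "z + x0"] by (simp add: algebra_simps)
      finally show ?thesis by simp
    qed
    have Lne: "L \<noteq> {}" using vg unfolding L_def by blast
    have bdd: "bdd_above L" unfolding L_def bdd_above_def using key[OF _ vg] by blast
    define \<alpha> where "\<alpha> = Sup L"
    have lo: "t - p (y - x0) \<le> \<alpha>" if "(y,t) \<in> g" for y t
      unfolding \<alpha>_def using that by (intro cSup_upper bdd) (auto simp: L_def)
    have hi: "\<alpha> \<le> p (z + x0) - s" if "(z,s) \<in> g" for z s
      unfolding \<alpha>_def using key[OF _ that] by (intro cSup_least Lne) (auto simp: L_def)
    define h where "h = {(y + s *\<^sub>R x0, t + s * \<alpha>) |y t s. (y,t) \<in> g}"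
    have "h = {x + y |x y. x \<in> g \<and> y \<in> span {(x0,\<alpha>)}}"
      unfolding span_singleton
    proof (intro subset_antisym subsetI)
      fix z assume "z \<in> h"
      then obtain y t s where "(y,t) \<in> g" "z = (y,t) + s *\<^sub>R (x0,\<alpha>)" by (auto simp: h_def)
      then show "z \<in> {x + y |x y. x \<in> g \<and> y \<in> range (\<lambda>k. k *\<^sub>R (x0,\<alpha>))}" by blast
    next
      fix z assume "z \<in> {x + y |x y. x \<in> g \<and> y \<in> range (\<lambda>k. k *\<^sub>R (x0,\<alpha>))}"
      then obtain y t s where "(y,t) \<in> g" "z = (y,t) + s *\<^sub>R (x0,\<alpha>)" by fastforce
      then show "z \<in> h" by (auto simp: h_def)
    qed
    then have sh: "subspace h" using subspace_sums[OF sg subspace_span] by simp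
    have hp: "t + s * \<alpha> \<le> p (y + s *\<^sub>R x0)" if yt: "(y,t) \<in> g" for y t s
    proof -
      consider "s = 0" | "s > 0" | "s < 0" by linarith
      then show ?thesis
      proof cases
        case 1 then show ?thesis using gp[OF yt] by simp
      next
        case 2
        have "(inverse s *\<^sub>R y, inverse s * t) \<in> g" using subspace_scale[OF sg yt, of "inverse s"] by simp
        from hi[OF this] have "s * \<alpha> \<le> s * (p (inverse s *\<^sub>R y + x0) - inverse s * t)" using 2 by simp
        moreover have "s * p (inverse s *\<^sub>R y + x0) = p (y + s *\<^sub>R x0)"
          using scale[OF 2, of "inverse s *\<^sub>R y + x0"] 2 by (simp add: scaleR_add_right)
        moreover have "s * (inverse s * t) = t" using 2 by simp
        ultimately show ?thesis using 2 by (simp add: right_diff_distrib)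
      next
        case 3
        define r where "r = - s"
        have r: "r > 0" using 3 r_def by simp
        have "(inverse r *\<^sub>R y, inverse r * t) \<in> g" using subspace_scale[OF sg yt, of "inverse r"] by simp
        from lo[OF this] have "r * (inverse r * t - p (inverse r *\<^sub>R y - x0)) \<le> r * \<alpha>" using r by simp
        moreover have "r *\<^sub>R (inverse r *\<^sub>R y - x0) = y + s *\<^sub>R x0"
          using r by (simp add: scaleR_diff_right) (simp add: r_def)
        moreover have "s * \<alpha> = - (r * \<alpha>)" "r * (inverse r * t) = t" using r by (auto simp: r_def)
        ultimately show ?thesis
          using scale[OF r, of "inverse r *\<^sub>R y - x0"] unfolding right_diff_distrib by simp
      qed
    qed
    have gh: "g \<subseteq> h" unfolding h_def by (force intro: exI[of _ "0::real"])
    have "\<forall>(x,t)\<in>h. t \<le> p x" using hp by (auto simp: h_def)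
    then have "h \<in> G" unfolding G_def using sh gh vg by blast
    then have "h = g" using max gh by auto
    moreover have "(x0, \<alpha>) \<in> h" unfolding h_def
      using subspace_0[OF sg] by (force simp: zero_prod_def intro: exI[of _ "1::real"])
    ultimately show ?thesis by auto
  qed
  have uniq: "t = t'" if "(x,t) \<in> g" "(x,t') \<in> g" for x t t'
  proof -
    have "(0, t - t') \<in> g" "(0, t' - t) \<in> g" using subspace_diff[OF sg that] subspace_diff[OF sg that(2,1)] by auto
    then show ?thesis using gp[of 0 "t - t'"] gp[of 0 "t' - t"] p0 by auto
  qed
  define f where "f x = (THE t. (x,t) \<in> g)" for x
  have fg: "(x, f x) \<in> g" for x
    unfolding f_def using total[of x] uniq by (auto intro: theI2)
  have "linear f"
  proof
    show "f (x + y) = f x + f y" for x y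
      using uniq[OF fg] subspace_add[OF sg fg[of x] fg[of y]] by simp
    show "f (r *\<^sub>R x) = r *\<^sub>R f x" for r x
      using uniq[OF fg] subspace_scale[OF sg fg[of x], of r] by simp
  qed
  moreover have "f x \<le> p x" for x using gp fg by auto
  moreover have "f v = p v" using uniq fg vg by blast
  ultimately show ?thesis by blast
qed

text \<open>Hahn-Banach with the distance to \<open>N\<close> as gauge gives a real functional
  \<open>f\<close> that is 0 on \<open>N\<close> and positive at \<open>v\<close>. Its
  complexification f x - i f (i x) still vanishes on \<open>N\<close>, since \<open>N\<close> is a
  complex subspace, and is then normalised at \<open>v\<close>.\<close>

lemma separating_functional:
  fixes N :: "'a::complex_normed_vector set"
  assumes N: "csubspace N" "closed N" and v: "v \<notin> N"
  shows "\<exists>\<phi> :: 'a \<Rightarrow> complex. bounded_clinear \<phi> \<and> (\<forall>x\<in>N. \<phi> x = 0) \<and> \<phi> v = 1"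
proof -
  have sN: "subspace N" by (rule csubspace_imp_subspace[OF N(1)])
  have ne: "N \<noteq> {}" using subspace_0[OF sN] by auto
  obtain f where f: "linear f" "\<And>x. f x \<le> infdist x N" "f v = infdist v N"
    using hahn_banach_dominated[of "\<lambda>x. infdist x N" v] infdist_subspace_add[OF sN]
      infdist_subspace_scaleR[OF sN] by blast
  have fv: "f v > 0" using f(3) v N(2) ne infdist_pos_not_in_closed by metis
  have fn: "f x \<le> norm x" for x
    using f(2)[of x] infdist_le[OF subspace_0[OF sN], of x] by simp
  have fabs: "\<bar>f x\<bar> \<le> norm x" for x
    using fn[of x] fn[of "-x"] by (simp add: linear_neg[OF f(1)] abs_le_iff)
  have f0: "f x = 0" if "x \<in> N" for x
    using f(2)[of x] f(2)[of "-x"] that subspace_neg[OF sN that] by (simp add: linear_neg[OF f(1)])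
  define \<psi> where "\<psi> x = Complex (f x) (- f (\<i> *\<^sub>C x))" for x
  have cx: "c *\<^sub>C x = Re c *\<^sub>R x + Im c *\<^sub>R (\<i> *\<^sub>C x)" for c and x :: 'a
    by (subst complex_eq[of c]) (simp add: scaleR_scaleC scaleC_add_left scaleC_scaleC mult.commute)
  have ii: "\<i> *\<^sub>C \<i> *\<^sub>C x = - x" for x :: 'a by (simp add: scaleC_scaleC scaleC_minus1)
  have ri: "\<i> *\<^sub>C (r *\<^sub>R x) = r *\<^sub>R (\<i> *\<^sub>C x)" for r and x :: 'a
    by (simp add: scaleR_scaleC scaleC_scaleC mult.commute)
  have add: "\<psi> (x + y) = \<psi> x + \<psi> y" for x y
    by (simp add: \<psi>_def linear_add[OF f(1)] scaleC_add_right complex_eq_iff)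
  have sc: "\<psi> (c *\<^sub>C x) = c * \<psi> x" for c x
    by (subst cx) (simp add: \<psi>_def complex_eq_iff linear_add[OF f(1)] linear_scale[OF f(1)]
        linear_neg[OF f(1)] linear_diff[OF f(1)] scaleC_add_right ri ii algebra_simps)
  have bd: "norm (\<psi> x) \<le> norm x * 2" for x
  proof -
    have "norm (\<psi> x) \<le> \<bar>f x\<bar> + \<bar>f (\<i> *\<^sub>C x)\<bar>" using cmod_le[of "\<psi> x"] by (simp add: \<psi>_def)
    also have "\<dots> \<le> norm x + norm (\<i> *\<^sub>C x)" by (intro add_mono fabs)
    finally show ?thesis by (simp add: norm_scaleC)
  qed
  have blin: "bounded_linear \<psi>"
    using add sc bd by (intro bounded_linear_intro[of \<psi> 2]) (simp_all add: scaleR_scaleC scaleC_complex_def)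
  have nz: "\<psi> v \<noteq> 0" using fv by (auto simp: \<psi>_def complex_eq_iff)
  define \<phi> where "\<phi> x = inverse (\<psi> v) * \<psi> x" for x
  have "bounded_clinear \<phi>"
    unfolding bounded_clinear_def \<phi>_def
    by (auto intro: bounded_linear_const_mult blin simp: sc scaleC_complex_def)
  moreover have "\<phi> x = 0" if "x \<in> N" for x
    using that f0 csubspace_scale[OF N(1)] by (simp add: \<phi>_def \<psi>_def complex_eq_iff)
  ultimately show ?thesis using nz by (intro exI[of _ \<phi>]) (auto simp: \<phi>_def)
qed

section \<open>The open mapping theorem and Neubauer's lemma\<close>

text \<open>Baire category in the closed space f(E): the closures of the images of balls cover it,
  so one of them has interior. This yields approximate solutions with relative error one half, which
  the next lemma iterates.\<close>

lemma open_mapping_approximation: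
  fixes f :: "'a::banach \<Rightarrow> 'b::banach"
  assumes f: "bounded_linear f" and E: "subspace E" and cl: "closed (f ` E)"
  shows "\<exists>c>0. \<forall>y\<in>f ` E. \<exists>x\<in>E. norm x \<le> c * norm y \<and> norm (y - f x) \<le> norm y / 2"
proof -
  interpret f: bounded_linear f by fact
  define V where "V = f ` E"
  have V: "subspace V" unfolding V_def by (rule linear_subspace_image[OF f.linear E])
  define T where "T n = closure (f ` (E \<inter> cball 0 (real n)))" for n :: nat
  have TV: "T n \<subseteq> V" for n
    unfolding T_def V_def by (rule closure_minimal) (use cl in auto)
  have "\<exists>n. (top_of_set V) interior_of (T n) \<noteq> {}"
  proof (rule ccontr)
    assume "\<not> ?thesis"
    moreover have "closedin (top_of_set V) (T n)" for n
      by (rule closed_subset[OF TV]) (simp add: T_def)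
    moreover have "completely_metrizable_space (top_of_set V)"
      using cl unfolding V_def
      by (intro completely_metrizable_space_closedin completely_metrizable_space_euclidean) auto
    ultimately have "(top_of_set V) interior_of \<Union>(range T) = {}"
      by (intro Baire_category_alt) auto
    moreover have "\<Union>(range T) = V"
    proof
      show "V \<subseteq> \<Union>(range T)"
      proof
        fix y assume "y \<in> V"
        then obtain x where x: "x \<in> E" "y = f x" unfolding V_def by auto
        obtain n where "norm x \<le> real n" using real_arch_simple by blast
        then have "y \<in> T n" unfolding T_def using x by (intro closure_subset[THEN subsetD]) auto
        then show "y \<in> \<Union>(range T)" by auto
      qed
    qed (use TV in auto)
    moreover have "(top_of_set V) interior_of V = V"
      using interior_of_topspace[of "top_of_set V"] by simp
    ultimately show False using subspace_0[OF V] by auto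
  qed
  then obtain n y0 where "y0 \<in> (top_of_set V) interior_of (T n)" by auto
  then obtain W where W: "openin (top_of_set V) W" "y0 \<in> W" "W \<subseteq> T n"
    by (auto simp: interior_of_def)
  then obtain r where r: "r > 0" "ball y0 r \<inter> V \<subseteq> W"
    by (meson openin_contains_ball)
  have y0: "y0 \<in> V" "y0 \<in> T n" using W TV by auto
  \<comment> \<open>Both \<open>y0\<close> and \<open>y0 + y\<close> are limits of images of vectors
    of norm at most \<open>n\<close>; subtracting removes the centre \<open>y0\<close> at the price
    of the factor 2.\<close>
  have small: "\<exists>x\<in>E. norm x \<le> 2 * real n \<and> norm (y - f x) < e"
    if y: "y \<in> V" "norm y < r" and "e > 0" for y e
  proof -
    have "y0 + y \<in> T n" using W r y y0 subspace_add[OF V] by (auto simp: dist_norm subset_iff)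
    then obtain x1 where x1: "x1 \<in> E" "norm x1 \<le> n" "dist (f x1) (y0 + y) < e/2"
      unfolding T_def using \<open>e>0\<close> by (force simp: closure_approachable dest: spec[of _ "e/2"])
    obtain x2 where x2: "x2 \<in> E" "norm x2 \<le> n" "dist (f x2) y0 < e/2"
      using y0(2) unfolding T_def using \<open>e>0\<close> by (force simp: closure_approachable dest: spec[of _ "e/2"])
    have "norm (y - f (x1 - x2)) = norm ((f x2 - y0) - (f x1 - (y0 + y)))" by (simp add: f.diff algebra_simps)
    also have "\<dots> \<le> norm (f x2 - y0) + norm (f x1 - (y0 + y))" by (rule norm_triangle_ineq4)
    also have "\<dots> < e" using x1 x2 by (simp add: dist_norm)
    finally have "norm (y - f (x1 - x2)) < e" .
    moreover have "norm (x1 - x2) \<le> 2 * real n" using norm_triangle_ineq4[of x1 x2] x1 x2 by linarith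
    ultimately show ?thesis using subspace_diff[OF E x1(1) x2(1)] by blast
  qed
  \<comment> \<open>Scaling \<open>y\<close> to norm r/2 and approximating within r/4 gives relative
    error 1/2. Undoing the scaling multiplies the bound 2n by 2 \<open>norm y\<close> / r; the
    summand 1 keeps \<open>c\<close> positive when n = 0.\<close>
  define c where "c = (4 * real n + 1) / r"
  show ?thesis
  proof (intro exI[of _ c] conjI ballI)
    show "c > 0" using r unfolding c_def by (auto intro: divide_pos_pos)
    fix y assume y: "y \<in> f ` E"
    show "\<exists>x\<in>E. norm x \<le> c * norm y \<and> norm (y - f x) \<le> norm y / 2"
    proof (cases "y = 0")
      case True
      then show ?thesis using subspace_0[OF E] by (intro bexI[of _ 0]) (auto simp: f.zero)
    next
      case False
      define s where "s = r / (2 * norm y)"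
      have s: "s > 0" using r False by (simp add: s_def)
      have "s *\<^sub>R y \<in> V" using y subspace_scale[OF V] by (simp add: V_def)
      moreover have "norm (s *\<^sub>R y) < r" using False r by (simp add: s_def)
      ultimately obtain x where x: "x \<in> E" "norm x \<le> 2 * real n" "norm (s *\<^sub>R y - f x) < r / 4"
        using small[of "s *\<^sub>R y" "r/4"] r by auto
      have "norm (y - f (inverse s *\<^sub>R x)) = inverse s * norm (s *\<^sub>R y - f x)"
      proof -
        have "y - f (inverse s *\<^sub>R x) = inverse s *\<^sub>R (s *\<^sub>R y - f x)"
          using s by (simp add: f.scaleR scaleR_diff_right)
        then show ?thesis using s by simp
      qed
      also have "\<dots> \<le> inverse s * (r / 4)" using x s by (intro mult_left_mono) auto
      also have "\<dots> = norm y / 2" using r False by (simp add: s_def field_simps)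
      finally have "norm (y - f (inverse s *\<^sub>R x)) \<le> norm y / 2" .
      moreover have "norm (inverse s *\<^sub>R x) \<le> c * norm y"
      proof -
        have "norm (inverse s *\<^sub>R x) \<le> inverse s * (2 * real n)" using x s by simp
        also have "\<dots> \<le> c * norm y" using r False by (simp add: s_def c_def field_simps)
        finally show ?thesis .
      qed
      ultimately show ?thesis using subspace_scale[OF E x(1)] by blast
    qed
  qed
qed

text \<open>The error is corrected again and again; it halves each time, so the corrections form a
  geometric series. Its sum accounts for the factor 2 in \<open>2 * c\<close>, and closedness of
  \<open>E\<close> keeps the limit in \<open>E\<close>.\<close>

lemma open_mapping_bound:
  fixes f :: "'a::banach \<Rightarrow> 'b::banach"
  assumes f: "bounded_linear f" and E: "subspace E" "closed E" and cl: "closed (f ` E)"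
  shows "\<exists>c>0. \<forall>y\<in>f ` E. \<exists>x\<in>E. f x = y \<and> norm x \<le> c * norm y"
proof -
  interpret f: bounded_linear f by fact
  have V: "subspace (f ` E)" by (rule linear_subspace_image[OF f.linear E(1)])
  obtain c where c: "c > 0"
    "\<forall>y\<in>f ` E. \<exists>x\<in>E. norm x \<le> c * norm y \<and> norm (y - f x) \<le> norm y / 2"
    using open_mapping_approximation[OF f E(1) cl] by blast
  then obtain g where g: "\<And>y. y \<in> f ` E \<Longrightarrow> g y \<in> E" "\<And>y. y \<in> f ` E \<Longrightarrow> norm (g y) \<le> c * norm y"
    "\<And>y. y \<in> f ` E \<Longrightarrow> norm (y - f (g y)) \<le> norm y / 2" by metis
  show ?thesis
  proof (intro exI[of _ "2 * c"] conjI ballI)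
    show "2 * c > 0" using c by simp
    fix y assume y: "y \<in> f ` E"
    \<comment> \<open>\<open>Y k\<close> is the residual after \<open>k\<close> corrections:
      \<open>y\<close> equals f applied to the first \<open>k\<close> corrections plus
      \<open>Y k\<close>.\<close>
    define Y where "Y k = ((\<lambda>z. z - f (g z)) ^^ k) y" for k
    have Y0: "Y 0 = y" and YS: "Y (Suc k) = Y k - f (g (Y k))" for k by (simp_all add: Y_def)
    have YV: "Y k \<in> f ` E" for k
      by (induction k) (use y g in \<open>auto simp: Y0 YS intro!: subspace_diff[OF V]\<close>)
    have Yn: "norm (Y k) \<le> norm y * (1/2)^k" for k
    proof (induction k)
      case (Suc k)
      then show ?case using g(3)[OF YV[of k]] by (simp add: YS)
    qed (simp add: Y0)
    have gn: "norm (g (Y k)) \<le> (c * norm y) * (1/2)^k" for k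
      using order_trans[OF g(2)[OF YV[of k]] mult_left_mono[OF Yn[of k], of c]] c
      by (simp add: mult.assoc)
    have geo: "(\<lambda>k. (c * norm y) * (1/2)^k) sums (2 * c * norm y)"
      using sums_mult[OF geometric_sums[of "1/2::real"], of "c * norm y"] by (simp add: mult_ac)
    have sn: "summable (\<lambda>k. norm (g (Y k)))"
      by (rule summable_comparison_test'[OF sums_summable[OF geo], of 0]) (use gn in simp)
    define x where "x = (\<Sum>k. g (Y k))"
    have xs: "(\<lambda>k. g (Y k)) sums x" unfolding x_def using summable_norm_cancel[OF sn] by (rule summable_sums)
    have "norm x \<le> (\<Sum>k. norm (g (Y k)))" unfolding x_def by (rule summable_norm[OF sn])
    also have "\<dots> \<le> 2 * c * norm y"
      using suminf_le[OF gn sn sums_summable[OF geo]] sums_unique[OF geo] by simp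
    finally have nx: "norm x \<le> 2 * c * norm y" .
    have "x \<in> E"
    proof (rule closed_sequentially[OF E(2)])
      show "(\<lambda>n. \<Sum>k<n. g (Y k)) \<longlonglongrightarrow> x" using xs by (simp add: sums_def)
      show "(\<Sum>k<n. g (Y k)) \<in> E" for n using g(1)[OF YV] by (intro subspace_sum[OF E(1)])
    qed
    moreover have "f x = y"
    proof (rule LIMSEQ_unique)
      show "(\<lambda>n. f (\<Sum>k<n. g (Y k))) \<longlonglongrightarrow> f x" using xs by (intro f.tendsto) (simp add: sums_def)
      have "f (\<Sum>k<n. g (Y k)) = y - Y n" for n
        by (induction n) (simp_all add: f.zero f.add YS Y0)
      moreover have "Y \<longlonglongrightarrow> 0"
      proof (rule Lim_null_comparison)
        show "\<forall>\<^sub>F n in sequentially. norm (Y n) \<le> norm y * (1/2)^n" using Yn by simp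
        show "(\<lambda>n. norm y * (1/2)^n) \<longlonglongrightarrow> 0"
          using tendsto_mult_right_zero[OF LIMSEQ_power_zero[of "1/2::real"]] by simp
      qed
      ultimately show "(\<lambda>n. f (\<Sum>k<n. g (Y k))) \<longlonglongrightarrow> y" using tendsto_diff[OF tendsto_const, of Y 0] by simp
    qed
    ultimately show "\<exists>x\<in>E. f x = y \<and> norm x \<le> 2 * c * norm y" using nx by blast
  qed
qed

text \<open>Openness in sequential form, as the two closedness lemmas below use it.\<close>

lemma open_mapping_lift_sequence:
  fixes f :: "'a::banach \<Rightarrow> 'b::banach"
  assumes f: "bounded_linear f" and E: "subspace E" "closed E" and cl: "closed (f ` E)"
    and y: "\<And>k. y k \<in> f ` E" "y \<longlonglongrightarrow> 0"
  obtains x where "\<And>k. x k \<in> E" "\<And>k. f (x k) = y k" "x \<longlonglongrightarrow> 0"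
proof -
  obtain c where c: "c > 0" "\<forall>y\<in>f ` E. \<exists>x\<in>E. f x = y \<and> norm x \<le> c * norm y"
    using open_mapping_bound[OF f E cl] by blast
  then have "\<forall>k. \<exists>x. x \<in> E \<and> f x = y k \<and> norm x \<le> c * norm (y k)" using y(1) by blast
  then obtain x where x: "\<And>k. x k \<in> E" "\<And>k. f (x k) = y k" "\<And>k. norm (x k) \<le> c * norm (y k)" by metis
  have "x \<longlonglongrightarrow> 0"
  proof (rule Lim_null_comparison)
    show "\<forall>\<^sub>F k in sequentially. norm (x k) \<le> c * norm (y k)" using x by simp
    show "(\<lambda>k. c * norm (y k)) \<longlonglongrightarrow> 0"
      using tendsto_mult_right_zero[OF tendsto_norm_zero[OF y(2)]] .
  qed
  then show thesis using that x by blast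
qed

text \<open>By openness \<open>f\<close> is a quotient map from \<open>E\<close> onto f(E): lifting
  \<open>z k - l\<close> to a null sequence makes a preimage of the limit a limit of
  preimages.\<close>

lemma closed_of_closed_preimage:
  fixes f :: "'a::banach \<Rightarrow> 'b::banach"
  assumes f: "bounded_linear f" and E: "subspace E" "closed E" and cl: "closed (f ` E)"
    and Z: "Z \<subseteq> f ` E" and pre: "closed {x \<in> E. f x \<in> Z}"
  shows "closed Z"
  unfolding closed_sequential_limits
proof (intro allI impI, elim conjE)
  interpret f: bounded_linear f by fact
  fix z l assume z: "\<forall>n. z n \<in> Z" "z \<longlonglongrightarrow> l"
  then have "l \<in> f ` E" using closed_sequentially[OF cl, of z l] Z by blast
  then obtain e where e: "e \<in> E" "l = f e" by auto
  have "z k - l \<in> f ` E" for k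
    using z Z e by (intro subspace_diff[OF linear_subspace_image[OF f.linear E(1)]]) auto
  then obtain u where u: "\<And>k. u k \<in> E" "\<And>k. f (u k) = z k - l" "u \<longlonglongrightarrow> 0"
    using open_mapping_lift_sequence[OF f E cl, of "\<lambda>k. z k - l"] z(2) by (auto simp: LIM_zero_iff)
  have "e \<in> {x \<in> E. f x \<in> Z}"
  proof (rule closed_sequentially[OF pre])
    show "(\<lambda>k. e + u k) \<longlonglongrightarrow> e" using tendsto_add[OF tendsto_const u(3)] by simp
    show "e + u k \<in> {x \<in> E. f x \<in> Z}" for k
      using subspace_add[OF E(1) e(1) u(1)[of k]] z u(2)[of k] e by (simp add: f.add)
  qed
  then show "l \<in> Z" using e by simp
qed

text \<open>Neubauer's lemma: if \<open>f e + g d\<close> is a limit of points of \<open>f ` E\<close>, lifting the differences to a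
  null sequence exhibits \<open>g d\<close> as a limit of points of the intersection.\<close>

lemma closed_summand:
  fixes f :: "'a::banach \<Rightarrow> 'c::banach" and g :: "'b::banach \<Rightarrow> 'c"
  assumes f: "bounded_linear f" and E: "subspace E" "closed E"
    and g: "bounded_linear g" and G: "subspace G" "closed G"
    and sum: "closed (f ` E + g ` G)" and int: "closed (f ` E \<inter> g ` G)"
  shows "closed (f ` E)"
  unfolding closed_sequential_limits
proof (intro allI impI, elim conjE)
  interpret f: bounded_linear f by fact
  interpret g: bounded_linear g by fact
  define h where "h = (\<lambda>x. f (fst x) + g (snd x))"
  have h: "bounded_linear h" unfolding h_def
    by (intro bounded_linear_add bounded_linear_compose[OF f] bounded_linear_compose[OF g]
        bounded_linear_fst bounded_linear_snd)
  have him: "h ` (E \<times> G) = f ` E + g ` G" by (force simp: h_def set_plus_def)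
  have sEG: "subspace (E \<times> G)" "closed (E \<times> G)" using E G by (auto intro: subspace_Times closed_Times)
  fix y l assume y: "\<forall>n. y n \<in> f ` E" "y \<longlonglongrightarrow> l"
  have fEsub: "f ` E \<subseteq> f ` E + g ` G"
    using subspace_0[OF G(1)] g.zero by (force simp: set_plus_def)
  then have "l \<in> f ` E + g ` G" using closed_sequentially[OF sum, of y l] y by blast
  then obtain e d where ed: "e \<in> E" "d \<in> G" "l = f e + g d" by (auto simp: set_plus_def)
  have "subspace (h ` (E \<times> G))"
    using bounded_linear.linear[OF h] sEG(1) by (rule linear_subspace_image)
  then have "y k - l \<in> h ` (E \<times> G)" for k
    using y(1) fEsub \<open>l \<in> _\<close> by (intro subspace_diff) (auto simp: him)
  then obtain u where u: "\<And>k. u k \<in> E \<times> G" "\<And>k. h (u k) = y k - l" "u \<longlonglongrightarrow> 0"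
    using open_mapping_lift_sequence[OF h sEG, of "\<lambda>k. y k - l"] y(2) sum him
    by (auto simp: LIM_zero_iff)
  have "g d \<in> f ` E \<inter> g ` G"
  proof (rule closed_sequentially[OF int])
    have "(\<lambda>k. g d + g (snd (u k))) \<longlonglongrightarrow> g d + g 0"
      using tendsto_snd[OF u(3)] by (intro tendsto_add tendsto_const g.tendsto) (simp add: zero_prod_def)
    then show "(\<lambda>k. g (d + snd (u k))) \<longlonglongrightarrow> g d" by (simp add: g.zero g.add)
    fix k
    obtain x where x: "x \<in> E" "y k = f x" using y(1) by blast
    have uk: "fst (u k) \<in> E" "snd (u k) \<in> G" using u(1)[of k] by auto
    have "g (d + snd (u k)) = f (x - e - fst (u k))"
      using u(2)[of k] x ed by (simp add: h_def g.add f.diff f.add algebra_simps)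
    moreover have "x - e - fst (u k) \<in> E" using x ed uk by (intro subspace_diff[OF E(1)])
    moreover have "d + snd (u k) \<in> G" using ed uk by (intro subspace_add[OF G(1)])
    ultimately show "g (d + snd (u k)) \<in> f ` E \<inter> g ` G" by (metis IntI imageI)
  qed
  then have "l \<in> f ` E" using ed linear_subspace_image[OF f.linear E(1)] by (auto intro: subspace_add)
  then show "l \<in> f ` E" .
qed

section \<open>Linear maps and quotient dimensions\<close>

global_interpretation complex_vector_pair: vector_space_pair
  "scaleC :: complex \<Rightarrow> 'a \<Rightarrow> 'a :: complex_vector" "scaleC :: complex \<Rightarrow> 'b \<Rightarrow> 'b :: complex_vector"
  by standard

abbreviation clinear :: "('a::complex_vector \<Rightarrow> 'b::complex_vector) \<Rightarrow> bool" where
  "clinear \<equiv> Vector_Spaces.linear scaleC scaleC"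

abbreviation cindependent :: "'a::complex_vector set \<Rightarrow> bool" where
  "cindependent B \<equiv> \<not> complex_vector.dependent B"

lemma clinear_iff:
  "clinear f \<longleftrightarrow> (\<forall>x y. f (x + y) = f x + f y) \<and> (\<forall>c x. f (c *\<^sub>C x) = c *\<^sub>C f x)"
  by (simp add: Vector_Spaces.linear_iff complex_vector.vector_space_axioms)

lemma clinearI:
  assumes "\<And>x y. f (x + y) = f x + f y" "\<And>c x. f (c *\<^sub>C x) = c *\<^sub>C f x"
  shows "clinear f"
  using assms by (simp add: clinear_iff) 

lemma csubspace_plus: "csubspace M \<Longrightarrow> csubspace N \<Longrightarrow> csubspace (M + N)"
proof -
  assume "csubspace M" "csubspace N"
  moreover have "M + N = {x + y |x y. x \<in> M \<and> y \<in> N}" by (auto simp: set_plus_def)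
  ultimately show ?thesis using complex_vector.subspace_sums[of M N] by simp
qed

lemma csubspace_Int: "csubspace M \<Longrightarrow> csubspace N \<Longrightarrow> csubspace (M \<inter> N)"
  by (rule complex_vector.subspace_inter)

lemma csubspace_image: "clinear f \<Longrightarrow> csubspace M \<Longrightarrow> csubspace (f ` M)"
  by (rule complex_vector_pair.linear_subspace_image)

lemma csubspace_null_space: "clinear f \<Longrightarrow> csubspace (null_space f)"
  unfolding null_space_def by (rule complex_vector_pair.linear_subspace_kernel)

lemma subset_plus_left: "csubspace N \<Longrightarrow> M \<subseteq> M + N"
  by (force simp: set_plus_def dest: csubspace_0)

lemma subset_plus_right: "csubspace M \<Longrightarrow> N \<subseteq> M + N"
  by (force simp: set_plus_def dest: csubspace_0)

lemma plus_subset: "csubspace L \<Longrightarrow> M \<subseteq> L \<Longrightarrow> N \<subseteq> L \<Longrightarrow> M + N \<subseteq> (L :: 'a::complex_vector set)"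
  by (auto simp: set_plus_def subset_iff csubspace_add)

lemma cspan_Un: "cspan (A \<union> B) = cspan A + cspan B"
  unfolding complex_vector.span_Un by (auto simp: set_plus_def)

lemma csubspace_cspan: "csubspace (cspan B)"
  by (rule complex_vector.subspace_span)

text \<open>\<open>f\<close> is the projection along \<open>N\<close> onto an algebraic complement.
  It replaces the quotient map: f(M) is a copy of M/N whenever \<open>N\<close> lies in
  \<open>M\<close>, inside the same type. Continuity is not claimed.\<close>

lemma exists_linear_with_kernel:
  assumes N: "csubspace (N :: 'a::complex_vector set)"
  shows "\<exists>f::'a \<Rightarrow> 'a. clinear f \<and> null_space f = N \<and> (\<forall>x. f x - x \<in> N)"
proof -
  obtain A where A: "A \<subseteq> N" "cindependent A" "N \<subseteq> cspan A"
    using complex_vector.maximal_independent_subset[of N] by blast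
  obtain B where B: "A \<subseteq> B" "cindependent B" "cspan B = UNIV"
    using complex_vector.maximal_independent_subset_extend[of A UNIV] A by (metis subset_UNIV top.extremum_uniqueI)
  obtain f where f: "clinear f" "\<forall>b\<in>B. f b = (if b \<in> A then 0 else b)"
    using complex_vector_pair.linear_independent_extend[OF B(2), of "\<lambda>b. if b \<in> A then 0 else b"] by blast
  have add: "f (x + y) = f x + f y" and scale: "f (c *\<^sub>C x) = c *\<^sub>C f x" for x y c
    using f(1) by (simp_all add: clinear_iff)
  have f0: "f 0 = 0" using scale[of 0 0] by simp
  have diff: "f x - x \<in> N" for x
  proof -
    have "x \<in> cspan B" using B by simp
    then show ?thesis
    proof (induction rule: complex_vector.span_induct_alt)
      case base then show ?case using N by (simp add: f0 csubspace_0)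
    next
      case (step c b y)
      have "f b - b \<in> N" using step f(2) A N by (auto simp: csubspace_0 intro: csubspace_neg)
      then have "c *\<^sub>C (f b - b) + (f y - y) \<in> N"
        using step N by (intro csubspace_add csubspace_scale)
      then show ?case by (simp add: add scale complex_vector.scale_right_diff_distrib algebra_simps)
    qed
  qed
  have "f x = 0" if "x \<in> N" for x
  proof -
    have "x \<in> cspan A" using A that by auto
    then show ?thesis
      by (induction rule: complex_vector.span_induct_alt) (use f B in \<open>auto simp: f0 add scale\<close>)
  qed
  moreover have "x \<in> N" if "f x = 0" for x
    using diff[of x] that csubspace_neg[OF N] by fastforce
  ultimately have "null_space f = N" by (auto simp: null_space_def)
  then show ?thesis using f(1) diff by blast
qed

lemma clinear_simps:
  assumes "clinear f"
  shows "f (x + y) = f x + f y" "f (x - y) = f x - f y" "f (- x) = - f x" "f 0 = 0"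
    "f (c *\<^sub>C x) = c *\<^sub>C f x" "f (sum g A) = (\<Sum>a\<in>A. f (g a))"
  using assms
  by (simp_all add: complex_vector_pair.linear_add complex_vector_pair.linear_diff
      complex_vector_pair.linear_neg complex_vector_pair.linear_0 complex_vector_pair.linear_scale
      complex_vector_pair.linear_sum)

lemma cdimension_cspan:
  assumes "cindependent B"
  shows "cdimension (cspan B) = (if finite B then enat (card B) else \<infinity>)"
proof (cases "finite B")
  case True
  then show ?thesis
    using assms by (auto simp: cdimension_def complex_vector.dim_eq_card_independent)
next
  case False
  have "\<not> (finite C \<and> cspan C = cspan B)" for C
    using complex_vector.independent_span_bound[OF _ assms, of C] complex_vector.span_superset[of B] False by auto
  then show ?thesis using False by (auto simp: cdimension_def)
qed

lemma csubspace_basis: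
  assumes "csubspace V"
  obtains B where "B \<subseteq> V" "cindependent B" "cspan B = V"
proof -
  obtain B where "B \<subseteq> V" "cindependent B" "V \<subseteq> cspan B"
    using complex_vector.maximal_independent_subset[of V] by blast
  then show thesis using that complex_vector.span_minimal[OF _ assms, of B] by blast
qed

lemma rank_nullity:
  assumes f: "clinear f" and V: "csubspace V"
  shows "cdimension V = cdimension (f ` V) + cdimension (V \<inter> null_space f)"
proof -
  obtain A where A: "A \<subseteq> V \<inter> null_space f" "cindependent A" "cspan A = V \<inter> null_space f"
    using csubspace_basis[OF csubspace_Int[OF V csubspace_null_space[OF f]]] by blast
  obtain B where B: "A \<subseteq> B" "B \<subseteq> V" "cindependent B" "V \<subseteq> cspan B"
    using complex_vector.maximal_independent_subset_extend[of A V] A by auto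
  have VB: "cspan B = V" using B complex_vector.span_minimal[OF _ V] by blast
  define C where "C = B - A"
  \<comment> \<open>The representation of such an \<open>x\<close> over \<open>B\<close> is
    supported both in \<open>A\<close> and in \<open>C\<close>, which are disjoint.\<close>
  have disj: "x = 0" if "x \<in> cspan A" "x \<in> cspan C" for x
  proof -
    have "complex_vector.representation B x = complex_vector.representation A x"
      "complex_vector.representation B x = complex_vector.representation C x"
      using that B by (auto intro!: complex_vector.representation_extend simp: C_def)
    then have "complex_vector.representation B x b = 0" for b
      using complex_vector.representation_ne_zero[of A x b] complex_vector.representation_ne_zero[of C x b]
      by (auto simp: C_def)
    moreover have "x \<in> cspan B" using that(1) B(1) complex_vector.span_mono by blast
    ultimately show ?thesis
      using complex_vector.sum_nonzero_representation_eq[OF B(3), of x] by simp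
  qed
  have CV: "cspan C \<subseteq> V" using VB complex_vector.span_mono[of C B] by (auto simp: C_def)
  have "inj_on f (cspan C)"
  proof (rule inj_onI)
    fix x y assume xy: "x \<in> cspan C" "y \<in> cspan C" "f x = f y"
    then have "x - y \<in> cspan C" by (intro complex_vector.span_diff)
    moreover from this have "x - y \<in> V \<inter> null_space f"
      using xy CV by (auto simp: null_space_def clinear_simps[OF f])
    ultimately show "x = y" using disj A(3) by fastforce
  qed
  moreover have indC: "cindependent C" using B(3) complex_vector.independent_mono C_def by blast
  ultimately have ind: "cindependent (f ` C)"
    by (intro complex_vector_pair.linear_independent_injective_image[OF f])
  have injC: "inj_on f C" using \<open>inj_on f (cspan C)\<close> complex_vector.span_superset inj_on_subset by blast
  have "f ` V = cspan (f ` C)"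
  proof -
    have "B = A \<union> C" using B(1) by (auto simp: C_def)
    then have "f ` V = cspan (f ` A) + cspan (f ` C)"
      using complex_vector_pair.linear_span_image[OF f, of B] VB
      by (simp add: image_Un cspan_Un)
    moreover have "cspan (f ` A) = {0}"
    proof -
      have "f ` A \<subseteq> {0}" using A(1) by (auto simp: null_space_def)
      then show ?thesis using complex_vector.span_mono[of "f ` A" "{0}"] complex_vector.span_zero[of "f ` A"] by auto
    qed
    ultimately show ?thesis by (simp add: set_plus_def)
  qed
  then have "cdimension (f ` V) = (if finite C then enat (card C) else \<infinity>)"
    using cdimension_cspan[OF ind] by (simp add: finite_image_iff[OF injC] card_image[OF injC])
  moreover have "cdimension (V \<inter> null_space f) = (if finite A then enat (card A) else \<infinity>)"
    using cdimension_cspan[OF A(2)] A(3) by simp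
  moreover have "cdimension V = (if finite B then enat (card B) else \<infinity>)"
    using cdimension_cspan[OF B(3)] VB by simp
  moreover have "finite B \<longleftrightarrow> finite A \<and> finite C"
    using B(1) by (auto simp: C_def intro: finite_subset)
  moreover have "card B = card C + card A" if "finite B"
    using B(1) that by (simp add: C_def card_Diff_subset finite_subset card_mono)
  ultimately show ?thesis by auto
qed

lemma mem_cspan_plus_iff:
  assumes f: "clinear f" and M: "csubspace M" and S: "S \<subseteq> M" and b: "b \<in> M"
  shows "b \<in> cspan S + (M \<inter> null_space f) \<longleftrightarrow> f b \<in> cspan (f ` S)"
proof
  assume "b \<in> cspan S + (M \<inter> null_space f)"
  then obtain s n where "s \<in> cspan S" "b = s + n" "f n = 0" by (auto simp: set_plus_def null_space_def)
  then show "f b \<in> cspan (f ` S)"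
    by (simp add: clinear_simps[OF f] complex_vector_pair.linear_span_image[OF f])
next
  assume "f b \<in> cspan (f ` S)"
  then obtain s where s: "s \<in> cspan S" "f b = f s"
    by (auto simp: complex_vector_pair.linear_span_image[OF f])
  moreover have "s \<in> M" using s(1) S complex_vector.span_minimal[OF S M] by auto
  ultimately have "b - s \<in> M \<inter> null_space f"
    using b M by (auto simp: null_space_def clinear_simps[OF f] csubspace_diff)
  then have "s + (b - s) \<in> cspan S + (M \<inter> null_space f)" using s(1) by (rule set_plus_intro[rotated])
  then show "b \<in> cspan S + (M \<inter> null_space f)" by simp
qed

lemma independent_mod_iff:
  assumes f: "clinear f" and M: "csubspace M" and B: "B \<subseteq> M"
  shows "(\<forall>b\<in>B. b \<notin> cspan (B - {b}) + (M \<inter> null_space f)) \<longleftrightarrow> inj_on f B \<and> cindependent (f ` B)"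
proof -
  have eq: "b \<in> cspan (B - {b}) + (M \<inter> null_space f) \<longleftrightarrow> f b \<in> cspan (f ` (B - {b}))" if "b \<in> B" for b
    using that B by (intro mem_cspan_plus_iff[OF f M]) auto
  show ?thesis
  proof safe
    assume L: "\<forall>b\<in>B. b \<notin> cspan (B - {b}) + (M \<inter> null_space f)"
    then have L': "f b \<notin> cspan (f ` (B - {b}))" if "b \<in> B" for b using eq that by auto
    show inj: "inj_on f B"
    proof (rule inj_onI, rule ccontr)
      fix x y assume "x \<in> B" "y \<in> B" "f x = f y" "x \<noteq> y"
      then have "f y \<in> f ` (B - {x})" by (intro imageI) simp
      then have "f x \<in> f ` (B - {x})" by (simp only: \<open>f x = f y\<close>)
      then show False using L'[OF \<open>x \<in> B\<close>] complex_vector.span_base[of "f x" "f ` (B - {x})"] by simp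
    qed
    assume "complex_vector.dependent (f ` B)"
    then obtain b where "b \<in> B" "f b \<in> cspan (f ` B - {f b})" by (auto simp: complex_vector.dependent_def)
    moreover have "f ` B - {f b} = f ` (B - {b})" using inj \<open>b \<in> B\<close> by (auto simp: inj_on_def)
    ultimately show False using L' by auto
  next
    fix b assume inj: "inj_on f B" and ind: "cindependent (f ` B)" and b: "b \<in> B"
      and "b \<in> cspan (B - {b}) + (M \<inter> null_space f)"
    then have "f b \<in> cspan (f ` (B - {b}))" using eq by auto
    moreover have "f ` B - {f b} = f ` (B - {b})" using inj b by (auto simp: inj_on_def)
    ultimately show False using ind b by (auto simp: complex_vector.dependent_def)
  qed
qed

text \<open>Membership modulo the kernel is membership of images, so quotient bases are exactly the
  injective lifts of bases of f(M).\<close>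

lemma quotient_basis_iff:
  assumes f: "clinear f" and M: "csubspace M"
  shows "quotient_basis M (M \<inter> null_space f) B \<longleftrightarrow>
    B \<subseteq> M \<and> inj_on f B \<and> cindependent (f ` B) \<and> cspan (f ` B) = f ` M"
proof -
  have "M = cspan B + (M \<inter> null_space f) \<longleftrightarrow> cspan (f ` B) = f ` M" if B: "B \<subseteq> M"
  proof
    assume "M = cspan B + (M \<inter> null_space f)"
    then have "f x \<in> cspan (f ` B)" if "x \<in> M" for x using mem_cspan_plus_iff[OF f M B that] that by auto
    then show "cspan (f ` B) = f ` M"
      using B complex_vector.span_minimal[OF image_mono[OF B] csubspace_image[OF f M]] by blast
  next
    assume "cspan (f ` B) = f ` M"
    then have "M \<subseteq> cspan B + (M \<inter> null_space f)" using mem_cspan_plus_iff[OF f M B] by blast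
    moreover have "cspan B + (M \<inter> null_space f) \<subseteq> M"
      using complex_vector.span_minimal[OF B M] by (intro plus_subset M) auto
    ultimately show "M = cspan B + (M \<inter> null_space f)" by blast
  qed
  then show ?thesis unfolding quotient_basis_def using independent_mod_iff[OF f M, of B] by blast
qed

text \<open>All finite quotient bases map onto bases of f(M), so the infimum runs over a constant;
  if f(M) is infinite-dimensional it runs over the empty set. From here on, quotient dimensions are
  computed by rank and nullity.\<close>

lemma quotient_dimension_eq:
  assumes f: "clinear f" and M: "csubspace M"
  shows "quotient_dimension M (M \<inter> null_space f) = cdimension (f ` M)"
proof -
  let ?Q = "{B. finite B \<and> quotient_basis M (M \<inter> null_space f) B}"
  obtain C where C: "C \<subseteq> f ` M" "cindependent C" "cspan C = f ` M"
    using csubspace_basis[OF csubspace_image[OF f M]] by blast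
  have card: "cdimension (f ` M) = enat (card B)" if "B \<in> ?Q" for B
    using that cdimension_cspan[of "f ` B"] by (auto simp: quotient_basis_iff[OF f M] card_image)
  show ?thesis
  proof (cases "finite C")
    case True
    define B where "B = inv_into M f ` C"
    have inj: "inj_on (inv_into M f) C" by (rule inj_on_inv_into[OF C(1)])
    have fB: "f ` B = C" unfolding B_def image_image using C(1) by (auto simp: f_inv_into_f subset_iff image_iff intro!: bexI)
    have "inj_on f B" by (rule eq_card_imp_inj_on) (use True fB inj in \<open>auto simp: B_def card_image\<close>)
    then have "B \<in> ?Q" using True fB C by (auto simp: quotient_basis_iff[OF f M] B_def intro: inv_into_into)
    then have ne: "?Q \<noteq> {}" by blast
    have "quotient_dimension M (M \<inter> null_space f) = (INF B\<in>?Q. cdimension (f ` M))"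
      unfolding quotient_dimension_def
      by (intro INF_cong refl) (rule card[symmetric])
    also have "\<dots> = cdimension (f ` M)" using ne by (rule INF_const)
    finally show ?thesis .
  next
    case False
    then have "cdimension (f ` M) = \<infinity>" using cdimension_cspan[OF C(2)] C(3) by simp
    then have "?Q = {}" using card by fastforce
    then show ?thesis unfolding quotient_dimension_def \<open>cdimension (f ` M) = \<infinity>\<close>
      by (simp only: image_empty Inf_empty top_enat_def)
qed
qed

lemma finite_cdimension_iff: "cdimension V < \<infinity> \<longleftrightarrow> (\<exists>B. finite B \<and> cspan B = V)"
  by (auto simp: cdimension_def)

lemma quotient_dimension_zero:
  assumes "csubspace V" shows "quotient_dimension V {0} = cdimension V"
proof -
  have "clinear (\<lambda>x::'a. x)" by (simp add: clinearI)
  moreover have "V \<inter> null_space (\<lambda>x. x) = {0}"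
    using csubspace_0[OF assms] by (auto simp: null_space_def)
  ultimately show ?thesis using quotient_dimension_eq[of "\<lambda>x. x" V] assms by simp
qed

text \<open>Rank-nullity for a map \<open>g\<close> with kernel \<open>M\<close> on f(Z), the copy
  of Z/N. Since \<open>f\<close> moves points only within \<open>N\<close>, \<open>g\<close> takes
  f(Z) onto g(Z), a copy of Z/M, and its kernel there is the copy f(M) of M/N.\<close>

lemma quotient_dimension_add:
  assumes N: "csubspace N" and M: "csubspace M" and Z: "csubspace Z" and sub: "N \<subseteq> M" "M \<subseteq> Z"
  shows "quotient_dimension Z N = quotient_dimension Z M + quotient_dimension M N"
proof -
  obtain f :: "'a \<Rightarrow> 'a" where f: "clinear f" "null_space f = N" "\<And>x. f x - x \<in> N"
    using exists_linear_with_kernel[OF N] by blast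
  obtain g :: "'a \<Rightarrow> 'a" where g: "clinear g" "null_space g = M"
    using exists_linear_with_kernel[OF M] by blast
  have "g (f z) = g z" for z
    using f(3)[of z] sub g(2) clinear_simps(2)[OF g(1), of "f z" z] by (auto simp: null_space_def)
  then have gf: "g ` f ` Z = g ` Z" by (simp add: image_image)
  have fM: "f z \<in> M \<longleftrightarrow> z \<in> M" for z
    using f(3)[of z] sub csubspace_add[OF M, of z "f z - z"]
      csubspace_diff[OF M, of "f z" "f z - z"] by auto
  have "f ` Z \<inter> null_space g = f ` M" using g(2) fM sub by auto
  then have "cdimension (f ` Z) = cdimension (g ` Z) + cdimension (f ` M)"
    using rank_nullity[OF g(1) csubspace_image[OF f(1) Z]] gf by simp
  moreover have "quotient_dimension Z N = cdimension (f ` Z)" "quotient_dimension M N = cdimension (f ` M)"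
    using quotient_dimension_eq[OF f(1) Z] quotient_dimension_eq[OF f(1) M] f(2) sub
    by (simp_all add: Int_absorb1)
  moreover have "quotient_dimension Z M = cdimension (g ` Z)"
    using quotient_dimension_eq[OF g(1) Z] g(2) sub by (simp add: Int_absorb1)
  ultimately show ?thesis by simp
qed

text \<open>Compose \<open>f\<close> with a map killing f(N): the kernel of the composition on
  \<open>M\<close> is \<open>N + (M \<inter> null_space f)\<close>, and both quotients have the same
  image.\<close>

lemma quotient_dimension_image:
  assumes f: "clinear f" and N: "csubspace N" and M: "csubspace M" and sub: "N \<subseteq> M"
  shows "quotient_dimension (f ` M) (f ` N) = quotient_dimension M (N + (M \<inter> null_space f))"
proof -
  obtain g :: "'b \<Rightarrow> 'b" where g: "clinear g" "null_space g = f ` N"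
    using exists_linear_with_kernel[OF csubspace_image[OF f N]] by blast
  have gf: "clinear (\<lambda>x. g (f x))" by (rule clinearI) (simp_all add: clinear_simps[OF f] clinear_simps[OF g(1)])
  have "M \<inter> null_space (\<lambda>x. g (f x)) = N + (M \<inter> null_space f)"
  proof (intro subset_antisym subsetI)
    fix x assume "x \<in> M \<inter> null_space (\<lambda>x. g (f x))"
    then have "x \<in> M" "f x \<in> f ` N" using g(2) by (auto simp: null_space_def)
    then obtain n where n: "n \<in> N" "f x = f n" "x \<in> M" by auto
    then have "x - n \<in> M \<inter> null_space f"
      using csubspace_diff[OF M, of x n] sub by (auto simp: null_space_def clinear_simps[OF f])
    then have "n + (x - n) \<in> N + (M \<inter> null_space f)" using n(1) by (rule set_plus_intro[rotated])
    then show "x \<in> N + (M \<inter> null_space f)" by simp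
  next
    fix x assume "x \<in> N + (M \<inter> null_space f)"
    then obtain n k where nk: "n \<in> N" "k \<in> M" "f k = 0" "x = n + k" by (auto simp: set_plus_def null_space_def)
    then have "f x \<in> f ` N" "x \<in> M"
      using sub csubspace_add[OF M] by (auto simp: clinear_simps[OF f])
    then show "x \<in> M \<inter> null_space (\<lambda>x. g (f x))" using g(2) by (auto simp: null_space_def)
  qed
  moreover have "f ` M \<inter> null_space g = f ` N" using g(2) sub by auto
  ultimately show ?thesis
    using quotient_dimension_eq[OF gf M] quotient_dimension_eq[OF g(1) csubspace_image[OF f M]]
    by (simp add: image_image)
qed

lemma quotient_dimension_second_iso:
  assumes M: "csubspace M" and N: "csubspace N"
  shows "quotient_dimension (M + N) N = quotient_dimension M (M \<inter> N)"
proof -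
  obtain f :: "'a \<Rightarrow> 'a" where f: "clinear f" "null_space f = N"
    using exists_linear_with_kernel[OF N] by blast
  have "f ` (M + N) = f ` M"
  proof
    show "f ` (M + N) \<subseteq> f ` M"
      using f(2) by (auto simp: set_plus_def null_space_def clinear_simps[OF f(1)])
    show "f ` M \<subseteq> f ` (M + N)" using subset_plus_left[OF N] by blast
  qed
  moreover have "(M + N) \<inter> N = N" using subset_plus_right[OF M] by blast
  ultimately show ?thesis
    using quotient_dimension_eq[OF f(1) csubspace_plus[OF M N]] quotient_dimension_eq[OF f(1) M] f(2) by simp
qed

lemma cdimension_eq_0:
  assumes "csubspace V" "cdimension V = 0" shows "V = {0}"
proof -
  obtain B where "cindependent B" "cspan B = V" using csubspace_basis[OF assms(1)] by blast
  then have "B = {}" using cdimension_cspan[of B] assms(2) by (auto simp: zero_enat_def split: if_splits)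
  then show ?thesis using \<open>cspan B = V\<close> by simp
qed

lemma cdimension_0: "cdimension {0::'a::complex_vector} = 0"
  using cdimension_cspan[of "{} :: 'a set"] complex_vector.independent_empty by (simp add: zero_enat_def)

lemma quotient_dimension_eq_0:
  assumes M: "csubspace M" and N: "csubspace N" and "N \<subseteq> M" "quotient_dimension M N = 0"
  shows "M = N"
proof -
  obtain f :: "'a \<Rightarrow> 'a" where f: "clinear f" "null_space f = N"
    using exists_linear_with_kernel[OF N] by blast
  have "cdimension (f ` M) = 0"
    using quotient_dimension_eq[OF f(1) M] f(2) assms(3,4) by (simp add: Int_absorb1)
  then have "f ` M = {0}" by (rule cdimension_eq_0[OF csubspace_image[OF f(1) M]])
  then show ?thesis using f(2) assms(3) by (auto simp: null_space_def)
qed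

lemma quotient_dimension_mono_left:
  assumes "csubspace N" "csubspace M" "csubspace Z" "N \<subseteq> M" "M \<subseteq> Z"
  shows "quotient_dimension M N \<le> quotient_dimension Z N"
  using quotient_dimension_add[OF assms] by simp

lemma quotient_dimension_antimono_right:
  assumes "csubspace N" "csubspace M" "csubspace Z" "N \<subseteq> M" "M \<subseteq> Z"
  shows "quotient_dimension Z M \<le> quotient_dimension Z N"
  using quotient_dimension_add[OF assms] by simp

lemma cdimension_mono:
  assumes "csubspace V" "csubspace W" "V \<subseteq> W" shows "cdimension V \<le> cdimension W"
  using quotient_dimension_mono_left[of "{0}" V W] assms
  by (simp add: quotient_dimension_zero csubspace_0)

section \<open>Inclusion up to finite dimension\<close>

text \<open>For subspaces this says that (M + N)/N is finite-dimensional; both directions together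
  mean commensurability. Stated with a spanning set, it passes through sums, images and chains
  without any inclusion between \<open>M\<close> and \<open>N\<close>.\<close>

definition almost_subset :: "'a::complex_vector set \<Rightarrow> 'a set \<Rightarrow> bool"  (infix \<open>\<preceq>\<close> 50) where
  "M \<preceq> N \<longleftrightarrow> (\<exists>B. finite B \<and> M \<subseteq> N + cspan B)"

lemma almost_subset_iff_finite:
  assumes M: "csubspace M" and N: "csubspace N"
  shows "M \<preceq> N \<longleftrightarrow> quotient_dimension M (M \<inter> N) < \<infinity>"
proof -
  obtain f :: "'a \<Rightarrow> 'a" where f: "clinear f" "null_space f = N" "\<And>x. f x - x \<in> N"
    using exists_linear_with_kernel[OF N] by blast
  have qd: "quotient_dimension M (M \<inter> N) = cdimension (f ` M)"
    using quotient_dimension_eq[OF f(1) M] f(2) by simp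
  show ?thesis
  proof
    assume "M \<preceq> N"
    then obtain B where B: "finite B" "M \<subseteq> N + cspan B" by (auto simp: almost_subset_def)
    have "f ` M \<subseteq> cspan (f ` B)"
    proof
      fix y assume "y \<in> f ` M"
      then obtain n s where "y = f (n + s)" "n \<in> N" "s \<in> cspan B" using B(2) by (fastforce simp: set_plus_def)
      then show "y \<in> cspan (f ` B)"
        using f(2) by (auto simp: clinear_simps[OF f(1)] complex_vector_pair.linear_span_image[OF f(1)] null_space_def)
    qed
    then have "cdimension (f ` M) \<le> cdimension (cspan (f ` B))"
      by (intro cdimension_mono csubspace_image f(1) M csubspace_cspan)
    also have "\<dots> < \<infinity>" using B(1) finite_cdimension_iff[of "cspan (f ` B)"] by blast
    finally show "quotient_dimension M (M \<inter> N) < \<infinity>" by (simp add: qd)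
  next
    assume "quotient_dimension M (M \<inter> N) < \<infinity>"
    then obtain B where B: "finite B" "cspan B = f ` M" unfolding qd finite_cdimension_iff by blast
    have "M \<subseteq> N + cspan B"
    proof
      fix x assume "x \<in> M"
      then have "- (f x - x) \<in> N" "f x \<in> cspan B"
        using f(3) csubspace_neg[OF N] B by blast+
      then have "- (f x - x) + f x \<in> N + cspan B" by (rule set_plus_intro)
      then show "x \<in> N + cspan B" by simp
    qed
    then show "M \<preceq> N" using B(1) by (auto simp: almost_subset_def)
  qed
qed

lemma almost_subset_iff_quotient:
  assumes "csubspace M" "csubspace N" "N \<subseteq> M"
  shows "M \<preceq> N \<longleftrightarrow> quotient_dimension M N < \<infinity>"
  using almost_subset_iff_finite[OF assms(1,2)] assms(3) by (simp add: Int_absorb1)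

lemma almost_subset_zero_iff:
  assumes "csubspace V" shows "V \<preceq> {0} \<longleftrightarrow> cdimension V < \<infinity>"
  using almost_subset_iff_quotient[of V "{0}"] assms
  by (simp add: quotient_dimension_zero csubspace_0)

lemma subset_imp_almost_subset: "M \<subseteq> N \<Longrightarrow> M \<preceq> N"
  unfolding almost_subset_def by (intro exI[of _ "{}"]) (simp add: set_plus_def)

lemma almost_subset_trans [trans]: "L \<preceq> M \<Longrightarrow> M \<preceq> N \<Longrightarrow> L \<preceq> N"
proof -
  assume "L \<preceq> M" "M \<preceq> N"
  then obtain A B where "finite A" "L \<subseteq> M + cspan A" "finite B" "M \<subseteq> N + cspan B"
    by (auto simp: almost_subset_def)
  then have "finite (B \<union> A)" "L \<subseteq> N + cspan (B \<union> A)"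
    using set_plus_mono2[of M "N + cspan B" "cspan A" "cspan A"] by (auto simp: cspan_Un add.assoc)
  then show ?thesis unfolding almost_subset_def by blast
qed

lemma almost_subset_mono: "M' \<subseteq> M \<Longrightarrow> M \<preceq> N \<Longrightarrow> N \<subseteq> N' \<Longrightarrow> M' \<preceq> N'"
  using almost_subset_trans subset_imp_almost_subset by metis

lemma almost_subset_plus:
  assumes "M \<preceq> N" "M' \<preceq> N'" shows "M + M' \<preceq> N + N'"
proof -
  obtain A B where AB: "finite A" "M \<subseteq> N + cspan A" "finite B" "M' \<subseteq> N' + cspan B"
    using assms by (auto simp: almost_subset_def)
  have "M + M' \<subseteq> (N + cspan A) + (N' + cspan B)" using AB by (intro set_plus_mono2)
  also have "\<dots> = (N + N') + cspan (A \<union> B)" by (simp add: cspan_Un ac_simps)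
  finally show ?thesis unfolding almost_subset_def using AB by blast
qed

lemma almost_subset_Int_self:
  assumes "csubspace M" "csubspace N" "M \<preceq> N" shows "M \<preceq> M \<inter> N"
  using assms almost_subset_iff_finite[of M N] almost_subset_iff_finite[of M "M \<inter> N"]
  by (simp add: csubspace_Int Int_assoc[symmetric])

text \<open>The two spaces are cut in one after the other, each time losing finite codimension
  only.\<close>

lemma almost_subset_Int:
  assumes "csubspace M" "csubspace N" "csubspace M'" "csubspace N'" "M \<preceq> N" "M' \<preceq> N'"
  shows "M \<inter> M' \<preceq> N \<inter> N'"
proof -
  have "M \<inter> M' \<preceq> N" by (rule almost_subset_mono[OF _ assms(5) order_refl]) blast
  then have "M \<inter> M' \<preceq> (M \<inter> M') \<inter> N" by (intro almost_subset_Int_self csubspace_Int assms)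
  also have "M \<inter> M' \<inter> N \<preceq> N'" by (rule almost_subset_mono[OF _ assms(6) order_refl]) blast
  then have "M \<inter> M' \<inter> N \<preceq> (M \<inter> M' \<inter> N) \<inter> N'" by (intro almost_subset_Int_self csubspace_Int assms)
  finally show ?thesis by (rule almost_subset_mono[rotated]) auto
qed

lemma almost_subset_image:
  assumes f: "clinear f" and "M \<preceq> N" shows "f ` M \<preceq> f ` N"
proof -
  obtain B where B: "finite B" "M \<subseteq> N + cspan B" using assms(2) by (auto simp: almost_subset_def)
  have "f ` M \<subseteq> f ` N + cspan (f ` B)"
  proof
    fix y assume "y \<in> f ` M"
    then obtain n s where "y = f (n + s)" "n \<in> N" "s \<in> cspan B" using B(2) by (fastforce simp: set_plus_def)
    then show "y \<in> f ` N + cspan (f ` B)"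
      by (auto simp: clinear_simps[OF f] complex_vector_pair.linear_span_image[OF f])
  qed
  then show ?thesis unfolding almost_subset_def using B(1) by blast
qed

text \<open>A finite value means that the infimum is over a nonempty set of naturals, hence
  attained.\<close>

lemma finite_quotient_basis_exists:
  assumes "csubspace M" "csubspace N" "N \<subseteq> M" "M \<preceq> N"
  obtains B where "finite B" "quotient_basis M N B" "enat (card B) = quotient_dimension M N"
proof -
  let ?Q = "{B. finite B \<and> quotient_basis M N B}"
  have fin: "quotient_dimension M N < \<infinity>" using assms almost_subset_iff_quotient by blast
  then have ne: "?Q \<noteq> {}"
    by (intro notI) (simp only: quotient_dimension_def image_empty Inf_empty top_enat_def less_irrefl)
  have "quotient_dimension M N \<in> (\<lambda>B. enat (card B)) ` ?Q"
    unfolding quotient_dimension_def Inf_enat_def using ne by (auto intro: LeastI)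
  then show thesis using that by auto
qed

lemma quotient_basis_Int:
  assumes M: "csubspace M" and N: "csubspace N" and "N \<subseteq> M" and B: "quotient_basis M N B"
  shows "cspan B \<inter> N = {0}"
proof -
  obtain f :: "'a \<Rightarrow> 'a" where f: "clinear f" "null_space f = N"
    using exists_linear_with_kernel[OF N] by blast
  have "inj_on f B" "cindependent (f ` B)"
    using quotient_basis_iff[OF f(1) M, of B] B f(2) \<open>N \<subseteq> M\<close> by (auto simp: Int_absorb1)
  then have "inj_on f (cspan B)"
    using complex_vector_pair.linear_inj_on_span_iff_independent_image[OF f(1)] by blast
  then have "x = 0" if "x \<in> cspan B" "f x = 0" for x
    using inj_onD[of f "cspan B" x 0] that by (simp add: clinear_simps[OF f(1)] complex_vector.span_zero)
  then show ?thesis using f(2) csubspace_0[OF N] complex_vector.span_zero[of B]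
    by (auto simp: null_space_def)
qed

section \<open>Finite-dimensional extensions of closed and complemented subspaces\<close>

lemma bounded_clinearD: "bounded_clinear f \<Longrightarrow> clinear f"
  by (auto simp: bounded_clinear_def clinear_iff linear_simps)

lemma bounded_clinear_imp_bounded_linear: "bounded_clinear f \<Longrightarrow> bounded_linear f"
  by (simp add: bounded_clinear_def)

lemma bounded_clinear_ident: "bounded_clinear (\<lambda>x. x)"
  by (simp add: bounded_clinear_def bounded_linear_ident)

lemma bounded_clinear_add:
  "bounded_clinear f \<Longrightarrow> bounded_clinear g \<Longrightarrow> bounded_clinear (\<lambda>x. f x + g x)"
  by (simp add: bounded_clinear_def bounded_linear_add scaleC_add_right)

lemma bounded_clinear_minus: "bounded_clinear f \<Longrightarrow> bounded_clinear (\<lambda>x. - f x)"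
  by (simp add: bounded_clinear_def bounded_linear_minus complex_vector.scale_minus_right)

lemma bounded_clinear_diff:
  "bounded_clinear f \<Longrightarrow> bounded_clinear g \<Longrightarrow> bounded_clinear (\<lambda>x. f x - g x)"
  using bounded_clinear_add[OF _ bounded_clinear_minus, of f g] by simp

lemma bounded_clinear_compose:
  "bounded_clinear f \<Longrightarrow> bounded_clinear g \<Longrightarrow> bounded_clinear (\<lambda>x. f (g x))"
  by (simp add: bounded_clinear_def bounded_linear_compose)

lemma bounded_clinear_funpow:
  fixes f :: "'a::complex_normed_vector \<Rightarrow> 'a"
  assumes "bounded_clinear f" shows "bounded_clinear (f ^^ n)"
proof (induction n)
  case 0
  show ?case by (simp add: bounded_clinear_ident)
next
  case (Suc n)
  have "f ^^ Suc n = (\<lambda>x. f ((f ^^ n) x))" by auto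
  then show ?case by (simp add: bounded_clinear_compose[OF assms Suc])
qed

lemma bounded_clinear_sum:
  "(\<And>i. i \<in> I \<Longrightarrow> bounded_clinear (f i)) \<Longrightarrow> bounded_clinear (\<lambda>x. \<Sum>i\<in>I. f i x)"
  by (simp add: bounded_clinear_def bounded_linear_sum complex_vector.scale_sum_right)

lemma bounded_linear_scaleC_left: "bounded_linear (\<lambda>a. a *\<^sub>C (x::'a::complex_normed_vector))"
  by (rule bounded_linear_intro[of _ "norm x"])
    (simp_all add: scaleC_add_left scaleR_scaleC scaleC_scaleC norm_scaleC scaleC_complex_def)

lemma bounded_clinear_scaleC_left:
  "bounded_clinear \<phi> \<Longrightarrow> bounded_clinear (\<lambda>x. \<phi> x *\<^sub>C (b::'a::complex_normed_vector))"
  by (simp add: bounded_clinear_def scaleC_complex_def scaleC_scaleC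
      bounded_linear_compose[OF bounded_linear_scaleC_left])

lemma bounded_clinear_scaleC_right: "bounded_clinear (\<lambda>x. \<mu> *\<^sub>C (x::'a::complex_normed_vector))"
proof -
  have "bounded_linear (\<lambda>x. \<mu> *\<^sub>C (x::'a))"
    by (rule bounded_linear_intro[of _ "cmod \<mu>"])
      (simp_all add: scaleC_add_right scaleR_scaleC scaleC_scaleC norm_scaleC mult.commute)
  then show ?thesis by (simp add: bounded_clinear_def scaleC_scaleC mult.commute)
qed

lemma closed_preimage:
  assumes "bounded_clinear f" "closed S" shows "closed {x. f x \<in> S}"
  using continuous_closed_vimage[OF assms(2), of f] bounded_clinear_imp_bounded_linear[OF assms(1)]
  by (simp add: vimage_def linear_continuous_at)

lemma csubspace_preimage: "clinear f \<Longrightarrow> csubspace S \<Longrightarrow> csubspace {x. f x \<in> S}"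
  by (rule complex_vector_pair.linear_subspace_linear_preimage)

lemma closed_null_space: "bounded_clinear f \<Longrightarrow> closed (null_space f)"
  using closed_preimage[of f "{0}"] by (simp add: null_space_def)

lemma cspan_insert: "cspan (insert b B) = cspan B + cspan {b}"
  using cspan_Un[of B "{b}"] by simp

lemma mem_cspan_singleton: "x \<in> cspan {b} \<longleftrightarrow> (\<exists>c. x = c *\<^sub>C b)"
  by (auto simp: complex_vector.span_singleton)

lemma mem_plus_cspan_singleton: "x \<in> N + cspan {b} \<longleftrightarrow> (\<exists>n c. n \<in> N \<and> x = n + c *\<^sub>C b)"
  by (force simp: set_plus_def complex_vector.span_singleton)

text \<open>If \<open>b\<close> is outside \<open>N\<close>, a functional that is 0 on
  \<open>N\<close> and 1 at \<open>b\<close> reads off the coefficient of \<open>b\<close>, so the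
  sum is the preimage of \<open>N\<close> under x - \<phi>(x) b.\<close>

lemma closed_plus_cspan_singleton:
  fixes N :: "'a::complex_normed_vector set"
  assumes "csubspace N" "closed N" shows "closed (N + cspan {b})"
proof (cases "b \<in> N")
  case True
  then have "N + cspan {b} = N"
    using plus_subset[OF assms(1) order_refl, of "cspan {b}"] complex_vector.span_minimal[of "{b}" N]
      subset_plus_left[OF csubspace_cspan, of N "{b}"] assms(1) by auto
  then show ?thesis using assms by simp
next
  case False
  then obtain \<phi> :: "'a \<Rightarrow> complex" where \<phi>: "bounded_clinear \<phi>" "\<forall>x\<in>N. \<phi> x = 0" "\<phi> b = 1"
    using separating_functional[OF assms] by blast
  note lin = clinear_simps[OF bounded_clinearD[OF \<phi>(1)]]
  have "N + cspan {b} = {x. x - \<phi> x *\<^sub>C b \<in> N}"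
  proof (intro subset_antisym subsetI CollectI)
    fix x assume "x \<in> N + cspan {b}"
    then obtain n c where "n \<in> N" "x = n + c *\<^sub>C b" unfolding mem_plus_cspan_singleton by blast
    then show "x - \<phi> x *\<^sub>C b \<in> N" using \<phi> by (simp add: lin scaleC_complex_def)
  next
    fix x assume "x \<in> {x. x - \<phi> x *\<^sub>C b \<in> N}"
    then have "(x - \<phi> x *\<^sub>C b) + \<phi> x *\<^sub>C b \<in> N + cspan {b}"
      by (intro set_plus_intro) (auto simp: mem_cspan_singleton)
    then show "x \<in> N + cspan {b}" by simp
  qed
  then show ?thesis
    using closed_preimage[OF bounded_clinear_diff[OF bounded_clinear_ident bounded_clinear_scaleC_left[OF \<phi>(1)]] assms(2)]
    by simp
qed

lemma closed_plus_cspan: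
  fixes N :: "'a::complex_normed_vector set"
  assumes "csubspace N" "closed N" "finite B" shows "closed (N + cspan B)"
  using assms(3)
proof (induction B)
  case empty then show ?case using assms by (simp add: set_plus_def)
next
  case (insert b B)
  have "closed ((N + cspan B) + cspan {b})"
    using insert assms(1) by (intro closed_plus_cspan_singleton csubspace_plus csubspace_cspan)
  then show ?case by (simp add: cspan_insert[of b B] add.assoc)
qed

lemma closed_cspan:
  assumes "finite B" shows "closed (cspan (B :: 'a::complex_normed_vector set))"
  using closed_plus_cspan[of "{0}" B] assms by (simp add: set_plus_def)

lemma closed_of_finite_cdimension:
  assumes "cdimension V < \<infinity>" shows "closed (V :: 'a::complex_normed_vector set)"
  using assms closed_cspan unfolding finite_cdimension_iff by blast

lemma closed_almost_superset:
  fixes M :: "'a::complex_normed_vector set"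
  assumes "csubspace M" "csubspace N" "closed N" "N \<subseteq> M" "M \<preceq> N"
  shows "closed M"
proof -
  obtain B where "finite B" "quotient_basis M N B" using finite_quotient_basis_exists[OF assms(1,2,4,5)] by blast
  then have "M = N + cspan B" by (simp add: quotient_basis_def add.commute)
  then show ?thesis using closed_plus_cspan[OF assms(2,3) \<open>finite B\<close>] by simp
qed

text \<open>Neubauer's lemma with a finite-dimensional algebraic complement of f(E) in
  \<open>V\<close> as second summand: the sum is the closed space \<open>V\<close>, the intersection
  is 0.\<close>

lemma closed_range_of_almost_superset:
  fixes f :: "'a::complex_banach \<Rightarrow> 'b::complex_banach"
  assumes f: "bounded_clinear f" and E: "csubspace E" "closed E"
    and V: "csubspace V" "closed V" "f ` E \<subseteq> V" "V \<preceq> f ` E"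
  shows "closed (f ` E)"
proof -
  have fE: "csubspace (f ` E)" by (rule csubspace_image[OF bounded_clinearD[OF f] E(1)])
  obtain B where B: "finite B" "quotient_basis V (f ` E) B"
    using finite_quotient_basis_exists[OF V(1) fE V(3,4)] by blast
  show ?thesis
  proof (rule closed_summand)
    show "bounded_linear f" by (rule bounded_clinear_imp_bounded_linear[OF f])
    show "subspace E" by (rule csubspace_imp_subspace[OF E(1)])
    show "bounded_linear (\<lambda>x::'b. x)" by (rule bounded_linear_ident)
    show "subspace (cspan B)" by (rule csubspace_imp_subspace[OF csubspace_cspan])
    show "closed (cspan B)" by (rule closed_cspan[OF B(1)])
    show "closed (f ` E + (\<lambda>x. x) ` cspan B)"
      using B(2) V(2) by (simp add: quotient_basis_def add.commute)
    show "closed (f ` E \<inter> (\<lambda>x. x) ` cspan B)"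
      using quotient_basis_Int[OF V(1) fE V(3) B(2)] by (simp add: Int_commute)
  qed fact
qed

text \<open>Write b = v + c along \<open>V\<close> and its complement \<open>C\<close>. Adding
  \<open>b\<close> to \<open>V\<close> is adding \<open>c\<close>, so \<open>C\<close> must lose the
  direction \<open>c\<close>: a functional with value 1 at \<open>c\<close> cuts it down to its
  kernel in \<open>C\<close>.\<close>

lemma topologically_complemented_insert:
  fixes V :: "'a::complex_normed_vector set"
  assumes "topologically_complemented V" shows "topologically_complemented (V + cspan {b})"
proof (cases "b \<in> V")
  case True
  have V: "csubspace V" using assms by (simp add: topologically_complemented_def)
  have "V + cspan {b} = V"
    using True plus_subset[OF V order_refl, of "cspan {b}"] complex_vector.span_minimal[of "{b}" V]
      subset_plus_left[OF csubspace_cspan, of V "{b}"] V by auto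
  then show ?thesis using assms by simp
next
  case False
  obtain C where V: "csubspace V" "closed V" and C: "csubspace C" "closed C" "V \<inter> C = {0}" "V + C = UNIV"
    using assms by (auto simp: topologically_complemented_def)
  have "b \<in> V + C" using C(4) by simp
  then obtain v c where vc: "v \<in> V" "c \<in> C" "b = v + c" by (auto simp: set_plus_def)
  have "c \<noteq> 0" using False vc by auto
  then obtain \<phi> :: "'a \<Rightarrow> complex" where \<phi>: "bounded_clinear \<phi>" "\<phi> c = 1"
    using separating_functional[of "{0}" c] by auto
  note lin = clinear_simps[OF bounded_clinearD[OF \<phi>(1)]]
  define D where "D = C \<inter> null_space \<phi>"
  have D: "csubspace D" "closed D" unfolding D_def
    using C \<phi> by (auto intro!: csubspace_Int csubspace_null_space closed_Int closed_null_space bounded_clinearD)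
  have W: "csubspace (V + cspan {b})" "closed (V + cspan {b})"
    by (intro csubspace_plus V csubspace_cspan, intro closed_plus_cspan_singleton V)
  have "x = 0" if xb: "x \<in> V + cspan {b}" and xD: "x \<in> D" for x
  proof -
    obtain w a where wa: "w \<in> V" "x = w + a *\<^sub>C b" using xb unfolding mem_plus_cspan_singleton by blast
    have x: "x = (w + a *\<^sub>C v) + a *\<^sub>C c" using wa vc by (simp add: scaleC_add_right)
    have "x - a *\<^sub>C c \<in> C" using xD C(1) vc(2) unfolding D_def
      by (intro csubspace_diff csubspace_scale) auto
    moreover have "w + a *\<^sub>C v \<in> V" using wa vc V(1)
      by (intro csubspace_add csubspace_scale)
    ultimately have 0: "w + a *\<^sub>C v = 0" using C(3) x by auto
    moreover have "\<phi> x = 0" using xD by (simp add: D_def null_space_def)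
    ultimately show "x = 0" using x \<phi>(2) by (simp add: lin scaleC_complex_def)
  qed
  then have "(V + cspan {b}) \<inter> D = {0}"
    using csubspace_0[OF W(1)] csubspace_0[OF D(1)] by blast
  moreover have "x \<in> (V + cspan {b}) + D" for x
  proof -
    have "x \<in> V + C" using C(4) by simp
    then obtain w d where wd: "w \<in> V" "d \<in> C" "x = w + d" by (auto simp: set_plus_def)
    have "d - \<phi> d *\<^sub>C c \<in> D" using wd vc C(1) \<phi>(2) unfolding D_def null_space_def
      by (auto simp: lin scaleC_complex_def intro!: csubspace_diff csubspace_scale)
    moreover have "(w - \<phi> d *\<^sub>C v) + \<phi> d *\<^sub>C b \<in> V + cspan {b}" using wd vc V(1)
      by (intro set_plus_intro csubspace_diff csubspace_scale
          complex_vector.span_scale complex_vector.span_base) auto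
    ultimately have "((w - \<phi> d *\<^sub>C v) + \<phi> d *\<^sub>C b) + (d - \<phi> d *\<^sub>C c) \<in> (V + cspan {b}) + D"
      by (rule set_plus_intro[rotated])
    moreover have "((w - \<phi> d *\<^sub>C v) + \<phi> d *\<^sub>C b) + (d - \<phi> d *\<^sub>C c) = x"
      using vc wd by (simp add: scaleC_add_right)
    ultimately show ?thesis by simp
  qed
  ultimately show ?thesis unfolding topologically_complemented_def using W D by blast
qed

lemma topologically_complemented_plus_cspan:
  fixes V :: "'a::complex_normed_vector set"
  assumes "topologically_complemented V" "finite B" shows "topologically_complemented (V + cspan B)"
  using assms(2)
proof (induction B)
  case empty then show ?case using assms by (simp add: set_plus_def)
next
  case (insert b B)
  then show ?case using topologically_complemented_insert[of "V + cspan B" b]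
    by (simp add: cspan_insert[of b B] add.assoc)
qed

text \<open>What \<open>W\<close> lacks of \<open>V\<close> is finite-dimensional and can be added
  to the complement of \<open>V\<close> without losing closedness.\<close>

lemma topologically_complemented_almost_subset:
  fixes V :: "'a::complex_normed_vector set"
  assumes V: "topologically_complemented V" and W: "csubspace W" "closed W" "W \<subseteq> V" "V \<preceq> W"
  shows "topologically_complemented W"
proof -
  obtain C where Vs: "csubspace V" and C: "csubspace C" "closed C" "V \<inter> C = {0}" "V + C = UNIV"
    using V by (auto simp: topologically_complemented_def)
  obtain B where B: "finite B" "quotient_basis V W B"
    using finite_quotient_basis_exists[OF Vs W(1,3,4)] by blast
  have VB: "V = cspan B + W" using B(2) by (simp add: quotient_basis_def)
  have BW: "cspan B \<inter> W = {0}" by (rule quotient_basis_Int[OF Vs W(1,3) B(2)])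
  have "x = 0" if xW: "x \<in> W" and xC: "x \<in> C + cspan B" for x
  proof -
    obtain c s where cs: "c \<in> C" "s \<in> cspan B" "x = c + s" using xC by (auto simp: set_plus_def)
    have "s \<in> V" using cs(2) subset_plus_left[OF W(1), of "cspan B"] VB by auto
    then have "x - s \<in> V" using xW W(3) Vs by (intro csubspace_diff) auto
    then have "c = 0" using cs C(3) by auto
    then show "x = 0" using cs xW BW by auto
  qed
  moreover have CB: "csubspace (C + cspan B)" "closed (C + cspan B)"
    by (intro csubspace_plus C csubspace_cspan, intro closed_plus_cspan C B)
  ultimately have "W \<inter> (C + cspan B) = {0}"
    using csubspace_0[OF W(1)] csubspace_0 by blast
  moreover have "W + (C + cspan B) = UNIV" using C(4) VB by (simp add: ac_simps)
  ultimately show ?thesis unfolding topologically_complemented_def using W CB by blast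
qed

text \<open>First enlarge \<open>V\<close> by finitely many dimensions until it contains
  \<open>W\<close>, then shrink to \<open>W\<close>.\<close>

lemma topologically_complemented_commensurable:
  fixes V :: "'a::complex_normed_vector set"
  assumes V: "topologically_complemented V" and W: "csubspace W" "closed W" and "W \<preceq> V" "V \<preceq> W"
  shows "topologically_complemented W"
proof -
  obtain B where B: "finite B" "W \<subseteq> V + cspan B" using \<open>W \<preceq> V\<close> by (auto simp: almost_subset_def)
  have "V + cspan B \<preceq> V" unfolding almost_subset_def using B(1) by blast
  then show ?thesis
    using topologically_complemented_almost_subset[OF topologically_complemented_plus_cspan[OF V B(1)] W B(2)]
      almost_subset_trans \<open>V \<preceq> W\<close> by blast
qed

lemma topologically_complemented_range:
  fixes q :: "'a::complex_normed_vector \<Rightarrow> 'a"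
  assumes q: "bounded_clinear q" and idem: "\<And>x. q (q x) = q x"
  shows "topologically_complemented (range q)"
proof -
  note lin = clinear_simps[OF bounded_clinearD[OF q]]
  have r: "range q = {x. x - q x \<in> {0}}" using idem by (auto simp: image_iff)
  have "closed (range q)" unfolding r
    by (intro closed_preimage bounded_clinear_diff bounded_clinear_ident q) auto
  moreover have "range q \<inter> null_space q = {0}"
    using idem by (auto simp: null_space_def lin image_iff intro!: exI[of _ 0])
  moreover have "x \<in> range q + null_space q" for x
  proof -
    have "q x + (x - q x) \<in> range q + null_space q"
      by (intro set_plus_intro) (auto simp: null_space_def lin idem)
    then show ?thesis by simp
  qed
  ultimately show ?thesis unfolding topologically_complemented_def
    using q bounded_clinearD[OF q]
    by (auto intro!: exI[of _ "null_space q"] csubspace_image csubspace_null_space closed_null_space)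
qed

section \<open>Powers of an operator and the index\<close>

lemma clinear_funpow:
  fixes A :: "'a::complex_vector \<Rightarrow> 'a"
  assumes "clinear A" shows "clinear (A ^^ n)"
  by (rule clinearI) (induction n; simp add: clinear_simps[OF assms])+

lemma image_range_funpow: "A ` range (A ^^ n) = range (A ^^ Suc n)"
  by (auto simp: image_image)

lemma range_funpow_antimono: "m \<le> n \<Longrightarrow> range ((A :: 'a \<Rightarrow> 'a) ^^ n) \<subseteq> range (A ^^ m)"
  using funpow_add[of m "n - m" A] by (auto simp: image_def)

lemma csubspace_range_funpow: "clinear A \<Longrightarrow> csubspace (range ((A :: 'a::complex_vector \<Rightarrow> 'a) ^^ n))"
  using csubspace_image[OF clinear_funpow] csubspace_UNIV by blast

text \<open>Writing the sum as a preimage gives closedness by continuity and turns the stability of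
  kernels into the stability of these sums.\<close>

lemma range_plus_null_space_funpow:
  fixes A :: "'a::complex_vector \<Rightarrow> 'a"
  assumes A: "clinear A"
  shows "range (A ^^ n) + null_space (A ^^ d) = {x. (A ^^ d) x \<in> range (A ^^ (d + n))}"
proof (intro subset_antisym subsetI CollectI)
  note lin = clinear_simps[OF clinear_funpow[OF A]]
  fix x assume "x \<in> range (A ^^ n) + null_space (A ^^ d)"
  then obtain z y where "x = (A ^^ n) z + y" "(A ^^ d) y = 0" by (auto simp: set_plus_def null_space_def)
  then show "(A ^^ d) x \<in> range (A ^^ (d + n))" by (simp add: lin funpow_add)
next
  note lin = clinear_simps[OF clinear_funpow[OF A]]
  fix x assume "x \<in> {x. (A ^^ d) x \<in> range (A ^^ (d + n))}"
  then obtain z where "(A ^^ d) x = (A ^^ d) ((A ^^ n) z)" by (auto simp: funpow_add)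
  then have "(A ^^ n) z + (x - (A ^^ n) z) \<in> range (A ^^ n) + null_space (A ^^ d)"
    by (intro set_plus_intro) (auto simp: null_space_def lin)
  then show "x \<in> range (A ^^ n) + null_space (A ^^ d)" by simp
qed

lemma range_plus_null_space_funpow_1:
  fixes A :: "'a::complex_vector \<Rightarrow> 'a"
  assumes A: "clinear A"
  shows "range A + null_space (A ^^ d) = {x. (A ^^ d) x \<in> range (A ^^ Suc d)}"
  using range_plus_null_space_funpow[OF A, of 1 d] by simp

lemma null_space_funpow_mono:
  fixes A :: "'a::complex_vector \<Rightarrow> 'a"
  assumes A: "clinear A" and "m \<le> n"
  shows "null_space (A ^^ m) \<subseteq> null_space (A ^^ n)"
  using funpow_add[of "n - m" m A] assms(2)
  by (auto simp: null_space_def clinear_simps[OF clinear_funpow[OF A]])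

text \<open>The two recursions say that the index of the restriction of \<open>A\<close> to \<open>range (A ^^ n)\<close> does
  not depend on \<open>n\<close>.\<close>

lemma defect_recursion:
  fixes A :: "'a::complex_vector \<Rightarrow> 'a"
  assumes A: "clinear A"
  defines "t \<equiv> \<lambda>n. quotient_dimension (null_space A \<inter> range (A ^^ n)) (null_space A \<inter> range (A ^^ Suc n))"
  shows "cdimension (null_space A \<inter> range (A ^^ n)) =
      t n + cdimension (null_space A \<inter> range (A ^^ Suc n))"
    and "quotient_dimension (range (A ^^ n)) (A ` range (A ^^ n)) =
      t n + quotient_dimension (range (A ^^ Suc n)) (A ` range (A ^^ Suc n))"
proof -
  let ?R = "\<lambda>n. range (A ^^ n)" and ?K = "\<lambda>n. null_space A \<inter> range (A ^^ n)"
  have R: "csubspace (?R n)" for n by (rule csubspace_range_funpow[OF A])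
  have K: "csubspace (?K n)" for n by (intro csubspace_Int csubspace_null_space A R)
  have dec: "?R (Suc n) \<subseteq> ?R n" for n by (rule range_funpow_antimono) simp
  show "cdimension (?K n) = t n + cdimension (?K (Suc n))"
  proof -
    have "{0} \<subseteq> ?K (Suc n)" using csubspace_0[OF K[of "Suc n"]] by blast
    moreover have "?K (Suc n) \<subseteq> ?K n" using dec by blast
    ultimately show ?thesis
      using quotient_dimension_add[OF complex_vector.subspace_single_0 K K, of "Suc n" n]
      unfolding t_def quotient_dimension_zero[OF K] by blast
  qed
  \<comment> \<open>The space \<open>?R (Suc n) + ?K n\<close> is placed in between.
    \<open>A\<close> identifies the upper quotient with \<open>?R (Suc n)\<close> modulo
    \<open>?R (Suc (Suc n))\<close>; the lower one is \<open>?K n\<close> modulo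
    \<open>?K (Suc n)\<close> by the second isomorphism theorem, of dimension
    \<open>t n\<close>.\<close>
  have "quotient_dimension (?R n) (?R (Suc n)) =
      quotient_dimension (?R n) (?R (Suc n) + ?K n) + quotient_dimension (?R (Suc n) + ?K n) (?R (Suc n))"
    using dec[of n] by (intro quotient_dimension_add csubspace_plus R K plus_subset subset_plus_left) auto
  moreover have "quotient_dimension (?R (Suc n)) (?R (Suc (Suc n))) = quotient_dimension (?R n) (?R (Suc n) + ?K n)"
    using quotient_dimension_image[OF A R R dec, of n]
    by (simp only: image_range_funpow Int_commute[of "range (A ^^ n)"])
  moreover have "?K n \<inter> ?R (Suc n) = ?K (Suc n)" using dec[of n] by auto
  then have "quotient_dimension (?R (Suc n) + ?K n) (?R (Suc n)) = t n"
    using quotient_dimension_second_iso[OF K R, of n "Suc n"] by (simp only: t_def add.commute)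
  ultimately show "quotient_dimension (?R n) (A ` ?R n) =
      t n + quotient_dimension (?R (Suc n)) (A ` ?R (Suc n))"
    by (simp only: image_range_funpow add.commute)
qed

text \<open>\<open>g\<close> is nonincreasing with values in a well-order, so it becomes constant.
  Its minimum is finite, hence cancels and leaves \<open>t m = 0\<close>.\<close>

lemma decreasing_enat_eventually_constant:
  fixes g t :: "nat \<Rightarrow> enat"
  assumes rec: "\<And>m. g m = t m + g (Suc m)" and fin: "g n < \<infinity>"
  shows "\<exists>d. \<forall>m\<ge>d. t m = 0"
proof -
  obtain d where d: "\<And>m. g d \<le> g m"
    using exists_least_iff[of "\<lambda>v. v \<in> range g"] by (metis linorder_not_less rangeE rangeI)
  have dec: "g (Suc m) \<le> g m" for m by (subst (2) rec) simp
  have "g m \<le> g d" if "m \<ge> d" for m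
    using that by (induction m rule: dec_induct) (auto intro: order_trans[OF dec])
  then have eq: "g m = g d" if "m \<ge> d" for m using d that by (simp add: order_antisym)
  have "g d < \<infinity>" using d fin order_le_less_trans by blast
  then have "t m = 0" if "m \<ge> d" for m
    using rec[of m] eq[of m] eq[of "Suc m"] that by (cases "t m"; cases "g d") (auto simp: zero_enat_def)
  then show ?thesis by blast
qed

text \<open>The algebraic content of being semi Fredholm on a range. Closedness is left out because
  the recursions see dimensions only.\<close>

definition semi_fredholm_at :: "('a::complex_vector \<Rightarrow> 'a) \<Rightarrow> nat \<Rightarrow> bool" where
  "semi_fredholm_at A n \<longleftrightarrow> cdimension (null_space A \<inter> range (A ^^ n)) < \<infinity> \<or>
     quotient_dimension (range (A ^^ n)) (A ` range (A ^^ n)) < \<infinity>"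

text \<open>Nullity and defect drop by the same \<open>t\<close>; as one of them is finite,
  \<open>t\<close> is finite and cancels in the difference.\<close>

lemma fredholm_index_Suc:
  fixes A :: "'a::complex_normed_vector \<Rightarrow> 'a"
  assumes A: "clinear A" and sf: "semi_fredholm_at A n"
  shows "semi_fredholm_at A (Suc n)"
    and "fredholm_index_on (range (A ^^ Suc n)) A = fredholm_index_on (range (A ^^ n)) A"
proof -
  define t k c where "t = quotient_dimension (null_space A \<inter> range (A ^^ n)) (null_space A \<inter> range (A ^^ Suc n))"
    and "k = (\<lambda>n. cdimension (null_space A \<inter> range (A ^^ n)))"
    and "c = (\<lambda>n. quotient_dimension (range (A ^^ n)) (A ` range (A ^^ n)))"
  have rec: "k n = t + k (Suc n)" "c n = t + c (Suc n)"
    using defect_recursion[OF A, of n] by (simp_all only: t_def k_def c_def)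
  have fin: "k n < \<infinity> \<or> c n < \<infinity>" using sf by (simp add: semi_fredholm_at_def k_def c_def)
  show "semi_fredholm_at A (Suc n)"
    using fin unfolding rec semi_fredholm_at_def k_def[symmetric] c_def[symmetric]
    by (cases t; cases "k (Suc n)"; cases "c (Suc n)") (auto simp: k_def c_def)
  have "ereal_of_enat (k (Suc n)) - ereal_of_enat (c (Suc n)) = ereal_of_enat (k n) - ereal_of_enat (c n)"
    using fin unfolding rec by (cases t; cases "k (Suc n)"; cases "c (Suc n)") auto
  then show "fredholm_index_on (range (A ^^ Suc n)) A = fredholm_index_on (range (A ^^ n)) A"
    by (simp only: fredholm_index_on_def k_def c_def)
qed

lemma fredholm_index_le:
  fixes A :: "'a::complex_normed_vector \<Rightarrow> 'a"
  assumes A: "clinear A" and sf: "semi_fredholm_at A n" and "n \<le> m"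
  shows "semi_fredholm_at A m \<and> fredholm_index_on (range (A ^^ m)) A = fredholm_index_on (range (A ^^ n)) A"
  using assms(3)
proof (induction m rule: dec_induct)
  case (step m)
  then show ?case using fredholm_index_Suc[OF A, of m] by metis
qed (use sf in simp)

text \<open>Two admissible exponents are compared at their maximum, so the definite description has
  a unique solution.\<close>

lemma b_fredholm_index_eq:
  fixes A :: "'a::complex_normed_vector \<Rightarrow> 'a"
  assumes A: "clinear A" and cl: "closed (range (A ^^ n))"
    and sf: "upper_semi_fredholm_on (range (A ^^ n)) A \<or> lower_semi_fredholm_on (range (A ^^ n)) A"
  shows "b_fredholm_index A = fredholm_index_on (range (A ^^ n)) A"
  unfolding b_fredholm_index_def
proof (rule the_equality)
  have at: "semi_fredholm_at A m"
    if "upper_semi_fredholm_on (range (A ^^ m)) A \<or> lower_semi_fredholm_on (range (A ^^ m)) A" for m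
    using that by (auto simp: semi_fredholm_at_def upper_semi_fredholm_on_def lower_semi_fredholm_on_def)
  fix i assume "\<exists>m. closed (range (A ^^ m)) \<and>
    (upper_semi_fredholm_on (range (A ^^ m)) A \<or> lower_semi_fredholm_on (range (A ^^ m)) A) \<and>
    i = fredholm_index_on (range (A ^^ m)) A"
  then obtain m where "semi_fredholm_at A m" "i = fredholm_index_on (range (A ^^ m)) A" using at by blast
  then show "i = fredholm_index_on (range (A ^^ n)) A"
    using fredholm_index_le[OF A _ max.cobounded1, of m n] fredholm_index_le[OF A at[OF sf] max.cobounded2, of m]
    by simp
qed (use cl sf in blast)

text \<open>A finite infimum rules out the empty set, and over naturals it is attained:
  \<open>d\<close> itself is a stable exponent.\<close>

lemma dis_eq_enatD:
  assumes "dis A = enat d" "d \<le> m"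
  shows "null_space A \<inter> range (A ^^ d) = null_space A \<inter> range (A ^^ m)"
proof -
  let ?S = "{n. \<forall>m\<ge>n. null_space A \<inter> range (A ^^ n) = null_space A \<inter> range (A ^^ m)}"
  have "?S \<noteq> {}"
  proof
    assume "?S = {}"
    then have "dis A = \<infinity>" unfolding dis_def by (simp only: image_empty Inf_empty top_enat_def)
    then show False using assms(1) by simp
  qed
  moreover from this obtain n where "n \<in> ?S" by blast
  then have "enat n \<in> enat ` ?S" by (rule imageI)
  then have "(LEAST x. x \<in> enat ` ?S) \<in> enat ` ?S" by (rule LeastI)
  ultimately have "dis A \<in> enat ` ?S"
    unfolding dis_def Inf_enat_def by (simp only: image_is_empty if_False)
  then obtain k where "enat d = enat k" "k \<in> ?S" using assms(1) by auto
  then show ?thesis using assms(2) by simp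
qed

text \<open>Both recursions share the drops \<open>t\<close>. Whichever of nullity and defect is
  finite forces them to vanish eventually, and a zero drop means that the kernels agree.\<close>

lemma dis_finite:
  fixes A :: "'a::complex_normed_vector \<Rightarrow> 'a"
  assumes A: "clinear A" and sf: "semi_fredholm_at A n"
  shows "\<exists>d. dis A = enat d"
proof -
  let ?K = "\<lambda>n. null_space A \<inter> range (A ^^ n)"
  have K: "csubspace (?K n)" for n by (intro csubspace_Int csubspace_null_space A csubspace_range_funpow)
  have dec: "?K (Suc n) \<subseteq> ?K n" for n using range_funpow_antimono[of n "Suc n" A] by auto
  let ?t = "\<lambda>m. quotient_dimension (?K m) (?K (Suc m))"
  have "\<exists>d. \<forall>m\<ge>d. ?t m = 0"
    using sf unfolding semi_fredholm_at_def
  proof (elim disjE)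
    assume "cdimension (?K n) < \<infinity>"
    with defect_recursion(1)[OF A] show ?thesis
      by (rule decreasing_enat_eventually_constant[where t = ?t and g = "\<lambda>m. cdimension (?K m)"])
  next
    let ?g = "\<lambda>m. quotient_dimension (range (A ^^ m)) (A ` range (A ^^ m))"
    assume "?g n < \<infinity>"
    with defect_recursion(2)[OF A] show ?thesis
      by (rule decreasing_enat_eventually_constant[where t = ?t and g = ?g])
  qed
  then obtain d where d: "\<forall>m\<ge>d. ?t m = 0" by blast
  have "?K d = ?K m" if "m \<ge> d" for m
    using that
  proof (induction m rule: dec_induct)
    case (step m)
    then show ?case using quotient_dimension_eq_0[OF K K dec, of m] d by simp
  qed simp
  then have "d \<in> {n. \<forall>m\<ge>n. ?K n = ?K m}" by simp
  then have "dis A \<le> enat d" unfolding dis_def by (rule INF_lower)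
  then show ?thesis by (cases "dis A") auto
qed

text \<open>If A^(m+1) x = 0, then A^m x lies in the kernel of \<open>A\<close> and in the range of
  A^m, hence by stability in the range of A^(m+n); so \<open>x\<close> differs from a point of the
  range of A^n by a point killed by A^m.\<close>

lemma range_plus_null_space_stable:
  fixes A :: "'a::complex_vector \<Rightarrow> 'a"
  assumes A: "clinear A" and K: "\<And>m. d \<le> m \<Longrightarrow> null_space A \<inter> range (A ^^ d) = null_space A \<inter> range (A ^^ m)"
    and "d \<le> m"
  shows "range (A ^^ n) + null_space (A ^^ m) = range (A ^^ n) + null_space (A ^^ d)"
  using \<open>d \<le> m\<close>
proof (induction m rule: dec_induct)
  case (step m)
  note lin = clinear_simps[OF clinear_funpow[OF A]]
  have R: "csubspace (range (A ^^ n))" "csubspace (null_space (A ^^ m))"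
    by (intro csubspace_range_funpow csubspace_null_space clinear_funpow A)+
  have "null_space (A ^^ Suc m) \<subseteq> range (A ^^ n) + null_space (A ^^ m)"
  proof
    fix x assume "x \<in> null_space (A ^^ Suc m)"
    then have "(A ^^ m) x \<in> null_space A \<inter> range (A ^^ m)" by (simp add: null_space_def)
    then have "(A ^^ m) x \<in> null_space A \<inter> range (A ^^ (m + n))"
      using K[of m] K[of "m + n"] step(1) by (simp add: step.hyps)
    then show "x \<in> range (A ^^ n) + null_space (A ^^ m)"
      unfolding range_plus_null_space_funpow[OF A] by simp
  qed
  then have "range (A ^^ n) + null_space (A ^^ Suc m) \<subseteq> range (A ^^ n) + null_space (A ^^ m)"
    using R by (intro plus_subset csubspace_plus subset_plus_left)
  moreover have "range (A ^^ n) + null_space (A ^^ m) \<subseteq> range (A ^^ n) + null_space (A ^^ Suc m)"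
    by (intro set_plus_mono2 order_refl null_space_funpow_mono A) simp
  ultimately show ?case using step.IH by (metis order_antisym)
qed simp

text \<open>Here \<open>U\<close> is a common subspace of finite codimension; the identity for \<open>W\<close> and its analogue for
  another space \<open>V\<close> share all terms except kernel and cokernel.\<close>

lemma index_of_restriction:
  fixes A :: "'a::complex_vector \<Rightarrow> 'a"
  assumes A: "clinear A" and W: "csubspace W" "A ` W \<subseteq> W" and Z: "csubspace Z" "W \<subseteq> Z"
    and U: "csubspace U" "U \<subseteq> W"
  shows "quotient_dimension Z (A ` U) + cdimension (null_space A \<inter> W) =
    quotient_dimension Z U + cdimension (U \<inter> null_space A) + quotient_dimension W (A ` W)"
proof -
  let ?q = quotient_dimension
  define K where "K = W \<inter> null_space A"
  have K: "csubspace K" unfolding K_def by (intro csubspace_Int W csubspace_null_space A)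
  have AW: "csubspace (A ` W)" "csubspace (A ` U)" using csubspace_image[OF A] W U by auto
  have sub: "A ` U \<subseteq> A ` W" "A ` W \<subseteq> Z" "A ` U \<subseteq> W" "U \<subseteq> Z" using U W Z by auto
  have sub': "U + K \<subseteq> W" "U \<subseteq> U + K"
    by (intro plus_subset W U, simp add: K_def) (rule subset_plus_left[OF K])
  \<comment> \<open>Both sides of the claim reduce to the same four terms: the dimensions of Z/W,
    W/A(W), W/(U + K) and \<open>K\<close>, the last one split on the right along K \<inter> U. No
    subtraction occurs, so infinite values are harmless.\<close>
  have 1: "?q Z (A ` U) = ?q Z W + ?q W (A ` U)"
    by (intro quotient_dimension_add AW W Z sub sub')
  have 2: "?q W (A ` U) = ?q W (A ` W) + ?q (A ` W) (A ` U)"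
    by (intro quotient_dimension_add AW W sub sub')
  have 3: "?q (A ` W) (A ` U) = ?q W (U + K)"
    using quotient_dimension_image[OF A U(1) W(1) U(2)] by (simp add: K_def)
  have 4: "?q W U = ?q W (U + K) + ?q (U + K) U"
    by (intro quotient_dimension_add csubspace_plus U W K sub sub')
  have 5: "?q (U + K) U = ?q K (K \<inter> U)"
    using quotient_dimension_second_iso[OF K U(1)] by (simp add: add.commute)
  have "{0} \<subseteq> K \<inter> U" using csubspace_0 K U(1) by auto
  then have 6: "cdimension K = ?q K (K \<inter> U) + cdimension (K \<inter> U)"
    using quotient_dimension_add[of "{0}" "K \<inter> U" K] K U(1)
    by (simp add: quotient_dimension_zero csubspace_Int)
  have 7: "?q Z U = ?q Z W + ?q W U" by (intro quotient_dimension_add W Z U)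
  have "K \<inter> U = U \<inter> null_space A" "K = null_space A \<inter> W" using U by (auto simp: K_def)
  then show ?thesis using 1 2 3 4 5 6 7 by (simp add: ac_simps)
qed

text \<open>The restriction identity is applied to \<open>A\<close> on \<open>W\<close> and to
  \<open>L\<close> on \<open>V\<close>. The images of \<open>U\<close> agree and the codimension of
  \<open>U\<close> in V + W is finite; cancelling it leaves nullity of \<open>A\<close> + defect of
  \<open>L\<close> = defect of \<open>A\<close>.\<close>

lemma null_le_defect_of_injective:
  fixes A L :: "'a::complex_vector \<Rightarrow> 'a"
  assumes A: "clinear A" "csubspace W" "A ` W \<subseteq> W" and L: "clinear L" "csubspace V" "L ` V \<subseteq> V"
    and U: "csubspace U" "U \<subseteq> V" "U \<subseteq> W" "V \<preceq> U" "W \<preceq> U" and eq: "\<And>x. x \<in> U \<Longrightarrow> A x = L x"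
    and inj: "null_space L \<inter> V = {0}"
  shows "cdimension (null_space A \<inter> W) \<le> quotient_dimension W (A ` W)"
proof -
  let ?Z = "V + W" and ?q = quotient_dimension
  have Z: "csubspace ?Z" "V \<subseteq> ?Z" "W \<subseteq> ?Z"
    using A(2) L(2) by (auto intro: csubspace_plus subset_plus_left[THEN subsetD] subset_plus_right[THEN subsetD])
  have im: "A ` U = L ` U" using eq by auto
  have "U \<inter> null_space L = {0}" using inj U csubspace_0[OF U(1)] csubspace_0[OF csubspace_null_space[OF L(1)]] by auto
  moreover have "U \<inter> null_space A = U \<inter> null_space L" using eq by (auto simp: null_space_def)
  ultimately have kU: "cdimension (U \<inter> null_space A) = 0" "cdimension (U \<inter> null_space L) = 0"
    by (simp_all add: cdimension_0)
  have eA: "?q ?Z (A ` U) + cdimension (null_space A \<inter> W) =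
      ?q ?Z U + ?q W (A ` W)"
    using index_of_restriction[OF A Z(1,3) U(1,3)] kU by simp
  have eL: "?q ?Z (A ` U) = ?q ?Z U + ?q V (L ` V)"
    using index_of_restriction[OF L Z(1,2) U(1,2)] kU inj im by (simp add: cdimension_0)
  have "?Z \<preceq> U + U" by (intro almost_subset_plus U)
  then have "?Z \<preceq> U"
    by (rule almost_subset_mono[OF order_refl _ plus_subset[OF U(1) order_refl order_refl]])
  then have "?q ?Z U < \<infinity>" using almost_subset_iff_quotient[OF Z(1) U(1)] U Z by auto
  then show ?thesis using eA eL
    by (cases "?q ?Z U"; cases "?q V (L ` V)";
        cases "?q W (A ` W)"; cases "cdimension (null_space A \<inter> W)") auto
qed

text \<open>A surjective \<open>L\<close> takes V/U onto V/L(U), so L(U) has at most the finite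
  codimension of \<open>U\<close>. The restriction identity for \<open>A\<close> turns this into the
  inequality.\<close>

lemma defect_le_null_of_surjective:
  fixes A L :: "'a::complex_vector \<Rightarrow> 'a"
  assumes A: "clinear A" "csubspace W" "A ` W \<subseteq> W" and L: "clinear L" "csubspace V" "L ` V = V"
    and U: "csubspace U" "U \<subseteq> V" "U \<subseteq> W" "V \<preceq> U" "W \<preceq> U" and eq: "\<And>x. x \<in> U \<Longrightarrow> A x = L x"
  shows "quotient_dimension W (A ` W) \<le> cdimension (null_space A \<inter> W)"
proof -
  let ?Z = "V + W" and ?q = quotient_dimension
  have Z: "csubspace ?Z" "V \<subseteq> ?Z" "W \<subseteq> ?Z"
    using A(2) L(2) by (auto intro: csubspace_plus subset_plus_left[THEN subsetD] subset_plus_right[THEN subsetD])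
  have im: "A ` U = L ` U" using eq by auto
  have LU: "csubspace (L ` U)" "L ` U \<subseteq> V" using csubspace_image[OF L(1) U(1)] U(2) L(3) by auto
  have eA: "?q ?Z (A ` U) + cdimension (null_space A \<inter> W) =
      ?q ?Z U + cdimension (U \<inter> null_space A) + ?q W (A ` W)"
    by (rule index_of_restriction[OF A Z(1,3) U(1,3)])
  have "?q ?Z (A ` U) = ?q ?Z V + ?q V (L ` U)"
    unfolding im by (intro quotient_dimension_add LU L Z)
  also have "?q V (L ` U) = ?q V (U + (V \<inter> null_space L))"
    using quotient_dimension_image[OF L(1) U(1) L(2) U(2)] L(3) by simp
  also have "\<dots> \<le> ?q V U"
    using U(1,2) L csubspace_null_space[OF L(1)]
    by (intro quotient_dimension_antimono_right csubspace_plus csubspace_Int plus_subset subset_plus_left) auto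
  also have "?q ?Z V + ?q V U = ?q ?Z U"
    using quotient_dimension_add[OF U(1) L(2) Z(1) U(2) Z(2)] by simp
  finally have le: "?q ?Z (A ` U) \<le> ?q ?Z U" by (simp add: add_left_mono)
  have "?Z \<preceq> U + U" by (intro almost_subset_plus U)
  then have "?Z \<preceq> U"
    by (rule almost_subset_mono[OF order_refl _ plus_subset[OF U(1) order_refl order_refl]])
  then have "?q ?Z U < \<infinity>" using almost_subset_iff_quotient[OF Z(1) U(1)] U Z by auto
  then show ?thesis using eA le
    by (cases "?q ?Z U"; cases "?q ?Z (A ` U)"; cases "cdimension (U \<inter> null_space A)";
        cases "?q W (A ` W)"; cases "cdimension (null_space A \<inter> W)") auto
qed

section \<open>Finite rank perturbations\<close>

lemma finite_rank_iff: "F \<in> finite_rank_operators \<longleftrightarrow> bounded_clinear F \<and> range F \<preceq> {0}"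
  using almost_subset_zero_iff[OF csubspace_image[OF bounded_clinearD csubspace_UNIV], of F]
  by (auto simp: finite_rank_operators_def)

lemma finite_rank_add:
  assumes "F \<in> finite_rank_operators" "G \<in> finite_rank_operators"
  shows "(\<lambda>x. F x + G x) \<in> finite_rank_operators"
proof -
  have "range F + range G \<preceq> {0} + {0}" using assms by (intro almost_subset_plus) (auto simp: finite_rank_iff)
  moreover have "range (\<lambda>x. F x + G x) \<subseteq> range F + range G" by (auto simp: set_plus_def)
  ultimately have "range (\<lambda>x. F x + G x) \<preceq> {0}" by (auto intro: almost_subset_mono simp: set_plus_def)
  then show ?thesis using assms by (simp add: finite_rank_iff bounded_clinear_add)
qed

lemma finite_rank_minus:
  assumes "F \<in> finite_rank_operators" shows "(\<lambda>x. - F x) \<in> finite_rank_operators"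
proof -
  have F: "bounded_clinear F" using assms by (simp add: finite_rank_iff)
  have "- F x = F (- x)" for x by (simp add: clinear_simps[OF bounded_clinearD[OF F]])
  then have "range (\<lambda>x. - F x) \<subseteq> range F" by auto
  then show ?thesis using assms by (auto simp: finite_rank_iff bounded_clinear_minus intro: almost_subset_mono)
qed

lemma finite_rank_compose_left:
  assumes "bounded_clinear L" "F \<in> finite_rank_operators"
  shows "(\<lambda>x. L (F x)) \<in> finite_rank_operators"
proof -
  have "L ` range F \<preceq> L ` {0}"
    using assms by (intro almost_subset_image bounded_clinearD) (auto simp: finite_rank_iff)
  then show ?thesis using assms clinear_simps(4)[OF bounded_clinearD[OF assms(1)]]
    by (simp add: finite_rank_iff bounded_clinear_compose image_image)
qed

lemma finite_rank_compose_right: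
  assumes "bounded_clinear L" "F \<in> finite_rank_operators"
  shows "(\<lambda>x. F (L x)) \<in> finite_rank_operators"
proof -
  have "range (\<lambda>x. F (L x)) \<subseteq> range F" by auto
  then show ?thesis using assms by (auto simp: finite_rank_iff bounded_clinear_compose intro: almost_subset_mono)
qed

lemma almost_subset_null_space_finite_rank:
  assumes "F \<in> finite_rank_operators" shows "M \<preceq> null_space F"
proof -
  have F: "clinear F" using assms by (auto simp: finite_rank_iff intro: bounded_clinearD)
  then have "quotient_dimension UNIV (null_space F) < \<infinity>"
    using quotient_dimension_eq[OF F csubspace_UNIV] assms by (simp add: finite_rank_operators_def)
  then have "UNIV \<preceq> null_space F"
    using almost_subset_iff_quotient[OF csubspace_UNIV csubspace_null_space[OF F]] by simp
  then show ?thesis by (rule almost_subset_mono[OF subset_UNIV _ order_refl])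
qed

text \<open>Equality modulo the ideal of finite rank operators. Being symmetric, it makes every
  \<open>\<preceq>\<close> statement below available in both directions.\<close>

definition finite_rank_equiv :: "('a::complex_normed_vector \<Rightarrow> 'a) \<Rightarrow> ('a \<Rightarrow> 'a) \<Rightarrow> bool" where
  "finite_rank_equiv A L \<longleftrightarrow> bounded_clinear A \<and> bounded_clinear L \<and> (\<lambda>x. A x - L x) \<in> finite_rank_operators"

lemma finite_rank_equiv_sym: "finite_rank_equiv A L \<Longrightarrow> finite_rank_equiv L A"
  using finite_rank_minus[of "\<lambda>x. A x - L x"] by (auto simp: finite_rank_equiv_def)

lemma finite_rank_equiv_funpow:
  assumes "finite_rank_equiv A L" shows "finite_rank_equiv (A ^^ n) (L ^^ n)"
proof -
  have A: "bounded_clinear A" and L: "bounded_clinear L" and F: "(\<lambda>x. A x - L x) \<in> finite_rank_operators"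
    using assms by (auto simp: finite_rank_equiv_def)
  have "(\<lambda>x. (A ^^ n) x - (L ^^ n) x) \<in> finite_rank_operators"
  proof (induction n)
    case 0
    have "(\<lambda>x. 0 :: 'a) \<in> finite_rank_operators"
      by (auto simp: finite_rank_iff bounded_clinear_def intro: subset_imp_almost_subset)
    then show ?case by simp
  next
    case (Suc n)
    have "(\<lambda>x. (A ^^ Suc n) x - (L ^^ Suc n) x) =
        (\<lambda>x. L ((A ^^ n) x - (L ^^ n) x) + (A ((A ^^ n) x) - L ((A ^^ n) x)))"
      by (simp add: clinear_simps[OF bounded_clinearD[OF L]])
    then show ?case
      using finite_rank_add[OF finite_rank_compose_left[OF L Suc]
          finite_rank_compose_right[OF bounded_clinear_funpow[OF A, of n] F]] by simp
  qed
  then show ?thesis using A L by (simp add: finite_rank_equiv_def bounded_clinear_funpow)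
qed

lemma finite_rank_equiv_range: "finite_rank_equiv A L \<Longrightarrow> range A \<preceq> range L"
proof -
  assume "finite_rank_equiv A L"
  then have "range L + range (\<lambda>x. A x - L x) \<preceq> range L + {0}"
    by (intro almost_subset_plus[OF subset_imp_almost_subset[OF order_refl]])
      (simp add: finite_rank_equiv_def finite_rank_iff)
  moreover have "range A \<subseteq> range L + range (\<lambda>x. A x - L x)"
  proof
    fix y assume "y \<in> range A"
    then obtain x where "y = L x + (A x - L x)" by auto
    then show "y \<in> range L + range (\<lambda>x. A x - L x)" by blast
  qed
  ultimately show ?thesis by (auto intro: almost_subset_mono simp: set_plus_def)
qed

lemma finite_rank_equiv_null_space: "finite_rank_equiv A L \<Longrightarrow> null_space A \<preceq> null_space L"
proof -
  assume AL: "finite_rank_equiv A L"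
  let ?G = "\<lambda>x. A x - L x"
  have A: "clinear A" and G: "?G \<in> finite_rank_operators"
    using AL by (auto simp: finite_rank_equiv_def bounded_clinearD)
  have "null_space A \<preceq> null_space ?G" by (rule almost_subset_null_space_finite_rank[OF G])
  then have "null_space A \<preceq> null_space A \<inter> null_space ?G"
    using A G by (intro almost_subset_Int_self csubspace_null_space) (auto simp: finite_rank_iff bounded_clinearD)
  moreover have "null_space A \<inter> null_space ?G \<subseteq> null_space L" by (auto simp: null_space_def)
  ultimately show ?thesis by (rule almost_subset_mono[OF order_refl])
qed

text \<open>The two operators agree on the closed, finite-codimensional kernel of
  \<open>A - L\<close>. Closedness passes from the range of \<open>L\<close> down to the image of
  that kernel by Neubauer's lemma, then up to the range of \<open>A\<close> by adding finitely many
  dimensions.\<close>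

lemma finite_rank_equiv_closed_range:
  fixes A :: "'a::complex_banach \<Rightarrow> 'a"
  assumes AL: "finite_rank_equiv A L" and cl: "closed (range L)"
  shows "closed (range A)"
proof -
  let ?G = "\<lambda>x. A x - L x" and ?U = "null_space (\<lambda>x. A x - L x)"
  have A: "bounded_clinear A" and L: "bounded_clinear L" and G: "?G \<in> finite_rank_operators"
    using AL by (auto simp: finite_rank_equiv_def)
  note lA = bounded_clinearD[OF A] and lL = bounded_clinearD[OF L]
  have bG: "bounded_clinear ?G" using G by (simp add: finite_rank_iff)
  have U: "csubspace ?U" "closed ?U"
    by (intro csubspace_null_space bounded_clinearD bG, intro closed_null_space bG)
  have im: "A ` ?U = L ` ?U" by (auto simp: null_space_def image_iff)
  then have LA: "L ` ?U \<subseteq> range A" by (metis image_mono subset_UNIV)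
  have fin: "UNIV \<preceq> ?U" by (rule almost_subset_null_space_finite_rank[OF G])
  have "closed (L ` ?U)"
    by (rule closed_range_of_almost_superset[OF L U _ cl _ almost_subset_image[OF lL fin]])
      (auto intro: csubspace_image[OF lL])
  then show ?thesis
    using LA closed_almost_superset[OF _ _ _ _ almost_subset_image[OF lA fin]] im
      csubspace_image[OF lA csubspace_UNIV] csubspace_image[OF lL U(1)] by simp
qed

lemma finite_rank_equiv_kernels:
  assumes "finite_rank_equiv A L"
  shows "null_space A \<inter> range (A ^^ m) \<preceq> null_space L \<inter> range (L ^^ m)"
    and "range A + null_space (A ^^ m) \<preceq> range L + null_space (L ^^ m)"
proof -
  have "clinear A" "clinear L" using assms by (auto simp: finite_rank_equiv_def bounded_clinearD)
  then show "null_space A \<inter> range (A ^^ m) \<preceq> null_space L \<inter> range (L ^^ m)"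
    by (intro almost_subset_Int finite_rank_equiv_null_space finite_rank_equiv_range finite_rank_equiv_funpow
        assms csubspace_null_space csubspace_range_funpow)
  show "range A + null_space (A ^^ m) \<preceq> range L + null_space (L ^^ m)"
    by (intro almost_subset_plus finite_rank_equiv_null_space finite_rank_equiv_range finite_rank_equiv_funpow assms)
qed

lemma closed_range_plus_null_space:
  fixes A :: "'a::complex_normed_vector \<Rightarrow> 'a"
  assumes "bounded_clinear A" "closed (range (A ^^ Suc m))"
  shows "closed (range A + null_space (A ^^ m))"
  unfolding range_plus_null_space_funpow_1[OF bounded_clinearD[OF assms(1)]]
  by (rule closed_preimage[OF bounded_clinear_funpow[OF assms(1)] assms(2)])

lemma csubspace_range_plus_null_space:
  "clinear A \<Longrightarrow> csubspace (range A + null_space ((A :: 'a::complex_vector \<Rightarrow> 'a) ^^ m))"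
  by (intro csubspace_plus csubspace_null_space clinear_funpow csubspace_image csubspace_UNIV)

text \<open>The intersection of both ranges with the kernel of \<open>A - L\<close>; it is the input
  of the nullity-defect comparison.\<close>

lemma finite_rank_equiv_common_subspace:
  assumes AL: "finite_rank_equiv A L"
  obtains U where "csubspace U" "U \<subseteq> range (L ^^ m)" "U \<subseteq> range (A ^^ m)" "range (L ^^ m) \<preceq> U"
    "range (A ^^ m) \<preceq> U" "\<And>x. x \<in> U \<Longrightarrow> A x = L x"
proof -
  let ?G = "null_space (\<lambda>x. A x - L x)" and ?V = "range (L ^^ m)" and ?W = "range (A ^^ m)"
  have lin: "clinear A" "clinear L" "clinear (\<lambda>x. A x - L x)" and G: "(\<lambda>x. A x - L x) \<in> finite_rank_operators"
    using AL by (auto simp: finite_rank_equiv_def finite_rank_iff bounded_clinearD)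
  have sub: "csubspace ?V" "csubspace ?W" "csubspace ?G"
    by (intro csubspace_range_funpow csubspace_null_space lin)+
  have VW: "?V \<preceq> ?W" "?W \<preceq> ?V"
    using finite_rank_equiv_range[OF finite_rank_equiv_funpow[OF finite_rank_equiv_sym[OF AL]]]
      finite_rank_equiv_range[OF finite_rank_equiv_funpow[OF AL]] by simp_all
  note G' = almost_subset_null_space_finite_rank[OF G]
  have 1: "?V \<preceq> ?V \<inter> ?W" by (rule almost_subset_Int_self[OF sub(1,2) VW(1)])
  have 2: "?W \<preceq> ?V \<inter> ?W"
    using almost_subset_Int_self[OF sub(2,1) VW(2)] by (simp only: Int_commute)
  have 3: "?V \<inter> ?W \<preceq> ?V \<inter> ?W \<inter> ?G" by (intro almost_subset_Int_self csubspace_Int sub G')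
  show thesis
  proof (rule that)
    show "csubspace (?V \<inter> ?W \<inter> ?G)" by (intro csubspace_Int sub)
    show "?V \<preceq> ?V \<inter> ?W \<inter> ?G" by (rule almost_subset_trans[OF 1 3])
    show "?W \<preceq> ?V \<inter> ?W \<inter> ?G" by (rule almost_subset_trans[OF 2 3])
    show "A x = L x" if "x \<in> ?V \<inter> ?W \<inter> ?G" for x using that by (simp add: null_space_def)
  qed blast+
qed

section \<open>Ranges and kernels of one-sided Drazin invertible operators\<close>

text \<open>p = S L is an idempotent commuting with \<open>L\<close>; it satisfies S^m L^m = p for m
  \<ge> 1 and L^m p = L^m for m \<ge> j. So beyond \<open>j\<close> the kernel of L^m is that of
  \<open>p\<close>, and L^m S^m fixes exactly the range of L^m.\<close>

lemma left_drazin_structure: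
  fixes L :: "'a::complex_normed_vector \<Rightarrow> 'a"
  assumes L: "bounded_clinear L" and ld: "left_drazin_invertible L"
  obtains j where "\<And>m. m \<ge> j \<Longrightarrow> null_space L \<inter> range (L ^^ m) = {0}"
    "\<And>m. m \<ge> j \<Longrightarrow> closed (range (L ^^ m))"
    "\<And>m. m \<ge> j \<Longrightarrow> topologically_complemented (range L + null_space (L ^^ m))"
proof -
  obtain S j where S: "bounded_clinear S"
    and "L \<circ> S \<circ> L = S \<circ> L ^^ 2" "S ^^ 2 \<circ> L = S" "S \<circ> L ^^ (j + 1) = L ^^ j"
    using ld by (auto simp: left_drazin_invertible_def)
  then have eq: "L (S (L x)) = S (L (L x))" "S (S (L x)) = S x" "S (L ((L ^^ j) x)) = (L ^^ j) x" for x
    by (auto simp: fun_eq_iff numeral_2_eq_2)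
  note lL = bounded_clinearD[OF L] and lS = bounded_clinearD[OF S]
  note lLm = clinear_funpow[OF lL]
  define p where "p x = S (L x)" for x
  have p: "bounded_clinear p" unfolding p_def by (rule bounded_clinear_compose[OF S L])
  note sp = clinear_simps[OF bounded_clinearD[OF p]]
  have pL: "p (L x) = L (p x)" for x by (simp add: p_def eq)
  have pp: "p (p x) = p x" and Sp: "S (p x) = S x" for x by (simp_all add: p_def eq)
  have pLm: "p ((L ^^ m) x) = (L ^^ m) (p x)" for m x by (induction m) (simp_all add: pL)
  have SL: "(S ^^ Suc m) ((L ^^ Suc m) x) = p x" for m x
  proof (induction m arbitrary: x)
    case (Suc m)
    have "(S ^^ Suc (Suc m)) ((L ^^ Suc (Suc m)) x) = (S ^^ Suc m) (p ((L ^^ Suc m) x))"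
      by (simp add: funpow_swap1 p_def)
    also have "\<dots> = (S ^^ Suc m) ((L ^^ Suc m) (p x))" by (simp only: pLm)
    also have "\<dots> = p x" unfolding Suc.IH by (rule pp)
    finally show ?case .
  qed (simp add: p_def)
  have Lp: "(L ^^ m) (p x) = (L ^^ m) x" if "m \<ge> j" for m x
  proof -
    have "(L ^^ j) (p x) = (L ^^ j) x" using eq(3)[of x] pLm[of j x] by (simp add: p_def)
    then show ?thesis using funpow_add[of "m - j" j L] that by simp
  qed
  show thesis
  \<comment> \<open>\<open>Suc j\<close> instead of \<open>j\<close>, because S^m L^m = p fails to
    be available at m = 0.\<close>
  proof (rule that[of "Suc j"])
    fix m assume m: "m \<ge> Suc j"
    then obtain k where k: "m = Suc k" by (cases m) auto
    show "null_space L \<inter> range (L ^^ m) = {0}"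
    proof -
      have "x = 0" if "L x = 0" "x = (L ^^ m) z" for x z
        using pLm[of m z] Lp[of m z] m that by (simp add: p_def clinear_simps[OF lS])
      then show ?thesis
        using csubspace_0[OF csubspace_range_funpow[OF lL, of m]]
          csubspace_0[OF csubspace_null_space[OF lL]] by (fastforce simp: null_space_def)
    qed
    have "range (L ^^ m) = {z. (L ^^ m) ((S ^^ m) z) - z \<in> {0}}"
    proof -
      have "(L ^^ m) ((S ^^ m) ((L ^^ m) x)) = (L ^^ m) x" for x using SL[of k x] Lp[of m x] m k by simp
      then show ?thesis by (auto simp: image_iff) metis
    qed
    then show "closed (range (L ^^ m))"
      using closed_preimage[OF bounded_clinear_diff[OF bounded_clinear_compose[OF bounded_clinear_funpow[OF L]
            bounded_clinear_funpow[OF S]] bounded_clinear_ident], of "{0}" m m] by simp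
    \<comment> \<open>The projection onto \<open>range L + null_space (L ^^ m)\<close>. The part x -
      p x lies in the null space; L p S is idempotent because S L = p, takes values in the range of
      \<open>L\<close>, and vanishes on the kernel of \<open>p\<close> because S p = S.\<close>
    define q where "q x = L (p (S x)) + (x - p x)" for x
    have q: "bounded_clinear q"
      unfolding q_def by (intro bounded_clinear_add bounded_clinear_diff bounded_clinear_ident p
          bounded_clinear_compose[OF L] bounded_clinear_compose[OF p S])
    have qL: "q (L x) = L x" for x
      by (simp add: q_def p_def[symmetric] pp pL)
    have qn: "q x = x" if "x \<in> null_space (L ^^ m)" for x
    proof -
      have "p x = 0" using SL[of k x] that k clinear_simps(4)[OF clinear_funpow[OF lS], of m] by (simp add: null_space_def)
      moreover from this have "S x = 0" using Sp[of x] by (simp add: clinear_simps[OF lS])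
      ultimately show ?thesis by (simp add: q_def clinear_simps[OF lL] sp)
    qed
    have mem: "q x \<in> range L + null_space (L ^^ m)" for x
      unfolding q_def using Lp[of m x] m
      by (intro set_plus_intro) (auto simp: null_space_def clinear_simps[OF lLm])
    have fixq: "q y = y" if "y \<in> range L + null_space (L ^^ m)" for y
      using that qL qn by (auto simp: set_plus_def clinear_simps[OF bounded_clinearD[OF q]])
    have "range L + null_space (L ^^ m) = range q" using mem fixq by (auto simp: image_iff) metis
    moreover have "q (q x) = q x" for x by (rule fixq[OF mem])
    ultimately show "topologically_complemented (range L + null_space (L ^^ m))"
      using topologically_complemented_range[OF q] by simp
  qed
qed

text \<open>Mirror image of the left case: now p = L S is the idempotent commuting with
  \<open>L\<close>, and L^m S^m = p makes the range of L^m equal to the fixed space of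
  \<open>p\<close> for all m > j, hence constant.\<close>

lemma right_drazin_structure:
  fixes L :: "'a::complex_normed_vector \<Rightarrow> 'a"
  assumes L: "bounded_clinear L" and rd: "right_drazin_invertible L"
  obtains j where "\<And>m. m \<ge> j \<Longrightarrow> L ` range (L ^^ m) = range (L ^^ m)"
    "\<And>m. m \<ge> j \<Longrightarrow> closed (range (L ^^ m))"
    "\<And>m. m \<ge> j \<Longrightarrow> topologically_complemented (null_space L \<inter> range (L ^^ m))"
    "\<And>m. m \<ge> j \<Longrightarrow> range L + null_space (L ^^ m) = UNIV"
proof -
  obtain S j where S: "bounded_clinear S"
    and "L \<circ> S \<circ> L = L ^^ 2 \<circ> S" "L \<circ> S ^^ 2 = S" "L ^^ (j + 1) \<circ> S = L ^^ j"
    using rd by (auto simp: right_drazin_invertible_def)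
  then have eq: "L (S (L x)) = L (L (S x))" "L (S (S x)) = S x" "(L ^^ Suc j) (S x) = (L ^^ j) x" for x
    by (auto simp: fun_eq_iff numeral_2_eq_2)
  note lL = bounded_clinearD[OF L] and lS = bounded_clinearD[OF S]
  note lLm = clinear_funpow[OF lL]
  define p where "p x = L (S x)" for x
  have p: "bounded_clinear p" unfolding p_def by (rule bounded_clinear_compose[OF L S])
  note sp = clinear_simps[OF bounded_clinearD[OF p]]
  have pL: "p (L x) = L (p x)" for x by (simp add: p_def eq)
  have pS: "p (S x) = S x" for x by (simp add: p_def eq)
  have pp: "p (p x) = p x" for x
    using pL[of "S x"] pS[of x] by (simp add: p_def)
  have pLm: "p ((L ^^ m) x) = (L ^^ m) (p x)" for m x by (induction m) (simp_all add: pL)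
  have LS: "(L ^^ Suc m) ((S ^^ Suc m) x) = p x" for m x
  proof (induction m arbitrary: x)
    case (Suc m)
    have "(L ^^ Suc (Suc m)) ((S ^^ Suc (Suc m)) x) = (L ^^ Suc m) (p ((S ^^ Suc m) x))"
      by (simp add: funpow_swap1 p_def)
    also have "\<dots> = p ((L ^^ Suc m) ((S ^^ Suc m) x))" by (simp only: pLm)
    also have "\<dots> = p x" unfolding Suc.IH by (rule pp)
    finally show ?case .
  qed (simp add: p_def)
  have Lp: "(L ^^ m) (p x) = (L ^^ m) x" if "m \<ge> j" for m x
  proof -
    have "(L ^^ j) (p x) = (L ^^ j) x" using eq(3)[of x] by (simp add: p_def funpow_swap1)
    then show ?thesis using funpow_add[of "m - j" j L] that by simp
  qed
  have R: "range (L ^^ m) = {x. p x - x \<in> {0}}" if m: "m \<ge> Suc j" for m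
  proof -
    obtain k where k: "m = Suc k" using m by (cases m) auto
    have "p ((L ^^ m) x) = (L ^^ m) x" for x using pLm[of m x] Lp[of m x] m by simp
    moreover have "x \<in> range (L ^^ m)" if "p x = x" for x using LS[of k x] k that by (metis rangeI)
    ultimately show ?thesis by auto
  qed
  show thesis
  proof (rule that[of "Suc j"])
    fix m assume m: "m \<ge> Suc j"
    have "range (L ^^ Suc m) = range (L ^^ m)" by (simp only: R[OF m] R[OF le_SucI[OF m]])
    then show "L ` range (L ^^ m) = range (L ^^ m)" by (simp only: image_range_funpow)
    show "closed (range (L ^^ m))" unfolding R[OF m]
      by (intro closed_preimage bounded_clinear_diff p bounded_clinear_ident) auto
    have "x \<in> range L + null_space (L ^^ m)" for x
    proof -
      have "L (S x) + (x - p x) \<in> range L + null_space (L ^^ m)"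
        using Lp[of m x] m by (intro set_plus_intro) (auto simp: null_space_def clinear_simps[OF lLm])
      then show ?thesis by (simp add: p_def)
    qed
    then show "range L + null_space (L ^^ m) = UNIV" by blast
    \<comment> \<open>On the fixed space of \<open>p\<close> the operator \<open>S\<close> is a
      right inverse of \<open>L\<close>, so subtracting S L p projects that space onto its
      intersection with the kernel of \<open>L\<close>.\<close>
    define q where "q x = p x - S (L (p x))" for x
    have q: "bounded_clinear q" unfolding q_def
      by (intro bounded_clinear_diff p bounded_clinear_compose[OF S] bounded_clinear_compose[OF L p])
    have "p (q x) = q x" for x by (simp add: q_def sp pp pS)
    moreover have "L (q x) = 0" for x
    proof -
      have "L (q x) = L (p x) - p (L (p x))" by (simp add: q_def clinear_simps[OF lL] p_def)
      then show ?thesis by (simp add: pL pp)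
    qed
    ultimately have mem: "q x \<in> null_space L \<inter> range (L ^^ m)" for x unfolding R[OF m] by (auto simp: null_space_def)
    have fixq: "q x = x" if "x \<in> null_space L \<inter> range (L ^^ m)" for x
      using that unfolding R[OF m] by (auto simp: null_space_def q_def clinear_simps[OF lS])
    have "null_space L \<inter> range (L ^^ m) = range q" using mem fixq by (auto simp: image_iff) metis
    moreover have "q (q x) = q x" for x by (rule fixq[OF mem])
    ultimately show "topologically_complemented (null_space L \<inter> range (L ^^ m))"
      using topologically_complemented_range[OF q] by simp
  qed
qed

lemma index_nonpos_iff:
  assumes "cdimension (null_space A \<inter> M) < \<infinity>"
  shows "fredholm_index_on M A \<le> 0 \<longleftrightarrow> cdimension (null_space A \<inter> M) \<le> quotient_dimension M (A ` M)"
  using assms unfolding fredholm_index_on_def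
  by (cases "cdimension (null_space A \<inter> M)"; cases "quotient_dimension M (A ` M)") auto

lemma index_nonneg_iff:
  assumes "quotient_dimension M (A ` M) < \<infinity>"
  shows "fredholm_index_on M A \<ge> 0 \<longleftrightarrow> quotient_dimension M (A ` M) \<le> cdimension (null_space A \<inter> M)"
  using assms unfolding fredholm_index_on_def
  by (cases "cdimension (null_space A \<inter> M)"; cases "quotient_dimension M (A ` M)") auto

section \<open>From a Drazin invertible perturbation to the B-Fredholm property\<close>

text \<open>Everything is obtained for all large exponents at once, since \<open>dis A\<close> is
  not related to the exponent at which \<open>L\<close> becomes regular. Complements pass from
  \<open>L\<close> to \<open>A\<close> by commensurability.\<close>

lemma left_drazin_equiv_semi_fredholm:
  fixes A :: "'a::complex_banach \<Rightarrow> 'a"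
  assumes AL: "finite_rank_equiv A L" and ld: "left_drazin_invertible L"
  obtains j where
    "\<And>m. m \<ge> j \<Longrightarrow> closed (range (A ^^ m))"
    "\<And>m. m \<ge> j \<Longrightarrow> upper_semi_fredholm_on (range (A ^^ m)) A"
    "\<And>m. m \<ge> j \<Longrightarrow> fredholm_index_on (range (A ^^ m)) A \<le> 0"
    "\<And>m. m \<ge> j \<Longrightarrow> topologically_complemented (range A + null_space (A ^^ m))"
proof -
  have A: "bounded_clinear A" and L: "bounded_clinear L" using AL by (auto simp: finite_rank_equiv_def)
  note lA = bounded_clinearD[OF A] and lL = bounded_clinearD[OF L]
  obtain j where j: "\<And>m. m \<ge> j \<Longrightarrow> null_space L \<inter> range (L ^^ m) = {0}"
    "\<And>m. m \<ge> j \<Longrightarrow> closed (range (L ^^ m))"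
    "\<And>m. m \<ge> j \<Longrightarrow> topologically_complemented (range L + null_space (L ^^ m))"
    using left_drazin_structure[OF L ld] by blast
  have cl: "closed (range (A ^^ m))" if "m \<ge> j" for m
    by (rule finite_rank_equiv_closed_range[OF finite_rank_equiv_funpow[OF AL] j(2)[OF that]])
  show thesis
  proof (rule that[of j])
    fix m assume m: "m \<ge> j"
    show "closed (range (A ^^ m))" by (rule cl[OF m])
    have clA: "closed (A ` range (A ^^ m))" unfolding image_range_funpow by (rule cl) (use m in simp)
    have "null_space A \<inter> range (A ^^ m) \<preceq> {0}"
      using finite_rank_equiv_kernels(1)[OF AL, of m] j(1)[OF m] by simp
    then have fin: "cdimension (null_space A \<inter> range (A ^^ m)) < \<infinity>"
      using almost_subset_zero_iff[OF csubspace_Int[OF csubspace_null_space[OF lA] csubspace_range_funpow[OF lA]]]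
      by blast
    moreover have "A ` range (A ^^ m) \<subseteq> range (A ^^ m)"
      unfolding image_range_funpow by (rule range_funpow_antimono) simp
    ultimately show "upper_semi_fredholm_on (range (A ^^ m)) A"
      unfolding upper_semi_fredholm_on_def using closed_subset clA by blast
    obtain U where U: "csubspace U" "U \<subseteq> range (L ^^ m)" "U \<subseteq> range (A ^^ m)" "range (L ^^ m) \<preceq> U"
      "range (A ^^ m) \<preceq> U" "\<And>x. x \<in> U \<Longrightarrow> A x = L x"
      using finite_rank_equiv_common_subspace[OF AL, of m] by blast
    have "L ` range (L ^^ m) \<subseteq> range (L ^^ m)"
      unfolding image_range_funpow by (rule range_funpow_antimono) simp
    then have "cdimension (null_space A \<inter> range (A ^^ m)) \<le> quotient_dimension (range (A ^^ m)) (A ` range (A ^^ m))"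
      using null_le_defect_of_injective[OF lA csubspace_range_funpow[OF lA] \<open>A ` _ \<subseteq> _\<close> lL
          csubspace_range_funpow[OF lL] _ U j(1)[OF m]] by blast
    then show "fredholm_index_on (range (A ^^ m)) A \<le> 0" using index_nonpos_iff[OF fin] by blast
    show "topologically_complemented (range A + null_space (A ^^ m))"
    proof (rule topologically_complemented_commensurable[OF j(3)[OF m]])
      show "csubspace (range A + null_space (A ^^ m))" by (rule csubspace_range_plus_null_space[OF lA])
      show "closed (range A + null_space (A ^^ m))"
        by (rule closed_range_plus_null_space[OF A cl]) (use m in simp)
    qed (rule finite_rank_equiv_kernels(2)[OF AL], rule finite_rank_equiv_kernels(2)[OF finite_rank_equiv_sym[OF AL]])
  qed
qed

text \<open>The defect is finite because the ranges of L^m and L^(m+1) coincide for large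
  \<open>m\<close> and each is commensurable with the corresponding range of
  \<open>A\<close>.\<close>

lemma right_drazin_equiv_semi_fredholm:
  fixes A :: "'a::complex_banach \<Rightarrow> 'a"
  assumes AL: "finite_rank_equiv A L" and rd: "right_drazin_invertible L"
  obtains j where
    "\<And>m. m \<ge> j \<Longrightarrow> closed (range (A ^^ m))"
    "\<And>m. m \<ge> j \<Longrightarrow> lower_semi_fredholm_on (range (A ^^ m)) A"
    "\<And>m. m \<ge> j \<Longrightarrow> fredholm_index_on (range (A ^^ m)) A \<ge> 0"
    "\<And>m. m \<ge> j \<Longrightarrow> topologically_complemented (null_space A \<inter> range (A ^^ m))"
    "\<And>m. m \<ge> j \<Longrightarrow> quotient_dimension UNIV (range A + null_space (A ^^ m)) < \<infinity>"
proof -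
  have A: "bounded_clinear A" and L: "bounded_clinear L" using AL by (auto simp: finite_rank_equiv_def)
  note lA = bounded_clinearD[OF A] and lL = bounded_clinearD[OF L]
  obtain j where j: "\<And>m. m \<ge> j \<Longrightarrow> L ` range (L ^^ m) = range (L ^^ m)"
    "\<And>m. m \<ge> j \<Longrightarrow> closed (range (L ^^ m))"
    "\<And>m. m \<ge> j \<Longrightarrow> topologically_complemented (null_space L \<inter> range (L ^^ m))"
    "\<And>m. m \<ge> j \<Longrightarrow> range L + null_space (L ^^ m) = UNIV"
    using right_drazin_structure[OF L rd] by blast
  have cl: "closed (range (A ^^ m))" if "m \<ge> j" for m
    by (rule finite_rank_equiv_closed_range[OF finite_rank_equiv_funpow[OF AL] j(2)[OF that]])
  show thesis
  proof (rule that[of j])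
    fix m assume m: "m \<ge> j"
    show "closed (range (A ^^ m))" by (rule cl[OF m])
    have sub: "A ` range (A ^^ m) \<subseteq> range (A ^^ m)"
      unfolding image_range_funpow by (rule range_funpow_antimono) simp
    have "range (A ^^ m) \<preceq> range (L ^^ m)"
      by (rule finite_rank_equiv_range[OF finite_rank_equiv_funpow[OF AL]])
    also have "range (L ^^ m) = range (L ^^ Suc m)" using j(1)[OF m] unfolding image_range_funpow by simp
    also have "\<dots> \<preceq> range (A ^^ Suc m)"
      by (rule finite_rank_equiv_range[OF finite_rank_equiv_funpow[OF finite_rank_equiv_sym[OF AL]]])
    finally have "range (A ^^ m) \<preceq> A ` range (A ^^ m)" unfolding image_range_funpow .
    then have fin: "quotient_dimension (range (A ^^ m)) (A ` range (A ^^ m)) < \<infinity>"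
      using almost_subset_iff_quotient[OF csubspace_range_funpow[OF lA] csubspace_image[OF lA csubspace_range_funpow[OF lA]] sub]
      by blast
    then show "lower_semi_fredholm_on (range (A ^^ m)) A" by (simp add: lower_semi_fredholm_on_def)
    obtain U where U: "csubspace U" "U \<subseteq> range (L ^^ m)" "U \<subseteq> range (A ^^ m)" "range (L ^^ m) \<preceq> U"
      "range (A ^^ m) \<preceq> U" "\<And>x. x \<in> U \<Longrightarrow> A x = L x"
      using finite_rank_equiv_common_subspace[OF AL, of m] by blast
    have "quotient_dimension (range (A ^^ m)) (A ` range (A ^^ m)) \<le> cdimension (null_space A \<inter> range (A ^^ m))"
      using defect_le_null_of_surjective[OF lA csubspace_range_funpow[OF lA] sub lL
          csubspace_range_funpow[OF lL] j(1)[OF m] U] by blast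
    then show "fredholm_index_on (range (A ^^ m)) A \<ge> 0" using index_nonneg_iff[OF fin] by blast
    show "topologically_complemented (null_space A \<inter> range (A ^^ m))"
    proof (rule topologically_complemented_commensurable[OF j(3)[OF m]])
      show "csubspace (null_space A \<inter> range (A ^^ m))"
        by (intro csubspace_Int csubspace_null_space csubspace_range_funpow lA)
      show "closed (null_space A \<inter> range (A ^^ m))"
        by (intro closed_Int closed_null_space A cl m)
    qed (rule finite_rank_equiv_kernels(1)[OF AL], rule finite_rank_equiv_kernels(1)[OF finite_rank_equiv_sym[OF AL]])
    have "UNIV \<preceq> range A + null_space (A ^^ m)"
      using finite_rank_equiv_kernels(2)[OF finite_rank_equiv_sym[OF AL], of m] j(4)[OF m] by simp
    then show "quotient_dimension UNIV (range A + null_space (A ^^ m)) < \<infinity>"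
      using almost_subset_iff_quotient[OF csubspace_UNIV csubspace_range_plus_null_space[OF lA]] by simp
  qed
qed

lemma range_plus_null_space_dis:
  assumes "clinear A" "dis A = enat d" "d \<le> m"
  shows "range A + null_space (A ^^ m) = range A + null_space (A ^^ d)"
  using range_plus_null_space_stable[OF assms(1) dis_eq_enatD[OF assms(2)] assms(3), of 1] by simp

text \<open>The definition speaks about \<open>d = dis A\<close>, the known facts about exponents
  from \<open>j\<close> on. At \<open>max d j\<close> both apply, and the two spaces involved are
  the same there as at \<open>d\<close>.\<close>

lemma left_b_fredholm_of_left_drazin_equiv:
  fixes A :: "'a::complex_banach \<Rightarrow> 'a"
  assumes AL: "finite_rank_equiv A L" and ld: "left_drazin_invertible L"
  shows "left_b_fredholm A \<and> b_fredholm_index A \<le> 0"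
proof -
  have lA: "clinear A" using AL by (auto simp: finite_rank_equiv_def bounded_clinearD)
  obtain j where j: "\<And>m. m \<ge> j \<Longrightarrow> closed (range (A ^^ m))"
    "\<And>m. m \<ge> j \<Longrightarrow> upper_semi_fredholm_on (range (A ^^ m)) A"
    "\<And>m. m \<ge> j \<Longrightarrow> fredholm_index_on (range (A ^^ m)) A \<le> 0"
    "\<And>m. m \<ge> j \<Longrightarrow> topologically_complemented (range A + null_space (A ^^ m))"
    using left_drazin_equiv_semi_fredholm[OF AL ld] by blast
  have fin: "cdimension (null_space A \<inter> range (A ^^ m)) < \<infinity>" if "m \<ge> j" for m
    using j(2)[OF that] by (simp add: upper_semi_fredholm_on_def)
  have "semi_fredholm_at A j" using fin[of j] by (simp add: semi_fredholm_at_def)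
  then obtain d where d: "dis A = enat d" using dis_finite[OF lA] by blast
  have "cdimension (null_space A \<inter> range (A ^^ d)) < \<infinity>"
    using dis_eq_enatD[OF d max.cobounded1, of j] fin[OF max.cobounded2, of d] by simp
  moreover have "topologically_complemented (range A + null_space (A ^^ d))"
    using range_plus_null_space_dis[OF lA d max.cobounded1, of j] j(4)[OF max.cobounded2, of d] by simp
  ultimately show ?thesis
    using d b_fredholm_index_eq[OF lA j(1)[OF order_refl]] j(2,3)[OF order_refl]
    by (auto simp: left_b_fredholm_def)
qed

lemma right_b_fredholm_of_right_drazin_equiv:
  fixes A :: "'a::complex_banach \<Rightarrow> 'a"
  assumes AL: "finite_rank_equiv A L" and rd: "right_drazin_invertible L"
  shows "right_b_fredholm A \<and> b_fredholm_index A \<ge> 0"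
proof -
  have A: "bounded_clinear A" using AL by (auto simp: finite_rank_equiv_def)
  note lA = bounded_clinearD[OF A]
  obtain j where j: "\<And>m. m \<ge> j \<Longrightarrow> closed (range (A ^^ m))"
    "\<And>m. m \<ge> j \<Longrightarrow> lower_semi_fredholm_on (range (A ^^ m)) A"
    "\<And>m. m \<ge> j \<Longrightarrow> fredholm_index_on (range (A ^^ m)) A \<ge> 0"
    "\<And>m. m \<ge> j \<Longrightarrow> topologically_complemented (null_space A \<inter> range (A ^^ m))"
    "\<And>m. m \<ge> j \<Longrightarrow> quotient_dimension UNIV (range A + null_space (A ^^ m)) < \<infinity>"
    using right_drazin_equiv_semi_fredholm[OF AL rd] by blast
  have "semi_fredholm_at A j"
    using j(2)[of j] by (simp add: semi_fredholm_at_def lower_semi_fredholm_on_def)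
  then obtain d where d: "dis A = enat d" using dis_finite[OF lA] by blast
  define m where "m = max d j"
  have m: "m \<ge> d" "m \<ge> j" by (simp_all add: m_def)
  have Y: "range A + null_space (A ^^ m) = range A + null_space (A ^^ d)"
    by (rule range_plus_null_space_dis[OF lA d m(1)])
  have "topologically_complemented (null_space A \<inter> range (A ^^ d))"
    using dis_eq_enatD[OF d m(1)] j(4)[OF m(2)] by simp
  \<comment> \<open>At exponent \<open>m\<close> the sum is the preimage of the range of A^(m+1),
    hence closed; by \<open>Y\<close> it is the sum for \<open>d\<close>.\<close>
  moreover have "closed (range A + null_space (A ^^ d))"
    using closed_range_plus_null_space[OF A j(1)[of "Suc m"]] m Y by simp
  moreover have "quotient_dimension UNIV (range A + null_space (A ^^ d)) < \<infinity>"
    using j(5)[OF m(2)] Y by simp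
  ultimately show ?thesis
    using d b_fredholm_index_eq[OF lA j(1)[OF order_refl]] j(2,3)[OF order_refl]
    by (auto simp: right_b_fredholm_def)
qed

lemma drazin_imp_left_right:
  assumes "drazin_invertible L"
  shows "left_drazin_invertible L" "right_drazin_invertible L"
proof -
  obtain S j where S: "bounded_clinear S" and eq: "L \<circ> S = S \<circ> L" "S ^^ 2 \<circ> L = S" "L ^^ (j + 1) \<circ> S = L ^^ j"
    using assms by (auto simp: drazin_invertible_def)
  have comm: "L (S x) = S (L x)" for x using fun_cong[OF eq(1)] by simp
  have pow: "(L ^^ n) (S x) = S ((L ^^ n) x)" for n x by (induction n) (simp_all add: comm)
  have 2: "S (S (L x)) = S x" for x using fun_cong[OF eq(2), of x] by (simp add: numeral_2_eq_2)
  have 3: "S (L ((L ^^ j) x)) = (L ^^ j) x" for x using fun_cong[OF eq(3), of x] by (simp add: pow comm)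
  show "left_drazin_invertible L" unfolding left_drazin_invertible_def
    using S by (intro exI[of _ S] exI[of _ j]) (simp add: fun_eq_iff comm 2 3 numeral_2_eq_2)
  show "right_drazin_invertible L" unfolding right_drazin_invertible_def
    using S by (intro exI[of _ S] exI[of _ j]) (simp add: fun_eq_iff comm pow 2 3 numeral_2_eq_2)
qed

text \<open>The same \<open>L\<close> serves both one-sided results, so the index has both signs;
  the maximum of the two thresholds is an exponent with a Fredholm restriction.\<close>

lemma b_weyl_of_drazin_equiv:
  fixes A :: "'a::complex_banach \<Rightarrow> 'a"
  assumes AL: "finite_rank_equiv A L" and dr: "drazin_invertible L"
  shows "b_fredholm A \<and> b_fredholm_index A = 0"
proof -
  obtain i where i: "\<And>m. m \<ge> i \<Longrightarrow> closed (range (A ^^ m))"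
    "\<And>m. m \<ge> i \<Longrightarrow> upper_semi_fredholm_on (range (A ^^ m)) A"
    "\<And>m. m \<ge> i \<Longrightarrow> fredholm_index_on (range (A ^^ m)) A \<le> 0"
    "\<And>m. m \<ge> i \<Longrightarrow> topologically_complemented (range A + null_space (A ^^ m))"
    using left_drazin_equiv_semi_fredholm[OF AL drazin_imp_left_right(1)[OF dr]] by blast
  obtain j where j: "\<And>m. m \<ge> j \<Longrightarrow> closed (range (A ^^ m))"
    "\<And>m. m \<ge> j \<Longrightarrow> lower_semi_fredholm_on (range (A ^^ m)) A"
    "\<And>m. m \<ge> j \<Longrightarrow> fredholm_index_on (range (A ^^ m)) A \<ge> 0"
    "\<And>m. m \<ge> j \<Longrightarrow> topologically_complemented (null_space A \<inter> range (A ^^ m))"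
    "\<And>m. m \<ge> j \<Longrightarrow> quotient_dimension UNIV (range A + null_space (A ^^ m)) < \<infinity>"
    using right_drazin_equiv_semi_fredholm[OF AL drazin_imp_left_right(2)[OF dr]] by blast
  have "b_fredholm A" unfolding b_fredholm_def fredholm_on_def
    using i(1,2)[OF max.cobounded1, of j] j(2)[OF max.cobounded2, of i] by blast
  then show ?thesis
    using left_b_fredholm_of_left_drazin_equiv[OF AL drazin_imp_left_right(1)[OF dr]]
      right_b_fredholm_of_right_drazin_equiv[OF AL drazin_imp_left_right(2)[OF dr]] by auto
qed

section \<open>Construction of the perturbation\<close>

text \<open>First \<open>range (A ^^ n) + null_space (A ^^ d)\<close> is closed by induction on \<open>n\<close>, because it is determined
  by its preimage under \<open>A\<close>; then \<open>range (A ^^ n) + null_space (A ^^ i)\<close> is closed by descending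
  induction from \<open>i = d\<close> to \<open>i = 0\<close>, using Neubauer's lemma.\<close>

lemma closed_range_funpow_of_dis:
  fixes A :: "'a::complex_banach \<Rightarrow> 'a"
  assumes A: "bounded_clinear A"
    and K: "\<And>m. d \<le> m \<Longrightarrow> null_space A \<inter> range (A ^^ d) = null_space A \<inter> range (A ^^ m)"
    and clK: "closed (null_space A \<inter> range (A ^^ d))"
    and clY: "closed (range A + null_space (A ^^ d))" and n: "n \<ge> d"
  shows "closed (range (A ^^ n))"
proof -
  note lA = bounded_clinearD[OF A]
  note bAn = bounded_clinear_imp_bounded_linear[OF bounded_clinear_funpow[OF A]]
  let ?N = "\<lambda>i. null_space (A ^^ i)"
  have N: "csubspace (?N i)" "subspace (?N i)" "closed (?N i)" for i
    by (auto intro: csubspace_null_space clinear_funpow lA closed_null_space bounded_clinear_funpow A csubspace_imp_subspace)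
  have R: "csubspace (range (A ^^ i))" for i by (rule csubspace_range_funpow[OF lA])
  have sum_image: "(\<lambda>z. (A ^^ m) (fst z) + snd z) ` (UNIV \<times> ?N i) = range (A ^^ m) + ?N i" for m i
    by (force simp: set_plus_def)
  have sum_lin: "bounded_linear (\<lambda>z. (A ^^ m) (fst z) + snd z)" for m
    by (intro bounded_linear_add bounded_linear_compose[OF bAn] bounded_linear_fst bounded_linear_snd)
  have EN: "subspace (UNIV \<times> ?N i)" "closed (UNIV \<times> ?N i)" for i
    using N by (auto intro: subspace_Times closed_Times)
  define Y where "Y n = range (A ^^ n) + ?N d" for n
  have Y1: "Y 1 = range A + ?N d" by (simp add: Y_def)
  have clYn: "closed (Y n)" for n
  proof (induction n)
    case 0
    have "Y 0 = UNIV" using subset_plus_left[OF N(1), of UNIV d] by (auto simp: Y_def)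
    then show ?case by simp
  next
    case (Suc n)
    let ?h = "\<lambda>z. (A ^^ 1) (fst z) + snd z"
    have sub: "Y (Suc n) \<subseteq> Y 1"
      unfolding Y_def by (intro set_plus_mono2 range_funpow_antimono order_refl) simp
    have YS: "csubspace (Y (Suc n))" unfolding Y_def by (intro csubspace_plus R N)
    \<comment> \<open>A summand from \<open>?N d\<close> does not affect membership in
      \<open>Y (Suc n)\<close>. A x lies there iff \<open>x\<close> lies in the range of A^n plus
      the null space of A^(d+1), and stability of these sums identifies that with
      \<open>Y n\<close>.\<close>
    have "{z \<in> UNIV \<times> ?N d. ?h z \<in> Y (Suc n)} = Y n \<times> ?N d"
    proof -
      have "A x + v \<in> Y (Suc n) \<longleftrightarrow> x \<in> Y n" if "v \<in> ?N d" for x v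
      proof -
        have "v \<in> Y (Suc n)" unfolding Y_def using subset_plus_right[OF R] that by blast
        then have "A x + v \<in> Y (Suc n) \<longleftrightarrow> A x \<in> Y (Suc n)"
          using csubspace_add[OF YS, of "A x" v] csubspace_diff[OF YS, of "A x + v" v] by auto
        also have "\<dots> \<longleftrightarrow> (A ^^ Suc d) x \<in> range (A ^^ (Suc d + n))"
          unfolding Y_def range_plus_null_space_funpow[OF lA] by (simp add: funpow_swap1)
        also have "\<dots> \<longleftrightarrow> x \<in> range (A ^^ n) + ?N (Suc d)"
          unfolding range_plus_null_space_funpow[OF lA] by blast
        also have "range (A ^^ n) + ?N (Suc d) = Y n"
          unfolding Y_def by (rule range_plus_null_space_stable[OF lA K]) simp_all
        finally show ?thesis .
      qed
      then show ?thesis by auto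
    qed
    then show ?case
      using closed_of_closed_preimage[OF sum_lin[of 1] EN[of d], of "Y (Suc n)"] sub clY Suc closed_Times[OF Suc N(3)[of d]]
      unfolding sum_image Y_def[symmetric] Y1[symmetric] by simp
  qed
  \<comment> \<open>Descending induction: \<open>i\<close> counts how far the exponent of the null
    space has been lowered from \<open>d\<close>.\<close>
  have Z: "closed (range (A ^^ n) + ?N (d - i))" for i
  proof (induction i)
    case 0
    then show ?case using clYn by (simp add: Y_def)
  next
    case (Suc i)
    show ?case
    proof (cases "i < d")
      case False
      then show ?thesis using Suc by simp
    next
      case True
      define k where "k = d - Suc i"
      have k: "d - i = Suc k" using True by (simp add: k_def)
      \<comment> \<open>Neubauer's lemma with \<open>?N (Suc k)\<close> as second summand. The sum
        is closed by induction. The intersection is the preimage under A^k of the kernel of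
        \<open>A\<close> in the range of A^(k+n), which is the closed stable kernel because k + n
        \<ge> d.\<close>
      have "closed ((\<lambda>z. (A ^^ n) (fst z) + snd z) ` (UNIV \<times> ?N k))"
      proof (rule closed_summand[OF sum_lin EN bounded_linear_ident N(2,3)])
        have "range (A ^^ n) + ?N k + ?N (Suc k) = range (A ^^ n) + ?N (Suc k)"
        proof -
          have "?N k + ?N (Suc k) = ?N (Suc k)"
            using null_space_funpow_mono[OF lA, of k "Suc k"]
            by (intro subset_antisym plus_subset subset_plus_right N) auto
          then show ?thesis by (simp add: add.assoc)
        qed
        then show "closed ((\<lambda>z. (A ^^ n) (fst z) + snd z) ` (UNIV \<times> ?N k) + (\<lambda>x. x) ` ?N (Suc k))"
          unfolding sum_image image_ident by (simp only: Suc[unfolded k])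
        have "(range (A ^^ n) + ?N k) \<inter> ?N (Suc k) = {x. (A ^^ k) x \<in> null_space A \<inter> range (A ^^ (k + n))}"
          unfolding range_plus_null_space_funpow[OF lA] by (auto simp: null_space_def)
        also have "null_space A \<inter> range (A ^^ (k + n)) = null_space A \<inter> range (A ^^ d)"
          using K[of "k + n"] n by simp
        finally show "closed ((\<lambda>z. (A ^^ n) (fst z) + snd z) ` (UNIV \<times> ?N k) \<inter> (\<lambda>x. x) ` ?N (Suc k))"
          unfolding sum_image image_ident
          by (simp only: closed_preimage[OF bounded_clinear_funpow[OF A] clK])
      qed
      then show ?thesis unfolding sum_image k_def .
    qed
  qed
  have "?N 0 = {0}" by (simp add: null_space_def)
  then have "range (A ^^ n) + ?N (d - d) = range (A ^^ n)" by (simp add: set_plus_def)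
  then show ?thesis using Z[of d] by simp
qed

section \<open>The finite rank operator exchanging kernel and cokernel\<close>

text \<open>Lifts \<open>k\<close> members of a basis of a copy of W/N. The codimension may be
  infinite: this selects part of a cokernel in the left case and, with N = 0, part of a kernel in
  the right case.\<close>

lemma independent_mod_exists:
  assumes W: "csubspace W" and N: "csubspace N" and sub: "N \<subseteq> W" and k: "enat k \<le> quotient_dimension W N"
  obtains B where "finite B" "card B = k" "B \<subseteq> W" "cindependent B" "cspan B \<inter> N = {0}"
proof -
  obtain f :: "'a \<Rightarrow> 'a" where f: "clinear f" "null_space f = N"
    using exists_linear_with_kernel[OF N] by blast
  obtain C where C: "C \<subseteq> f ` W" "cindependent C" "cspan C = f ` W"
    using csubspace_basis[OF csubspace_image[OF f(1) W]] by blast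
  have "W \<inter> null_space f = N" using f(2) sub by blast
  then have "quotient_dimension W N = (if finite C then enat (card C) else \<infinity>)"
    using quotient_dimension_eq[OF f(1) W] cdimension_cspan[OF C(2)] C(3) by simp
  then have le: "k \<le> card C" if "finite C" using k that by simp
  have "\<exists>C'\<subseteq>C. finite C' \<and> card C' = k"
  proof (cases "finite C")
    case True
    then show ?thesis using obtain_subset_with_card_n[OF le[OF True]] by blast
  next
    case False
    then show ?thesis using infinite_arbitrarily_large[OF False, of k] by blast
  qed
  then obtain C' where C': "C' \<subseteq> C" "finite C'" "card C' = k" by blast
  have indC': "cindependent C'" using C' C complex_vector.independent_mono by blast
  have C'W: "C' \<subseteq> f ` W" using C' C by blast
  define B where "B = inv_into W f ` C'"
  have fB: "f ` B = C'" unfolding B_def image_image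
    using C'W by (auto simp: f_inv_into_f subset_iff image_iff intro!: bexI)
  have cB: "card B = k" unfolding B_def using card_image[OF inj_on_inv_into[OF C'W]] C' by simp
  have finB: "finite B" using C' by (simp add: B_def)
  have inj: "inj_on f B" by (rule eq_card_imp_inj_on[OF finB]) (simp add: fB cB C')
  have BW: "B \<subseteq> W" unfolding B_def using C'W by (auto intro: inv_into_into)
  have "\<forall>b\<in>B. b \<notin> cspan (B - {b}) + (W \<inter> null_space f)"
    using independent_mod_iff[OF f(1) W BW] inj indC' fB by simp
  then have "\<forall>b\<in>B. b \<notin> cspan (B - {b})"
    using subset_plus_left[OF csubspace_Int[OF W csubspace_null_space[OF f(1)]]] by blast
  then have "cindependent B" by (auto simp: complex_vector.dependent_def)
  moreover have "inj_on f (cspan B)"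
    using complex_vector_pair.linear_inj_on_span_iff_independent_image[OF f(1), of B] indC' fB inj by simp
  then have "x = 0" if "x \<in> cspan B" "f x = 0" for x
    using inj_onD[of f "cspan B" x 0] that by (simp add: clinear_simps[OF f(1)] complex_vector.span_zero)
  then have "cspan B \<inter> N = {0}"
    using f(2) csubspace_0[OF N] complex_vector.span_zero[of B] by (auto simp: null_space_def)
  ultimately show thesis using that finB cB BW by blast
qed

text \<open>Each \<open>b\<close> is separated from the span of the others, which is closed as it is
  finite-dimensional.\<close>

lemma biorthogonal_functionals:
  fixes B :: "'a::complex_normed_vector set"
  assumes "finite B" "cindependent B"
  obtains \<phi> :: "'a \<Rightarrow> 'a \<Rightarrow> complex" where "\<And>b. b \<in> B \<Longrightarrow> bounded_clinear (\<phi> b)"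
    "\<And>b c. b \<in> B \<Longrightarrow> c \<in> B \<Longrightarrow> \<phi> b c = (if c = b then 1 else 0)"
proof -
  have "\<exists>\<psi> :: 'a \<Rightarrow> complex. bounded_clinear \<psi> \<and> (\<forall>x\<in>cspan (B - {b}). \<psi> x = 0) \<and> \<psi> b = 1"
    if "b \<in> B" for b
    using that assms
    by (intro separating_functional csubspace_cspan closed_cspan) (auto simp: complex_vector.dependent_def)
  then obtain \<phi> :: "'a \<Rightarrow> 'a \<Rightarrow> complex" where \<phi>: "\<And>b. b \<in> B \<Longrightarrow> bounded_clinear (\<phi> b)"
    "\<And>b x. b \<in> B \<Longrightarrow> x \<in> cspan (B - {b}) \<Longrightarrow> \<phi> b x = 0" "\<And>b. b \<in> B \<Longrightarrow> \<phi> b b = 1"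
    by metis
  show thesis
  proof (rule that[of \<phi>])
    fix b c assume "b \<in> B" "c \<in> B"
    then show "\<phi> b c = (if c = b then 1 else 0)"
      using \<phi>(2)[of b c] \<phi>(3)[of b] complex_vector.span_base[of c "B - {b}"] by auto
  qed (use \<phi>(1) in blast)
qed

text \<open>\<open>F\<close> carries the independent set \<open>B\<close> in the kernel onto the set
  \<open>C\<close> transversal to A(W). The two conclusions are implications so that one
  construction serves all three cases: \<open>B\<close> spanning the kernel gives injectivity,
  \<open>C\<close> spanning a full complement gives surjectivity.\<close>

lemma finite_rank_perturbation:
  fixes A :: "'a::complex_normed_vector \<Rightarrow> 'a"
  assumes A: "clinear A" and W: "csubspace W"
    and B: "finite B" "cindependent B" "B \<subseteq> null_space A \<inter> W"
    and C: "finite C" "cindependent C" "C \<subseteq> W" "cspan C \<inter> A ` W = {0}"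
    and card: "card B = card C"
  obtains F where "F \<in> finite_rank_operators" "range F \<subseteq> W"
    "cspan B = null_space A \<inter> W \<longrightarrow> (\<forall>w\<in>W. A w + F w = 0 \<longrightarrow> w = 0)"
    "W = cspan C + A ` W \<longrightarrow> W \<subseteq> (\<lambda>x. A x + F x) ` W"
proof -
  note lA = clinear_simps[OF A]
  obtain \<phi> :: "'a \<Rightarrow> 'a \<Rightarrow> complex" where \<phi>: "\<And>b. b \<in> B \<Longrightarrow> bounded_clinear (\<phi> b)"
    "\<And>b c. b \<in> B \<Longrightarrow> c \<in> B \<Longrightarrow> \<phi> b c = (if c = b then 1 else 0)"
    using biorthogonal_functionals[OF B(1,2)] by blast
  obtain g where g: "bij_betw g C B"
    using finite_same_card_bij[OF C(1) B(1)] card by auto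
  have gB: "g v \<in> B" if "v \<in> C" for v using g that by (auto simp: bij_betw_def)
  have lin: "clinear (\<phi> b)" if "b \<in> B" for b by (rule bounded_clinearD[OF \<phi>(1)[OF that]])
  \<comment> \<open>The functional dual to \<open>g v\<close> supplies the coefficient of
    \<open>v\<close>, so that F (g v) = v.\<close>
  define F where "F x = (\<Sum>v\<in>C. \<phi> (g v) x *\<^sub>C v)" for x
  have bF: "bounded_clinear F" unfolding F_def
    by (intro bounded_clinear_sum bounded_clinear_scaleC_left \<phi>(1) gB)
  have FC: "F x \<in> cspan C" for x unfolding F_def
    by (intro complex_vector.span_sum complex_vector.span_scale complex_vector.span_base)
  have CW: "cspan C \<subseteq> W" by (rule complex_vector.span_minimal[OF C(3) W])
  have sumB: "\<phi> b (\<Sum>v\<in>C. a v *\<^sub>C g v) = a u" if "u \<in> C" "b = g u" for a b u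
  proof -
    have b: "b \<in> B" using that gB by simp
    have "\<phi> b (\<Sum>v\<in>C. a v *\<^sub>C g v) = (\<Sum>v\<in>C. a v * (if v = u then 1 else 0))"
      unfolding clinear_simps[OF lin[OF b]] scaleC_complex_def
    proof (rule sum.cong)
      fix v assume "v \<in> C"
      then have "g v = b \<longleftrightarrow> v = u" using g that by (auto simp: bij_betw_def inj_on_def)
      then show "a v * \<phi> b (g v) = a v * (if v = u then 1 else 0)" using \<phi>(2)[OF b gB[OF \<open>v \<in> C\<close>]] by simp
    qed simp
    also have "\<dots> = a u" using that C(1) by (simp add: sum.delta if_distrib[of "(*) _"] cong: if_cong)
    finally show ?thesis .
  qed
  have spanB: "\<exists>a. x = (\<Sum>v\<in>C. a v *\<^sub>C g v)" if xB: "x \<in> cspan B" for x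
  proof -
    obtain a where "x = (\<Sum>b\<in>B. a b *\<^sub>C b)"
      using xB unfolding complex_vector.span_finite[OF B(1)] by blast
    also have "\<dots> = (\<Sum>v\<in>C. a (g v) *\<^sub>C g v)" using g by (rule sum.reindex_bij_betw[symmetric])
    finally show ?thesis by (intro exI[of _ "\<lambda>v. a (g v)"])
  qed
  show thesis
  proof (rule that[of F])
    show "F \<in> finite_rank_operators"
    proof -
      have "csubspace (range F)"
        by (rule csubspace_image[OF bounded_clinearD[OF bF] csubspace_UNIV])
      then have "cdimension (range F) \<le> cdimension (cspan C)"
        using FC by (intro cdimension_mono csubspace_cspan) auto
      also have "\<dots> < \<infinity>" using C(1) finite_cdimension_iff by blast
      finally show ?thesis using bF by (simp add: finite_rank_operators_def)
    qed
    show "range F \<subseteq> W" using FC CW by blast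
    have "w = 0" if "cspan B = null_space A \<inter> W" "w \<in> W" "A w + F w = 0" for w
    proof -
      \<comment> \<open>F w then lies in \<open>cspan C\<close> and in A(W), so it is 0.
        Independence of \<open>C\<close> kills all coordinates of \<open>w\<close>, and
        \<open>w\<close>, being in the kernel, is determined by them.\<close>
      have "F w = A (- w)" using that(3) by (simp add: lA eq_neg_iff_add_eq_0 add.commute)
      moreover have "- w \<in> W" using that(2) W by (rule csubspace_neg[rotated])
      ultimately have F0: "F w = 0" using C(4) FC[of w] by auto
      then have "\<phi> (g v) w = 0" if "v \<in> C" for v
        using complex_vector.independentD[OF C(2,1) order_refl, of "\<lambda>v. \<phi> (g v) w" v] that by (simp add: F_def)
      moreover have "A w = 0" using F0 that(3) by simp
      then have "w \<in> cspan B" using that(1,2) by (simp add: null_space_def)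
      then obtain a where a: "w = (\<Sum>v\<in>C. a v *\<^sub>C g v)" using spanB by blast
      ultimately have "a v = 0" if "v \<in> C" for v using sumB[OF that refl, of a] that by simp
      then show "w = 0" using a by simp
    qed
    then show "cspan B = null_space A \<inter> W \<longrightarrow> (\<forall>w\<in>W. A w + F w = 0 \<longrightarrow> w = 0)" by blast
    show "W = cspan C + A ` W \<longrightarrow> W \<subseteq> (\<lambda>x. A x + F x) ` W"
    proof (intro impI subsetI)
      assume WC: "W = cspan C + A ` W"
      fix w assume "w \<in> W"
      then have "w \<in> cspan C + A ` W" using WC by simp
      then obtain s u where s: "s \<in> cspan C" and u: "u \<in> W" "w = s + A u" by (auto simp: set_plus_def)
      obtain \<beta> where \<beta>: "s = (\<Sum>v\<in>C. \<beta> v *\<^sub>C v)"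
        using s complex_vector.span_finite[OF C(1)] by auto
      \<comment> \<open>A kernel vector that leaves A u unchanged and corrects the coordinates of
        \<open>u\<close> so that F (u + t) is the prescribed component \<open>s\<close>.\<close>
      define t where "t = (\<Sum>v\<in>C. (\<beta> v - \<phi> (g v) u) *\<^sub>C g v)"
      have "t \<in> null_space A \<inter> W" unfolding t_def
        using gB B(3) csubspace_Int[OF csubspace_null_space[OF A] W]
        by (intro complex_vector.subspace_sum csubspace_scale) auto
      then have t: "A t = 0" "t \<in> W" by (auto simp: null_space_def)
      have "F (u + t) = (\<Sum>v\<in>C. \<beta> v *\<^sub>C v)" unfolding F_def
      proof (rule sum.cong)
        fix v assume v: "v \<in> C"
        show "\<phi> (g v) (u + t) *\<^sub>C v = \<beta> v *\<^sub>C v"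
          using sumB[OF v refl, of "\<lambda>v. \<beta> v - \<phi> (g v) u"]
          by (simp add: clinear_simps[OF lin[OF gB[OF v]]] t_def[symmetric])
      qed simp
      then have "w = A (u + t) + F (u + t)" using u \<beta> t by (simp add: lA add.commute)
      moreover have "u + t \<in> W" using u t W by (intro csubspace_add)
      ultimately show "w \<in> (\<lambda>x. A x + F x) ` W" by blast
    qed
  qed
qed

text \<open>Since \<open>W\<close> is invariant under \<open>A\<close> and contains the values of
  \<open>F\<close>, every power of A + F differs from that of \<open>A\<close> by a map into
  \<open>W\<close>; at exponent \<open>d\<close> the power of \<open>A\<close> itself has values in
  \<open>W\<close>.\<close>

lemma funpow_perturbation_range:
  fixes A :: "'a::complex_vector \<Rightarrow> 'a"
  assumes A: "clinear A" and F: "range F \<subseteq> range (A ^^ d)"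
  shows "range ((\<lambda>x. A x + F x) ^^ d) \<subseteq> range (A ^^ d)"
proof -
  let ?W = "range (A ^^ d)" and ?B = "\<lambda>x. A x + F x"
  have W: "csubspace ?W" by (rule csubspace_range_funpow[OF A])
  have AW: "A w \<in> ?W" if "w \<in> ?W" for w
    using that range_funpow_antimono[of d "Suc d" A] image_range_funpow[of A d] by auto
  have "(?B ^^ n) x - (A ^^ n) x \<in> ?W" for n and x :: 'a
  proof (induction n)
    case 0 then show ?case using csubspace_0[OF W] by simp
  next
    case (Suc n)
    have "A ((?B ^^ n) x - (A ^^ n) x) + F ((?B ^^ n) x) \<in> ?W"
      using AW[OF Suc] F by (intro csubspace_add[OF W]) auto
    then show ?case by (simp add: clinear_simps[OF A] algebra_simps)
  qed
  then have "((?B ^^ d) x - (A ^^ d) x) + (A ^^ d) x \<in> ?W" for x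
    by (intro csubspace_add[OF W]) auto
  then show ?thesis by auto
qed

section \<open>Criteria for Drazin invertibility\<close>

text \<open>The one-sided inverses are given by relations. Uniqueness turns the merely existential
  norm bound into a bound for the operator.\<close>

lemma bounded_clinear_of_graph:
  fixes G :: "'a::complex_normed_vector \<Rightarrow> 'b::complex_normed_vector \<Rightarrow> bool"
  assumes add: "\<And>x y x' y'. G x y \<Longrightarrow> G x' y' \<Longrightarrow> G (x + x') (y + y')"
    and scale: "\<And>c x y. G x y \<Longrightarrow> G (c *\<^sub>C x) (c *\<^sub>C y)"
    and uniq: "\<And>x y y'. G x y \<Longrightarrow> G x y' \<Longrightarrow> y = y'"
    and bound: "\<And>x. \<exists>y. G x y \<and> norm y \<le> c * norm x"
  obtains S where "bounded_clinear S" "\<And>x y. G x y \<longleftrightarrow> S x = y"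
proof -
  obtain S where S: "\<And>x. G x (S x)" "\<And>x. norm (S x) \<le> c * norm x" using bound by metis
  have eq: "G x y \<longleftrightarrow> S x = y" for x y using S(1) uniq by blast
  have 1: "S (x + y) = S x + S y" for x y using eq add S(1) by blast
  have 2: "S (a *\<^sub>C x) = a *\<^sub>C S x" for a x using eq scale S(1) by blast
  have "bounded_linear S"
    using 1 2 S(2) by (intro bounded_linear_intro[of S c]) (simp_all add: scaleR_scaleC mult.commute)
  then have "bounded_clinear S" using 2 by (simp add: bounded_clinear_def)
  then show thesis using that eq by blast
qed

text \<open>Iterating \<open>X = C + B X + N\<close>, where \<open>N = null_space (B ^^ d)\<close>, shows that
  \<open>C + B C + \<dots> + B ^^ (d - 1) C + range (B ^^ d)\<close> is an invariant complement of \<open>N\<close>.\<close>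

fun iterated_sum :: "'a::complex_vector set \<Rightarrow> ('a \<Rightarrow> 'a) \<Rightarrow> nat \<Rightarrow> 'a set" where
  "iterated_sum C B 0 = UNIV"
| "iterated_sum C B (Suc k) = C + B ` iterated_sum C B k"

text \<open>Let X_d be the iterated sum. The space splits as X_d + N, and \<open>B\<close> is
  injective on X_d. \<open>S\<close> inverts \<open>B\<close> from B(X_d) back to X_d and vanishes
  on C + N; the open mapping theorem bounds it.\<close>

lemma left_drazin_criterion:
  fixes B :: "'a::complex_banach \<Rightarrow> 'a"
  assumes B: "bounded_clinear B" and asc: "null_space (B ^^ Suc d) \<subseteq> null_space (B ^^ d)"
    and tc: "topologically_complemented (range B + null_space (B ^^ d))"
  shows "left_drazin_invertible B"
proof -
  note cB = bounded_clinearD[OF B]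
  note lB = clinear_simps[OF cB]
  let ?N = "null_space (B ^^ d)" and ?X = "iterated_sum"
  have N: "csubspace ?N" "closed ?N"
    by (auto intro: csubspace_null_space clinear_funpow cB closed_null_space bounded_clinear_funpow B)
  have BN: "B n \<in> ?N" if "n \<in> ?N" for n
    using that lB(4) by (simp add: null_space_def funpow_swap1[symmetric])
  have NB: "n \<in> ?N" if "B n \<in> ?N" for n
    using that asc by (auto simp: null_space_def funpow_swap1)
  obtain C where C: "csubspace C" "closed C" "(range B + ?N) \<inter> C = {0}" "(range B + ?N) + C = UNIV"
    using tc by (auto simp: topologically_complemented_def)
  \<comment> \<open>Such a \<open>c\<close> would lie in the space to which \<open>C\<close> is
    complementary.\<close>
  have C0: "c = 0" "B u \<in> ?N" if "c \<in> C" "c + B u \<in> ?N" for c u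
  proof -
    have "c = B (- u) + (c + B u)" by (simp add: lB)
    then have "c \<in> range B + ?N" using that(2) by (metis rangeI set_plus_intro)
    then show "c = 0" using C(3) that(1) by blast
    then show "B u \<in> ?N" using that(2) by simp
  qed
  define h where "h = (\<lambda>z :: ('a \<times> 'a) \<times> 'a. B (fst (fst z)) + snd (fst z) + snd z)"
  have h: "bounded_linear h" unfolding h_def
    by (intro bounded_linear_add bounded_linear_compose[OF bounded_clinear_imp_bounded_linear[OF B]]
        bounded_linear_compose[OF bounded_linear_fst] bounded_linear_compose[OF bounded_linear_snd]
        bounded_linear_fst bounded_linear_snd)
  let ?E = "(UNIV \<times> ?N) \<times> C"
  have E: "subspace ?E" "closed ?E" using N C by (auto intro!: subspace_Times closed_Times csubspace_imp_subspace)
  have hE: "h ` ?E = UNIV"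
  proof -
    have "x \<in> h ` ?E" for x
    proof -
      have "x \<in> (range B + ?N) + C" using C(4) by simp
      then obtain u n c where "n \<in> ?N" "c \<in> C" "x = B u + n + c" by (auto simp: set_plus_def)
      then show ?thesis by (intro image_eqI[of _ _ "((u,n),c)"]) (auto simp: h_def)
    qed
    then show ?thesis by blast
  qed
  have clE: "closed (h ` ?E)" by (simp only: hE closed_UNIV)
  obtain \<kappa> where \<kappa>: "\<kappa> > 0" "\<forall>y\<in>h ` ?E. \<exists>x\<in>?E. h x = y \<and> norm x \<le> \<kappa> * norm y"
    using open_mapping_bound[OF h E clE] by blast
  have bound: "\<exists>z\<in>?E. h z = y \<and> norm z \<le> \<kappa> * norm y" for y
    using bspec[OF \<kappa>(2), of y] by (simp only: hE UNIV_I)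
  have split: "\<exists>u n c. n \<in> ?N \<and> c \<in> C \<and> x = B u + n + c \<and> norm u \<le> \<kappa> * norm x \<and> norm c \<le> \<kappa> * norm x" for x
  proof -
    obtain z where z: "z \<in> ?E" "h z = x" "norm z \<le> \<kappa> * norm x" using bound[of x] by blast
    have "norm (fst (fst z)) \<le> \<kappa> * norm x" "norm (snd z) \<le> \<kappa> * norm x"
      using norm_fst_le[of "fst z" "snd z"] norm_fst_le[of "fst (fst z)" "snd (fst z)"]
        norm_snd_le[of "snd z" "fst z"] z(3) by simp_all
    then show ?thesis using z(1,2) unfolding h_def
      by (intro exI[of _ "fst (fst z)"] exI[of _ "snd (fst z)"] exI[of _ "snd z"]) auto
  qed
  have X: "csubspace (?X C B k)" for k
    by (induction k) (auto intro!: csubspace_plus csubspace_image cB C(1))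
  have Xdec: "?X C B (Suc k) \<subseteq> ?X C B k" for k
  proof (induction k)
    case (Suc k)
    then show ?case unfolding iterated_sum.simps(2)[of C B "Suc k"] iterated_sum.simps(2)[of C B k]
      by (intro set_plus_mono2 order_refl image_mono)
  qed simp
  have BX: "B x \<in> ?X C B d" if "x \<in> ?X C B d" for x
    using Xdec[of d] that subset_plus_right[OF C(1), of "B ` ?X C B d"] by auto
  obtain b where b: "b > 0" "\<And>x. norm (B x) \<le> norm x * b"
    using bounded_linear.pos_bounded[OF bounded_clinear_imp_bounded_linear[OF B]] by blast
  \<comment> \<open>Decompose x = B u + n + c, then replace \<open>u\<close> by its component
    \<open>p\<close> in the previous sum: the error B (u - p) + n stays in the null space. The
    constant adds the bound for \<open>c\<close> to those for \<open>u\<close>, \<open>p\<close> and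
    \<open>B\<close> multiplied.\<close>
  have decomp: "\<exists>M\<ge>0. \<forall>x. \<exists>p\<in>?X C B k. x - p \<in> ?N \<and> norm p \<le> M * norm x" for k
  proof (induction k)
    case 0
    have "\<exists>p\<in>?X C B 0. x - p \<in> ?N \<and> norm p \<le> 1 * norm x" for x
      using csubspace_0[OF N(1)] by (intro bexI[of _ x]) auto
    then show ?case using zero_le_one by blast
  next
    case (Suc k)
    then obtain M where M: "M \<ge> 0" "\<And>x. \<exists>p\<in>?X C B k. x - p \<in> ?N \<and> norm p \<le> M * norm x" by blast
    show ?case
    proof (intro exI[of _ "\<kappa> + M * \<kappa> * b"] conjI allI)
      show "0 \<le> \<kappa> + M * \<kappa> * b" using \<kappa>(1) M(1) b(1) by simp
      fix x
      obtain u n c where s: "n \<in> ?N" "c \<in> C" "x = B u + n + c" "norm u \<le> \<kappa> * norm x" "norm c \<le> \<kappa> * norm x"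
        using split by blast
      obtain p where p: "p \<in> ?X C B k" "u - p \<in> ?N" "norm p \<le> M * norm u" using M(2) by blast
      have "c + B p \<in> ?X C B (Suc k)" using s(2) p(1) by (auto intro: set_plus_intro)
      moreover have "x - (c + B p) = B (u - p) + n" using s(3) by (simp add: lB)
      then have "x - (c + B p) \<in> ?N" using BN[OF p(2)] s(1) csubspace_add[OF N(1)] by simp
      moreover have "norm (c + B p) \<le> (\<kappa> + M * \<kappa> * b) * norm x"
      proof -
        have "norm (c + B p) \<le> norm c + norm p * b" using norm_triangle_ineq[of c "B p"] b(2)[of p] by linarith
        also have "\<dots> \<le> \<kappa> * norm x + (M * norm u) * b" using s(5) p(3) b(1) by (intro add_mono mult_right_mono) auto
        also have "\<dots> \<le> \<kappa> * norm x + (M * (\<kappa> * norm x)) * b"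
          using s(4) M(1) b(1) by (intro add_left_mono mult_right_mono mult_left_mono) auto
        finally show ?thesis by (simp add: algebra_simps)
      qed
      ultimately show "\<exists>p\<in>?X C B (Suc k). x - p \<in> ?N \<and> norm p \<le> (\<kappa> + M * \<kappa> * b) * norm x" by blast
    qed
  qed
  \<comment> \<open>By \<open>C0\<close> the component in \<open>C\<close> vanishes at every stage,
    so \<open>x\<close> is B^k of a vector of the null space; at k = d this is 0, hence X_d meets
    the null space trivially.\<close>
  have "\<exists>v\<in>?N. x = (B ^^ k) v" if "x \<in> ?X C B k" "x \<in> ?N" for k x
    using that
  proof (induction k arbitrary: x)
    case (Suc k)
    then obtain c u where cu: "c \<in> C" "u \<in> ?X C B k" "x = c + B u" by (auto simp: set_plus_def)
    then have "c = 0" "B u \<in> ?N" using C0 Suc.prems(2) by auto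
    then show ?case using Suc.IH[OF cu(2) NB] cu(3) by auto
  qed auto
  then have XN: "x = 0" if "x \<in> ?X C B d" "x \<in> ?N" for x
    using that by (fastforce simp: null_space_def)
  \<comment> \<open>The graph of \<open>S\<close>: \<open>u\<close> is the point of X_d that
    \<open>B\<close> maps to \<open>x\<close> modulo C + N.\<close>
  define G where "G x u \<longleftrightarrow> u \<in> ?X C B d \<and> x - B u \<in> C + ?N" for x u
  have CN: "csubspace (C + ?N)" by (intro csubspace_plus C N)
  obtain M where M: "M \<ge> 0" "\<And>x. \<exists>p\<in>?X C B d. x - p \<in> ?N \<and> norm p \<le> M * norm x"
    using decomp[of d] by blast
  obtain S where S: "bounded_clinear S" "\<And>x y. G x y \<longleftrightarrow> S x = y"
  proof (rule bounded_clinear_of_graph[of G "M * \<kappa>"])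
    fix x y x' y' assume "G x y" "G x' y'"
    moreover have "(x + x') - B (y + y') = (x - B y) + (x' - B y')" by (simp add: lB)
    ultimately show "G (x + x') (y + y')" unfolding G_def
      using csubspace_add[OF CN] csubspace_add[OF X] by metis
  next
    fix c x y assume "G x y"
    moreover have "c *\<^sub>C x - B (c *\<^sub>C y) = c *\<^sub>C (x - B y)" by (simp add: lB complex_vector.scale_right_diff_distrib)
    ultimately show "G (c *\<^sub>C x) (c *\<^sub>C y)" unfolding G_def
      using csubspace_scale[OF CN] csubspace_scale[OF X] by simp
  next
    fix x y y' assume G: "G x y" "G x y'"
    have "B (y - y') = (x - B y') - (x - B y)" by (simp add: lB)
    then have "B (y - y') \<in> C + ?N" using G csubspace_diff[OF CN] unfolding G_def by metis
    then obtain c n where cn: "c \<in> C" "n \<in> ?N" "B (y - y') = c + n" by (auto simp: set_plus_def)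
    have "- c + B (y - y') \<in> ?N" using cn by simp
    then have "y - y' \<in> ?N" using C0(2)[of "- c"] csubspace_neg[OF C(1) cn(1)] NB by blast
    then show "y = y'" using XN[of "y - y'"] csubspace_diff[OF X] G by (simp add: G_def)
  next
    fix x
    obtain u n c where s: "n \<in> ?N" "c \<in> C" "x = B u + n + c" "norm u \<le> \<kappa> * norm x"
      using split by blast
    obtain p where p: "p \<in> ?X C B d" "u - p \<in> ?N" "norm p \<le> M * norm u" using M(2) by blast
    have "x - B p = c + (n + B (u - p))" using s(3) by (simp add: lB)
    moreover have "n + B (u - p) \<in> ?N" using s(1) BN[OF p(2)] csubspace_add[OF N(1)] by blast
    ultimately have "G x p" unfolding G_def using p(1) s(2) by (simp add: set_plus_intro)
    moreover have "norm p \<le> M * \<kappa> * norm x"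
      using order_trans[OF p(3) mult_left_mono[OF s(4) M(1)]] by (simp add: mult.assoc)
    ultimately show "\<exists>p. G x p \<and> norm p \<le> M * \<kappa> * norm x" by blast
  qed (rule that)
  have Nsub: "n \<in> C + ?N" if "n \<in> ?N" for n using subset_plus_right[OF C(1)] that by blast
  have SB: "S (B (p + n)) = p" if "p \<in> ?X C B d" "n \<in> ?N" for p n
    using S(2)[of "B (p + n)" p] Nsub[OF BN[OF that(2)]] that(1) by (simp add: G_def lB)
  have S0: "S n = 0" if "n \<in> ?N" for n
    using S(2)[of n 0] Nsub[OF that] csubspace_0[OF X] by (simp add: G_def lB)
  have dec: "\<exists>p n. p \<in> ?X C B d \<and> n \<in> ?N \<and> x = p + n" for x
  proof -
    obtain p where "p \<in> ?X C B d" "x - p \<in> ?N" using M(2) by blast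
    then show ?thesis by (intro exI[of _ p] exI[of _ "x - p"]) simp
  qed
  note lS = clinear_simps[OF bounded_clinearD[OF S(1)]]
  have Xpow: "(B ^^ k) p \<in> ?X C B d" if "p \<in> ?X C B d" for p k
    by (induction k) (use that BX in auto)
  have "B (S (B x)) = S (B (B x)) \<and> S (S (B x)) = S x \<and> S (B ((B ^^ d) x)) = (B ^^ d) x" for x
  proof -
    obtain p n where pn: "p \<in> ?X C B d" "n \<in> ?N" "x = p + n" using dec by blast
    have "S (B x) = p" using SB pn by simp
    moreover have "S (B (B p + B n)) = B p" by (rule SB[OF BX[OF pn(1)] BN[OF pn(2)]])
    then have "S (B (B x)) = B p" using pn(3) by (simp add: lB)
    moreover have "S x = S p" using pn(3) S0[OF pn(2)] by (simp add: lS)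
    moreover have "(B ^^ d) x = (B ^^ d) p"
      using pn(2,3) clinear_simps[OF clinear_funpow[OF cB]] by (simp add: null_space_def)
    moreover have "S (B ((B ^^ d) p)) = (B ^^ d) p"
      using SB[OF Xpow[OF pn(1)] csubspace_0[OF N(1)], of d] by simp
    ultimately show ?thesis by simp
  qed
  then show ?thesis unfolding left_drazin_invertible_def using S(1)
    by (intro exI[of _ S] conjI exI[of _ d]) (auto simp: fun_eq_iff numeral_2_eq_2)
qed

text \<open>The points whose first \<open>k\<close> iterates, starting with the point itself, lie in
  \<open>D\<close>, and which B^k sends to 0.\<close>

fun iterated_preimage :: "'a::complex_vector set \<Rightarrow> ('a \<Rightarrow> 'a) \<Rightarrow> nat \<Rightarrow> 'a set" where
  "iterated_preimage D B 0 = {0}"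
| "iterated_preimage D B (Suc k) = D \<inter> {x. B x \<in> iterated_preimage D B k}"

text \<open>The invariant complement of \<open>range (B ^^ d)\<close> on which \<open>B\<close> is nilpotent is obtained dually,
  from a complement \<open>D\<close> of the kernel of the restriction of \<open>B\<close>.\<close>

lemma right_drazin_inverse_exists:
  fixes B :: "'a::complex_banach \<Rightarrow> 'a"
  assumes B: "bounded_clinear B" and surj: "B ` range (B ^^ d) = range (B ^^ d)"
    and cl: "closed (range (B ^^ d))"
    and tc: "topologically_complemented (null_space B \<inter> range (B ^^ d))"
  obtains S where "bounded_clinear S" "range S \<subseteq> range (B ^^ d)"
    "\<And>x. B (S (B x)) = B (B (S x))" "\<And>x. B (S (S x)) = S x" "\<And>x. (B ^^ Suc d) (S x) = (B ^^ d) x"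
proof -
  note cB = bounded_clinearD[OF B]
  note lB = clinear_simps[OF cB]
  define W where "W = range (B ^^ d)"
  have W: "csubspace W" "closed W" unfolding W_def using csubspace_range_funpow[OF cB] cl by auto
  have BW: "B w \<in> W" if "w \<in> W" for w using surj that by (auto simp: W_def)
  obtain D where D: "csubspace D" "closed D" "(null_space B \<inter> W) \<inter> D = {0}" "(null_space B \<inter> W) + D = UNIV"
    using tc by (auto simp: topologically_complemented_def W_def)
  let ?X = "iterated_preimage D B"
  have X: "csubspace (?X k)" "closed (?X k)" for k
    by (induction k) (auto intro!: csubspace_Int closed_Int closed_preimage csubspace_preimage D B cB)
  have Xinc: "?X k \<subseteq> ?X (Suc k)" for k
    by (induction k) (auto simp: lB csubspace_0[OF D(1)])
  have BX: "B x \<in> ?X d" if "x \<in> ?X d" for x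
    using Xinc[of d] that by auto
  \<comment> \<open>Induction on \<open>k\<close> gives B x = 0, so \<open>x\<close> lies in the
    kernel of \<open>B\<close> in \<open>W\<close> and in its complement \<open>D\<close>.\<close>
  have XW: "x = 0" if "x \<in> ?X k" "x \<in> W" for k x
    using that
  proof (induction k arbitrary: x)
    case (Suc k)
    then have "B x = 0" using BW by auto
    then show ?case using Suc.prems D(3) by (auto simp: null_space_def)
  qed simp
  have XN: "(B ^^ k) x = 0" if "x \<in> ?X k" for k x
    using that by (induction k arbitrary: x) (auto simp: funpow_swap1)
  \<comment> \<open>Surjectivity on \<open>W\<close> and the splitting along \<open>D\<close> pull
    the decomposition of B x back to \<open>x\<close>. For k = d the premise holds for every
    \<open>x\<close>, so the nilpotent part and \<open>W\<close> span the space.\<close>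
  have sum: "\<exists>z\<in>?X k. \<exists>w\<in>W. x = z + w" if "(B ^^ k) x \<in> W" for k x
    using that
  proof (induction k arbitrary: x)
    case 0
    then show ?case by simp
  next
    case (Suc k)
    then obtain z w where zw: "z \<in> ?X k" "w \<in> W" "B x = z + w" by (metis comp_apply funpow_Suc_right)
    obtain w' where w': "w' \<in> W" "w = B w'" using zw(2) surj unfolding W_def by blast
    have "x - w' \<in> (null_space B \<inter> W) + D" using D(4) by simp
    then obtain k' \<delta> where kd: "B k' = 0" "k' \<in> W" "\<delta> \<in> D" "x - w' = k' + \<delta>"
      by (auto simp: set_plus_def null_space_def)
    have "B \<delta> = B (x - w')" using kd(1,4) by (simp add: lB)
    also have "\<dots> = z" using zw(3) w'(2) by (simp add: lB)
    finally have "\<delta> \<in> ?X (Suc k)" using kd(3) zw(1) by simp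
    moreover have "w' + k' \<in> W" using w'(1) kd(2) by (rule csubspace_add[OF W(1)])
    moreover have "x = \<delta> + (w' + k')" using kd(4) by (simp add: algebra_simps)
    ultimately show ?case by blast
  qed
  \<comment> \<open>Dropping the kernel component of a preimage in \<open>W\<close> leaves one in W
    \<inter> D.\<close>
  have lift: "\<exists>u\<in>W \<inter> D. B u = w" if w: "w \<in> W" for w
  proof -
    obtain w' where w': "w' \<in> W" "w = B w'" using w surj unfolding W_def by blast
    have "w' \<in> (null_space B \<inter> W) + D" using D(4) by simp
    then obtain k' \<delta> where kd: "B k' = 0" "k' \<in> W" "\<delta> \<in> D" "w' = k' + \<delta>"
      by (auto simp: set_plus_def null_space_def)
    have "\<delta> = w' - k'" using kd(4) by simp
    then have "\<delta> \<in> W" using w'(1) kd(2) csubspace_diff[OF W(1)] by simp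
    moreover have "B \<delta> = w" using kd(1,4) w'(2) by (simp add: lB)
    ultimately show ?thesis using kd(3) by blast
  qed
  have decomp: "\<exists>u\<in>W \<inter> D. \<exists>z\<in>?X d. x = B u + z" for x
  proof -
    obtain z w where "z \<in> ?X d" "w \<in> W" "x = z + w" using sum[of d x] by (auto simp: W_def)
    then show ?thesis using lift[of w] by (metis add.commute)
  qed
  define h where "h = (\<lambda>z :: 'a \<times> 'a. B (fst z) + snd z)"
  have h: "bounded_linear h" unfolding h_def
    by (intro bounded_linear_add bounded_linear_compose[OF bounded_clinear_imp_bounded_linear[OF B]]
        bounded_linear_fst bounded_linear_snd)
  let ?E = "(W \<inter> D) \<times> ?X d"
  have E: "subspace ?E" "closed ?E"
    using W D X by (auto intro!: subspace_Times closed_Times csubspace_imp_subspace csubspace_Int)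
  have hE: "h ` ?E = UNIV"
    using decomp by (force simp: h_def image_iff)
  have clE: "closed (h ` ?E)" by (simp only: hE closed_UNIV)
  obtain \<kappa> where \<kappa>: "\<kappa> > 0" "\<forall>y\<in>h ` ?E. \<exists>x\<in>?E. h x = y \<and> norm x \<le> \<kappa> * norm y"
    using open_mapping_bound[OF h E clE] by blast
  have bound: "\<exists>z\<in>?E. h z = y \<and> norm z \<le> \<kappa> * norm y" for y
    using bspec[OF \<kappa>(2), of y] by (simp only: hE UNIV_I)
  \<comment> \<open>\<open>S\<close> inverts \<open>B\<close> as a bijection from W \<inter> D onto
    \<open>W\<close> and vanishes on the nilpotent part.\<close>
  define G where "G x u \<longleftrightarrow> u \<in> W \<inter> D \<and> x - B u \<in> ?X d" for x u
  have WD: "csubspace (W \<inter> D)" by (intro csubspace_Int W D)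
  obtain S where S: "bounded_clinear S" "\<And>x y. G x y \<longleftrightarrow> S x = y"
  proof (rule bounded_clinear_of_graph[of G \<kappa>])
    fix x y x' y' assume "G x y" "G x' y'"
    moreover have "(x + x') - B (y + y') = (x - B y) + (x' - B y')" by (simp add: lB)
    ultimately show "G (x + x') (y + y')" unfolding G_def
      using csubspace_add[OF X(1)] csubspace_add[OF WD] by metis
  next
    fix c x y assume "G x y"
    moreover have "c *\<^sub>C x - B (c *\<^sub>C y) = c *\<^sub>C (x - B y)" by (simp add: lB complex_vector.scale_right_diff_distrib)
    ultimately show "G (c *\<^sub>C x) (c *\<^sub>C y)" unfolding G_def
      using csubspace_scale[OF X(1)] csubspace_scale[OF WD] by metis
  next
    fix x y y' assume G: "G x y" "G x y'"
    have "y - y' \<in> W \<inter> D" using G csubspace_diff[OF WD] unfolding G_def by blast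
    moreover have "B (y - y') = (x - B y') - (x - B y)" by (simp add: lB)
    then have "B (y - y') \<in> ?X d" using G csubspace_diff[OF X(1)] unfolding G_def by metis
    ultimately have "B (y - y') = 0" using XW[of "B (y - y')" d] BW by blast
    then have "y - y' \<in> (null_space B \<inter> W) \<inter> D" using \<open>y - y' \<in> W \<inter> D\<close> by (simp add: null_space_def)
    then show "y = y'" using D(3) by simp
  next
    fix x
    obtain z where z: "z \<in> ?E" "h z = x" "norm z \<le> \<kappa> * norm x" using bound[of x] by blast
    have "G x (fst z)" unfolding G_def using z(1,2) by (auto simp: h_def)
    moreover have "norm (fst z) \<le> \<kappa> * norm x" using norm_fst_le[of "fst z" "snd z"] z(3) by simp
    ultimately show "\<exists>u. G x u \<and> norm u \<le> \<kappa> * norm x" by blast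
  qed (rule that)
  have SG: "S x \<in> W" "x - B (S x) \<in> ?X d" for x using S(2)[of x "S x"] by (auto simp: G_def)
  have BS: "B (S (w + z)) = w" if "w \<in> W" "z \<in> ?X d" for w z
  proof -
    have "B (S (w + z)) - w = z - ((w + z) - B (S (w + z)))" by simp
    also have "\<dots> \<in> ?X d" by (rule csubspace_diff[OF X(1) that(2) SG(2)])
    finally have "B (S (w + z)) - w = 0"
      using XW csubspace_diff[OF W(1) BW[OF SG(1)] that(1)] by blast
    then show ?thesis by simp
  qed
  show thesis
  proof (rule that[OF S(1)])
    show "range S \<subseteq> range (B ^^ d)" using SG(1) by (auto simp: W_def)
    fix x
    obtain z w where "z \<in> ?X d" "w \<in> W" "x = z + w" using sum[of d x] by (auto simp: W_def)
    then have wz: "w \<in> W" "z \<in> ?X d" "x = w + z" by (simp_all add: add.commute)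
    show "B (S (B x)) = B (B (S x))"
      using BS[OF BW[OF wz(1)] BX[OF wz(2)]] BS[OF wz(1,2)] wz(3) by (simp add: lB)
    show "B (S (S x)) = S x" using BS[OF SG(1)[of x] csubspace_0[OF X(1)]] by simp
    have "(B ^^ Suc d) (S x) = (B ^^ d) w" using BS[OF wz(1,2)] wz(3) by (simp add: funpow_swap1)
    also have "\<dots> = (B ^^ d) x" using wz(3) XN[OF wz(2)] clinear_simps[OF clinear_funpow[OF cB]] by simp
    finally show "(B ^^ Suc d) (S x) = (B ^^ d) x" .
  qed
qed

lemma right_drazin_criterion:
  fixes B :: "'a::complex_banach \<Rightarrow> 'a"
  assumes "bounded_clinear B" "B ` range (B ^^ d) = range (B ^^ d)" "closed (range (B ^^ d))"
    and "topologically_complemented (null_space B \<inter> range (B ^^ d))"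
  shows "right_drazin_invertible B"
proof -
  obtain S where "bounded_clinear S" "range S \<subseteq> range (B ^^ d)"
    "\<And>x. B (S (B x)) = B (B (S x))" "\<And>x. B (S (S x)) = S x" "\<And>x. (B ^^ Suc d) (S x) = (B ^^ d) x"
    using right_drazin_inverse_exists[OF assms] by blast
  then show ?thesis unfolding right_drazin_invertible_def
    by (intro exI[of _ S] conjI exI[of _ d]) (auto simp: fun_eq_iff numeral_2_eq_2)
qed

text \<open>The right inverse commutes with \<open>B\<close>: since \<open>S\<close> has values in
  \<open>W\<close>, the commutator lies in \<open>W\<close>, and \<open>B\<close> annihilates it, so
  injectivity on \<open>W\<close> makes it 0.\<close>

lemma drazin_criterion:
  fixes B :: "'a::complex_banach \<Rightarrow> 'a"
  assumes B: "bounded_clinear B" and surj: "B ` range (B ^^ d) = range (B ^^ d)"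
    and cl: "closed (range (B ^^ d))" and inj: "null_space B \<inter> range (B ^^ d) = {0}"
  shows "drazin_invertible B"
proof -
  note lB = clinear_simps[OF bounded_clinearD[OF B]]
  have "topologically_complemented {0::'a}" unfolding topologically_complemented_def
    by (auto intro!: exI[of _ UNIV] simp: set_plus_def)
  then obtain S where S: "bounded_clinear S" "range S \<subseteq> range (B ^^ d)"
    "\<And>x. B (S (B x)) = B (B (S x))" "\<And>x. B (S (S x)) = S x" "\<And>x. (B ^^ Suc d) (S x) = (B ^^ d) x"
    using right_drazin_inverse_exists[OF B surj cl] inj by metis
  have comm: "S (B x) = B (S x)" for x
  proof -
    have "B (S x) \<in> range (B ^^ d)" "S (B x) \<in> range (B ^^ d)" using S(2) surj by blast+
    then have "S (B x) - B (S x) \<in> null_space B \<inter> range (B ^^ d)"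
      using csubspace_diff[OF csubspace_range_funpow[OF bounded_clinearD[OF B]]]
      by (simp add: null_space_def lB S(3))
    then show ?thesis using inj by simp
  qed
  then show ?thesis unfolding drazin_invertible_def using S
    by (intro exI[of _ S] conjI exI[of _ d]) (auto simp: fun_eq_iff numeral_2_eq_2)
qed

section \<open>The spectra\<close>

lemma finite_rank_equiv_perturbation:
  assumes "bounded_clinear A" "F \<in> finite_rank_operators"
  shows "finite_rank_equiv (\<lambda>x. A x + F x) A"
  using assms by (simp add: finite_rank_equiv_def finite_rank_iff bounded_clinear_add)

lemma finite_independent_basis:
  assumes "csubspace V" "cdimension V < \<infinity>"
  obtains B where "finite B" "cindependent B" "cspan B = V" "enat (card B) = cdimension V"
proof -
  obtain B where B: "cindependent B" "cspan B = V" using csubspace_basis[OF assms(1)] by blast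
  then have "finite B" using cdimension_cspan[of B] assms(2) by (auto split: if_splits)
  then show thesis using that B cdimension_cspan[of B] by auto
qed

lemma finite_mod_basis:
  assumes W: "csubspace W" and N: "csubspace N" "N \<subseteq> W" and fin: "quotient_dimension W N < \<infinity>"
  obtains C where "finite C" "C \<subseteq> W" "cindependent C" "cspan C \<inter> N = {0}" "W = cspan C + N"
    "enat (card C) = quotient_dimension W N"
proof -
  have "W \<preceq> N" using almost_subset_iff_quotient[OF W N] fin by blast
  then obtain C where C: "finite C" "quotient_basis W N C" "enat (card C) = quotient_dimension W N"
    using finite_quotient_basis_exists[OF W N] by blast
  have "C \<subseteq> W" "W = cspan C + N" using C(2) by (auto simp: quotient_basis_def)
  moreover have "c \<notin> cspan (C - {c})" if "c \<in> C" for c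
    using C(2) that subset_plus_left[OF N(1)] unfolding quotient_basis_def by blast
  then have "cindependent C" by (auto simp: complex_vector.dependent_def)
  moreover have "cspan C \<inter> N = {0}" by (rule quotient_basis_Int[OF W N C(2)])
  ultimately show thesis using that C(1,3) by blast
qed

lemma image_range_funpow_subset: "A ` range ((A :: 'a \<Rightarrow> 'a) ^^ n) \<subseteq> range (A ^^ n)"
  unfolding image_range_funpow by (rule range_funpow_antimono) simp

text \<open>The d-th power of A + F lands in \<open>W\<close>, where A + F is injective; the ascent
  is thus at most \<open>d\<close>.\<close>

lemma null_space_funpow_perturbation:
  fixes A :: "'a::complex_vector \<Rightarrow> 'a"
  assumes A: "clinear A" and F: "range F \<subseteq> range (A ^^ d)"
    and inj: "\<And>w. w \<in> range (A ^^ d) \<Longrightarrow> A w + F w = 0 \<Longrightarrow> w = 0"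
  shows "null_space ((\<lambda>x. A x + F x) ^^ Suc d) \<subseteq> null_space ((\<lambda>x. A x + F x) ^^ d)"
  using inj funpow_perturbation_range[OF A F] by (auto simp: null_space_def image_subset_iff)

text \<open>With B = A + F mapping \<open>W\<close> onto itself, W = B^d(W) lies in the range of
  B^d, which lies in \<open>W\<close>.\<close>

lemma range_funpow_perturbation:
  fixes A :: "'a::complex_vector \<Rightarrow> 'a"
  assumes A: "clinear A" and F: "range F \<subseteq> range (A ^^ d)"
    and surj: "range (A ^^ d) \<subseteq> (\<lambda>x. A x + F x) ` range (A ^^ d)"
  shows "range ((\<lambda>x. A x + F x) ^^ d) = range (A ^^ d)"
    and "(\<lambda>x. A x + F x) ` range (A ^^ d) = range (A ^^ d)"
proof -
  let ?W = "range (A ^^ d)" and ?B = "\<lambda>x. A x + F x"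
  have sub: "?B ` ?W \<subseteq> ?W"
    using image_range_funpow_subset[of A d] F
    by (auto intro!: csubspace_add[OF csubspace_range_funpow[OF A]])
  then show eq: "?B ` ?W = ?W" using surj by blast
  have pow: "(?B ^^ n) ` ?W = ?W" for n
  proof (induction n)
    case (Suc n)
    have "(?B ^^ Suc n) ` ?W = ?B ` (?B ^^ n) ` ?W" by (simp only: funpow.simps image_comp comp_assoc)
    then show ?case by (simp only: Suc eq)
  qed simp
  have "(?B ^^ d) ` ?W \<subseteq> range (?B ^^ d)" by (rule image_mono) simp
  then have "?W \<subseteq> range (?B ^^ d)" by (simp only: pow)
  then show "range (?B ^^ d) = ?W" using funpow_perturbation_range[OF A F] by blast
qed

text \<open>The defect may be infinite, so \<open>C\<close> is only as large as the kernel and need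
  not span a complement of A(W): injectivity is what is gained.\<close>

lemma left_drazin_perturbation:
  fixes A :: "'a::complex_banach \<Rightarrow> 'a"
  assumes A: "bounded_clinear A" and lb: "left_b_fredholm A" and ind: "b_fredholm_index A \<le> 0"
  shows "\<exists>F\<in>finite_rank_operators. left_drazin_invertible (\<lambda>x. A x + F x)"
proof -
  note lA = bounded_clinearD[OF A]
  obtain d where d: "dis A = enat d" "cdimension (null_space A \<inter> range (A ^^ d)) < \<infinity>"
    "topologically_complemented (range A + null_space (A ^^ d))"
    using lb by (auto simp: left_b_fredholm_def)
  let ?W = "range (A ^^ d)"
  have W: "csubspace ?W" by (rule csubspace_range_funpow[OF lA])
  have K: "csubspace (null_space A \<inter> ?W)" by (intro csubspace_Int csubspace_null_space lA W)
  \<comment> \<open>Closedness at \<open>d\<close> and at \<open>Suc d\<close> makes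
    \<open>W\<close> an admissible restriction, so the index hypothesis becomes an inequality
    between nullity and defect on \<open>W\<close>.\<close>
  have cl: "closed (range (A ^^ n))" if "n \<ge> d" for n
    using d(3) by (intro closed_range_funpow_of_dis[OF A dis_eq_enatD[OF d(1)] closed_of_finite_cdimension[OF d(2)] _ that])
      (auto simp: topologically_complemented_def)
  have AW: "csubspace (A ` ?W)" "A ` ?W \<subseteq> ?W" by (rule csubspace_image[OF lA W]) (rule image_range_funpow_subset)
  have "closed (A ` ?W)" unfolding image_range_funpow by (rule cl) simp
  then have "upper_semi_fredholm_on ?W A"
    unfolding upper_semi_fredholm_on_def using d(2) AW(2) closed_subset by blast
  then have "fredholm_index_on ?W A \<le> 0" using b_fredholm_index_eq[OF lA cl[OF order_refl]] ind by simp
  then have le: "cdimension (null_space A \<inter> ?W) \<le> quotient_dimension ?W (A ` ?W)"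
    using index_nonpos_iff[OF d(2)] by blast
  obtain B where B: "finite B" "cindependent B" "cspan B = null_space A \<inter> ?W"
    "enat (card B) = cdimension (null_space A \<inter> ?W)"
    using finite_independent_basis[OF K d(2)] by blast
  obtain C where C: "finite C" "card C = card B" "C \<subseteq> ?W" "cindependent C" "cspan C \<inter> A ` ?W = {0}"
    using independent_mod_exists[OF W AW, of "card B"] le B(4) by auto
  have BK: "B \<subseteq> null_space A \<inter> ?W" using B(3) complex_vector.span_superset by blast
  obtain F where F: "F \<in> finite_rank_operators" "range F \<subseteq> ?W"
    "cspan B = null_space A \<inter> ?W \<longrightarrow> (\<forall>w\<in>?W. A w + F w = 0 \<longrightarrow> w = 0)"
    "?W = cspan C + A ` ?W \<longrightarrow> ?W \<subseteq> (\<lambda>x. A x + F x) ` ?W"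
    by (rule finite_rank_perturbation[OF lA W B(1,2) BK C(1,4,3,5) C(2)[symmetric]])
  have inj: "w = 0" if "w \<in> ?W" "A w + F w = 0" for w using F(3) B(3) that by blast
  let ?B = "\<lambda>x. A x + F x"
  have eqv: "finite_rank_equiv ?B A" by (rule finite_rank_equiv_perturbation[OF A F(1)])
  then have bB: "bounded_clinear ?B" by (simp add: finite_rank_equiv_def)
  \<comment> \<open>The complement found for \<open>A\<close> survives because the sums for
    \<open>A\<close> and \<open>?B\<close> are commensurable and the new sum is closed.\<close>
  have tc: "topologically_complemented (range ?B + null_space (?B ^^ d))"
  proof (rule topologically_complemented_commensurable[OF d(3)])
    show "csubspace (range ?B + null_space (?B ^^ d))"
      by (rule csubspace_range_plus_null_space[OF bounded_clinearD[OF bB]])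
    show "closed (range ?B + null_space (?B ^^ d))"
      by (rule closed_range_plus_null_space[OF bB finite_rank_equiv_closed_range[OF finite_rank_equiv_funpow[OF eqv] cl]])
        simp
  qed (rule finite_rank_equiv_kernels(2)[OF eqv], rule finite_rank_equiv_kernels(2)[OF finite_rank_equiv_sym[OF eqv]])
  have "null_space (?B ^^ Suc d) \<subseteq> null_space (?B ^^ d)"
    by (rule null_space_funpow_perturbation[OF lA F(2)]) (rule inj)
  from left_drazin_criterion[OF bB this tc] have "left_drazin_invertible ?B" .
  then show ?thesis using F(1) by blast
qed

text \<open>Here the kernel may be infinite-dimensional: \<open>C\<close> spans a full complement of
  A(W), while \<open>B\<close> is an independent set of the same size in the kernel.\<close>

lemma right_drazin_perturbation:
  fixes A :: "'a::complex_banach \<Rightarrow> 'a"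
  assumes A: "bounded_clinear A" and rb: "right_b_fredholm A" and ind: "b_fredholm_index A \<ge> 0"
  shows "\<exists>F\<in>finite_rank_operators. right_drazin_invertible (\<lambda>x. A x + F x)"
proof -
  note lA = bounded_clinearD[OF A]
  obtain d where d: "dis A = enat d" "closed (range A + null_space (A ^^ d))"
    "quotient_dimension UNIV (range A + null_space (A ^^ d)) < \<infinity>"
    "topologically_complemented (null_space A \<inter> range (A ^^ d))"
    using rb by (auto simp: right_b_fredholm_def)
  let ?W = "range (A ^^ d)"
  have W: "csubspace ?W" by (rule csubspace_range_funpow[OF lA])
  have K: "csubspace (null_space A \<inter> ?W)" by (intro csubspace_Int csubspace_null_space lA W)
  have clK: "closed (null_space A \<inter> ?W)" using d(4) by (simp add: topologically_complemented_def)
  have cl: "closed (range (A ^^ n))" if "n \<ge> d" for n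
    by (rule closed_range_funpow_of_dis[OF A dis_eq_enatD[OF d(1)] clK d(2) that])
  have AW: "csubspace (A ` ?W)" "A ` ?W \<subseteq> ?W" by (rule csubspace_image[OF lA W]) (rule image_range_funpow_subset)
  \<comment> \<open>Applying A^d to this turns finite codimension in the whole space into finite
    codimension of A(W) in \<open>W\<close>.\<close>
  have "UNIV \<preceq> range A + null_space (A ^^ d)"
    using almost_subset_iff_quotient[OF csubspace_UNIV csubspace_range_plus_null_space[OF lA]] d(3) by simp
  then have "?W \<preceq> (A ^^ d) ` (range A + null_space (A ^^ d))"
    by (rule almost_subset_image[OF clinear_funpow[OF lA]])
  moreover have "(A ^^ d) ` (range A + null_space (A ^^ d)) \<subseteq> A ` ?W"
    unfolding range_plus_null_space_funpow_1[OF lA] image_range_funpow by blast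
  ultimately have "?W \<preceq> A ` ?W" by (rule almost_subset_mono[OF order_refl])
  then have fin: "quotient_dimension ?W (A ` ?W) < \<infinity>" using almost_subset_iff_quotient[OF W AW] by blast
  then have "lower_semi_fredholm_on ?W A" by (simp add: lower_semi_fredholm_on_def)
  then have "fredholm_index_on ?W A \<ge> 0" using b_fredholm_index_eq[OF lA cl[OF order_refl]] ind by simp
  then have le: "quotient_dimension ?W (A ` ?W) \<le> cdimension (null_space A \<inter> ?W)"
    using index_nonneg_iff[OF fin] by blast
  obtain C where C: "finite C" "C \<subseteq> ?W" "cindependent C" "cspan C \<inter> A ` ?W = {0}" "?W = cspan C + A ` ?W"
    "enat (card C) = quotient_dimension ?W (A ` ?W)"
    using finite_mod_basis[OF W AW fin] by blast
  have "enat (card C) \<le> quotient_dimension (null_space A \<inter> ?W) {0}"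
    using le C(6) by (simp add: quotient_dimension_zero[OF K])
  moreover have "{0} \<subseteq> null_space A \<inter> ?W" using csubspace_0[OF K] by simp
  ultimately obtain B where B: "finite B" "card B = card C" "B \<subseteq> null_space A \<inter> ?W" "cindependent B"
    "cspan B \<inter> {0} = {0}"
    using independent_mod_exists[OF K complex_vector.subspace_single_0] by metis
  obtain F where F: "F \<in> finite_rank_operators" "range F \<subseteq> ?W"
    "cspan B = null_space A \<inter> ?W \<longrightarrow> (\<forall>w\<in>?W. A w + F w = 0 \<longrightarrow> w = 0)"
    "?W = cspan C + A ` ?W \<longrightarrow> ?W \<subseteq> (\<lambda>x. A x + F x) ` ?W"
    by (rule finite_rank_perturbation[OF lA W B(1,4,3) C(1,3,2,4) B(2)])
  have surj: "?W \<subseteq> (\<lambda>x. A x + F x) ` ?W" using F(4) C(5) by blast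
  let ?B = "\<lambda>x. A x + F x"
  note R = range_funpow_perturbation[OF lA F(2) surj]
  have eqv: "finite_rank_equiv ?B A" by (rule finite_rank_equiv_perturbation[OF A F(1)])
  then have bB: "bounded_clinear ?B" by (simp add: finite_rank_equiv_def)
  have clB: "closed (range (?B ^^ d))" unfolding R(1) by (rule cl[OF order_refl])
  have "topologically_complemented (null_space ?B \<inter> range (?B ^^ d))"
  proof (rule topologically_complemented_commensurable[OF d(4)])
    show "csubspace (null_space ?B \<inter> range (?B ^^ d))"
      by (intro csubspace_Int csubspace_null_space csubspace_range_funpow bounded_clinearD bB)
    show "closed (null_space ?B \<inter> range (?B ^^ d))" by (intro closed_Int closed_null_space bB clB)
  qed (rule finite_rank_equiv_kernels(1)[OF eqv], rule finite_rank_equiv_kernels(1)[OF finite_rank_equiv_sym[OF eqv]])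
  moreover have "?B ` range (?B ^^ d) = range (?B ^^ d)" unfolding R(1) by (rule R(2))
  ultimately have "right_drazin_invertible ?B" using right_drazin_criterion[OF bB _ clB] by blast
  then show ?thesis using F(1) by blast
qed

text \<open>\<open>d\<close> is any exponent from the definition of B-Fredholm. Nullity and defect
  are finite and equal, so full bases of kernel and cokernel are matched, and \<open>?B\<close>
  becomes bijective on \<open>W\<close>.\<close>

lemma drazin_perturbation:
  fixes A :: "'a::complex_banach \<Rightarrow> 'a"
  assumes A: "bounded_clinear A" and bf: "b_fredholm A" and ind: "b_fredholm_index A = 0"
  shows "\<exists>F\<in>finite_rank_operators. drazin_invertible (\<lambda>x. A x + F x)"
proof -
  note lA = bounded_clinearD[OF A]
  obtain d where cl: "closed (range (A ^^ d))"
    and us: "upper_semi_fredholm_on (range (A ^^ d)) A" and ls: "lower_semi_fredholm_on (range (A ^^ d)) A"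
    using bf by (auto simp: b_fredholm_def fredholm_on_def)
  let ?W = "range (A ^^ d)"
  have W: "csubspace ?W" by (rule csubspace_range_funpow[OF lA])
  have K: "csubspace (null_space A \<inter> ?W)" by (intro csubspace_Int csubspace_null_space lA W)
  have AW: "csubspace (A ` ?W)" "A ` ?W \<subseteq> ?W" by (rule csubspace_image[OF lA W]) (rule image_range_funpow_subset)
  have fin: "cdimension (null_space A \<inter> ?W) < \<infinity>" "quotient_dimension ?W (A ` ?W) < \<infinity>"
    using us ls by (simp_all add: upper_semi_fredholm_on_def lower_semi_fredholm_on_def)
  have "fredholm_index_on ?W A = 0" using b_fredholm_index_eq[OF lA cl] us ind by simp
  then have eq: "cdimension (null_space A \<inter> ?W) = quotient_dimension ?W (A ` ?W)"
    using index_nonpos_iff[OF fin(1)] index_nonneg_iff[OF fin(2)] by (simp add: order_antisym)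
  obtain B where B: "finite B" "cindependent B" "cspan B = null_space A \<inter> ?W"
    "enat (card B) = cdimension (null_space A \<inter> ?W)"
    using finite_independent_basis[OF K fin(1)] by blast
  obtain C where C: "finite C" "C \<subseteq> ?W" "cindependent C" "cspan C \<inter> A ` ?W = {0}" "?W = cspan C + A ` ?W"
    "enat (card C) = quotient_dimension ?W (A ` ?W)"
    using finite_mod_basis[OF W AW fin(2)] by blast
  have card: "card B = card C" using B(4) C(6) eq by (metis enat.inject)
  have BK: "B \<subseteq> null_space A \<inter> ?W" using B(3) complex_vector.span_superset by blast
  obtain F where F: "F \<in> finite_rank_operators" "range F \<subseteq> ?W"
    "cspan B = null_space A \<inter> ?W \<longrightarrow> (\<forall>w\<in>?W. A w + F w = 0 \<longrightarrow> w = 0)"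
    "?W = cspan C + A ` ?W \<longrightarrow> ?W \<subseteq> (\<lambda>x. A x + F x) ` ?W"
    by (rule finite_rank_perturbation[OF lA W B(1,2) BK C(1,3,2,4) card])
  have inj: "w = 0" if "w \<in> ?W" "A w + F w = 0" for w using F(3) B(3) that by blast
  have surj: "?W \<subseteq> (\<lambda>x. A x + F x) ` ?W" using F(4) C(5) by blast
  let ?B = "\<lambda>x. A x + F x"
  note R = range_funpow_perturbation[OF lA F(2) surj]
  have bB: "bounded_clinear ?B" using F(1) A by (simp add: finite_rank_iff bounded_clinear_add)
  have "null_space ?B \<inter> range (?B ^^ d) = {0}"
    unfolding R(1) using inj csubspace_0[OF W]
      clinear_simps(4)[OF bounded_clinearD[OF bB]] by (auto simp: null_space_def)
  moreover have "?B ` range (?B ^^ d) = range (?B ^^ d)" unfolding R(1) by (rule R(2))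
  moreover have "closed (range (?B ^^ d))" unfolding R(1) by (rule cl)
  ultimately have "drazin_invertible ?B" using drazin_criterion[OF bB] by blast
  then show ?thesis using F(1) by blast
qed

text \<open>Reduces each identity of spectra to an equivalence for a single operator. Perturbing
  \<open>T\<close> by \<open>F\<close> perturbs \<mu> - T by - F, and the finite rank operators are
  closed under negation.\<close>

lemma finite_rank_perturbation_spectrum:
  fixes T :: "'a::complex_normed_vector \<Rightarrow> 'a"
  assumes T: "bounded_clinear T"
    and eqv: "\<And>A. bounded_clinear A \<Longrightarrow> P A \<longleftrightarrow> (\<exists>F\<in>finite_rank_operators. Q (\<lambda>x. A x + F x))"
  shows "{\<mu>. \<not> P (shifted_op \<mu> T)} =
    (\<Inter>F\<in>finite_rank_operators. {\<mu>. \<not> Q (shifted_op \<mu> (\<lambda>x. T x + F x))})"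
proof -
  have "P (shifted_op \<mu> T) \<longleftrightarrow> (\<exists>F\<in>finite_rank_operators. Q (shifted_op \<mu> (\<lambda>x. T x + F x)))" for \<mu>
  proof -
    have "bounded_clinear (shifted_op \<mu> T)"
      unfolding shifted_op_def by (intro bounded_clinear_diff bounded_clinear_scaleC_right T)
    then have "P (shifted_op \<mu> T) \<longleftrightarrow> (\<exists>F\<in>finite_rank_operators. Q (\<lambda>x. shifted_op \<mu> T x + F x))"
      by (rule eqv)
    also have "\<dots> \<longleftrightarrow> (\<exists>F\<in>finite_rank_operators. Q (\<lambda>x. shifted_op \<mu> T x + - F x))"
    proof
      assume "\<exists>F\<in>finite_rank_operators. Q (\<lambda>x. shifted_op \<mu> T x + F x)"
      then obtain F where "F \<in> finite_rank_operators" "Q (\<lambda>x. shifted_op \<mu> T x + F x)" by blast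
      then show "\<exists>F\<in>finite_rank_operators. Q (\<lambda>x. shifted_op \<mu> T x + - F x)"
        using finite_rank_minus[of F] by (intro bexI[of _ "\<lambda>x. - F x"]) simp_all
    next
      assume "\<exists>F\<in>finite_rank_operators. Q (\<lambda>x. shifted_op \<mu> T x + - F x)"
      then obtain F where "F \<in> finite_rank_operators" "Q (\<lambda>x. shifted_op \<mu> T x + - F x)" by blast
      then show "\<exists>F\<in>finite_rank_operators. Q (\<lambda>x. shifted_op \<mu> T x + F x)"
        using finite_rank_minus[of F] by (intro bexI[of _ "\<lambda>x. - F x"]) simp_all
    qed
    also have "\<dots> \<longleftrightarrow> (\<exists>F\<in>finite_rank_operators. Q (shifted_op \<mu> (\<lambda>x. T x + F x)))"
      by (simp add: shifted_op_def diff_diff_add)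
    finally show ?thesis .
  qed
  then show ?thesis by blast
qed

theorem theorem3p22:
  fixes T :: "'a::complex_banach \<Rightarrow> 'a"
  assumes "bounded_clinear T"
  shows "left_b_fredholm_minus_spectrum T =
           (\<Inter>F\<in>finite_rank_operators. left_drazin_spectrum (\<lambda>x. T x + F x)) \<and>
         right_b_fredholm_minus_spectrum T =
           (\<Inter>F\<in>finite_rank_operators. right_drazin_spectrum (\<lambda>x. T x + F x)) \<and>
         b_weyl_spectrum T =
           (\<Inter>F\<in>finite_rank_operators. drazin_spectrum (\<lambda>x. T x + F x))"
  unfolding left_b_fredholm_minus_spectrum_def left_drazin_spectrum_def
    right_b_fredholm_minus_spectrum_def right_drazin_spectrum_def b_weyl_spectrum_def drazin_spectrum_def
proof (intro conjI finite_rank_perturbation_spectrum[OF assms])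
  fix A :: "'a \<Rightarrow> 'a" assume A: "bounded_clinear A"
  note eqv = finite_rank_equiv_sym[OF finite_rank_equiv_perturbation[OF A]]
  show "left_b_fredholm A \<and> b_fredholm_index A \<le> 0 \<longleftrightarrow>
      (\<exists>F\<in>finite_rank_operators. left_drazin_invertible (\<lambda>x. A x + F x))"
    using left_drazin_perturbation[OF A] left_b_fredholm_of_left_drazin_equiv[OF eqv] by blast
  show "right_b_fredholm A \<and> b_fredholm_index A \<ge> 0 \<longleftrightarrow>
      (\<exists>F\<in>finite_rank_operators. right_drazin_invertible (\<lambda>x. A x + F x))"
    using right_drazin_perturbation[OF A] right_b_fredholm_of_right_drazin_equiv[OF eqv] by blast
  show "b_fredholm A \<and> b_fredholm_index A = 0 \<longleftrightarrow>
      (\<exists>F\<in>finite_rank_operators. drazin_invertible (\<lambda>x. A x + F x))"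
    using drazin_perturbation[OF A] b_weyl_of_drazin_equiv[OF eqv] by blast
qed

end
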